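(* Let $\Omega\subset\mathbb{R}^2$ be a convex open bounded set and let $M>0$. Then $$\inf_{B\in B_{\Omega,M}}R(B)=0=\inf_{B\in D_{\Omega,M}}R(B),$$ where $R(B)=\int_\Omega\frac{1+v_3^+(x;B)}{2}\,dx$ and the classes of bodies $B_{\Omega,M}$, $D_{\Omega,M}$ and the final velocity $v^+(x;B)$ are as defined in the context.
   Context: Coordinates in $\mathbb{R}^3$ are $(x,z)$ with $x=(x_1,x_2)\in\mathbb{R}^2$. The set $\Omega\subset\mathbb{R}^2$ is convex, open and bounded, and $M>0$. Billiard scattering. For a body $B\subset\mathbb{R}^3$ consider the billiard (elastic reflection) in $\mathbb{R}^3\setminus B$. Suppose a particle initially moves according to $x(t)=x$, $z(t)=-t$ (velocity $v=(0,0,-1)$), then makes finitely many (maybe no) reflections at regular (smooth) points of $\partial B$, and finally moves freely; its final velocity is denoted by $v^+(x;B)=(v_1^+(x;B),v_2^+(x;B),v_3^+(x;B))$. At a reflection at a point with unit normal $n$, the velocity $w$ is replaced by $w-2\langle w,n\rangle n$. The scattering is called regular if $v^+(\cdot;B)$ is defined on a full-measure subset of $\mathbb{R}^2$ and is measurable. $B_{\Omega,M}$ is the class of 3D domains $B$ (bodies, not required to be connected) such that the surface $\partial B\setminus(\partial\Omega\times\mathbb{R})$ is piecewise smooth and (a) $\bar\Omega\times\{0\}\subset B\subset\bar\Omega\times[0,M]$; (b) the corresponding billiard scattering is regular. A body $B\in B_{\Omega,M}$ satisfies the double impact condition (DIC) if each incident particle with the initial velocity $v=(0,0,-1)$ has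 no more than two reflections from $B$. $D_{\Omega,M}$ is the class of connected bodies in $B_{\Omega,M}$ satisfying DIC. *)

theory Defs
  imports "HOL-Analysis.Analysis"
begin

text \<open>Points \<open>(x, z)\<close> of three-dimensional space; the product type carries the Euclidean
  inner product and norm.\<close>

type_synonym space3 = "(real^2) \<times> real"


section \<open>Piecewise smooth surfaces\<close>

primrec Ck_on :: "nat \<Rightarrow> ('a::real_normed_vector \<Rightarrow> 'b::real_normed_vector) \<Rightarrow> 'a set \<Rightarrow> bool" where
  "Ck_on 0 f U \<longleftrightarrow> continuous_on U f"
| "Ck_on (Suc k) f U \<longleftrightarrow>
     (\<forall>x\<in>U. f differentiable (at x)) \<and> (\<forall>v. Ck_on k (\<lambda>x. frechet_derivative f (at x) v) U)"

text \<open>Infinitely differentiable; only meant for open \<open>U\<close>.\<close>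

definition smooth_on :: "('a::real_normed_vector \<Rightarrow> 'b::real_normed_vector) \<Rightarrow> 'a set \<Rightarrow> bool" where
  "smooth_on f U \<longleftrightarrow> (\<forall>k. Ck_on k f U)"

definition smooth_arc :: "(real \<Rightarrow> 'a::real_normed_vector) \<Rightarrow> bool" where
  "smooth_arc \<gamma> \<longleftrightarrow> arc \<gamma> \<and>
     (\<exists>I. open I \<and> {0..1} \<subseteq> I \<and> smooth_on \<gamma> I) \<and>
     (\<forall>t\<in>{0..1}. vector_derivative \<gamma> (at t) \<noteq> 0)"

definition planar_region :: "(real^2) set \<Rightarrow> bool" where
  "planar_region K \<longleftrightarrow> compact K \<and> closure (interior K) = K \<and>
     (\<exists>\<Gamma>. finite \<Gamma> \<and> (\<forall>\<gamma>\<in>\<Gamma>. smooth_arc \<gamma>) \<and> frontier K = (\<Union>\<gamma>\<in>\<Gamma>. path_image \<gamma>))"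

text \<open>The parametrization is smooth up to the boundary of the parameter region, but may degenerate
  on that boundary, so that for instance the apex of a cone is allowed.\<close>

definition surface_patch :: "(real^2) set \<Rightarrow> (real^2 \<Rightarrow> space3) \<Rightarrow> bool" where
  "surface_patch K \<phi> \<longleftrightarrow> planar_region K \<and>
     (\<exists>V. open V \<and> K \<subseteq> V \<and> smooth_on \<phi> V) \<and>
     (\<forall>u\<in>interior K. inj (frechet_derivative \<phi> (at u)))"

text \<open>Locally, a finite union of patches which meet (each other, and themselves) only along
  their boundaries. The surface need not be closed in space; finiteness is required near each of
  its own points.\<close>

definition piecewise_smooth_surface :: "space3 set \<Rightarrow> bool" where
  "piecewise_smooth_surface S \<longleftrightarrow>
     (\<forall>p\<in>S. \<exists>W (n::nat) K \<phi>. open W \<and> p \<in> W \<and>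
        (\<forall>i<n. surface_patch (K i) (\<phi> i)) \<and>
        S \<inter> W = (\<Union>i<n. \<phi> i ` K i) \<inter> W \<and>
        (\<forall>i<n. \<forall>j<n. \<forall>u\<in>interior (K i). \<forall>v\<in>K j.
            \<phi> i u = \<phi> j v \<and> \<phi> i u \<in> W \<longrightarrow> i = j \<and> u = v))"

text \<open>The vector \<open>n\<close> is one of the two unit normals to \<open>S\<close> at \<open>p\<close>, and \<open>S\<close> is a smooth embedded
  surface near \<open>p\<close>.\<close>

definition unit_normal :: "space3 set \<Rightarrow> space3 \<Rightarrow> space3 \<Rightarrow> bool" where
  "unit_normal S p n \<longleftrightarrow> p \<in> S \<and> norm n = 1 \<and>
     (\<exists>W g c. open W \<and> p \<in> W \<and> smooth_on g W \<and> S \<inter> W = {y \<in> W. g y = (0::real)} \<and>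
        c \<noteq> 0 \<and> GDERIV g p :> c *\<^sub>R n)"


section \<open>Billiard scattering\<close>

definition reflect :: "space3 \<Rightarrow> space3 \<Rightarrow> space3" where
  "reflect n w = w - (2 * (w \<bullet> n)) *\<^sub>R n"

text \<open>\<open>after_reflections B x k p w\<close>: the particle falling along \<open>(x, - t)\<close> makes \<open>k\<close> reflections (and
  possibly more later), and \<open>p\<close>, \<open>w\<close> are the point of the \<open>k\<close>-th one and the velocity after it.
  For \<open>k = 0\<close>, \<open>p\<close> is any point of the vertical line above which the line misses \<open>B\<close>.\<close>

inductive after_reflections :: "space3 set \<Rightarrow> real^2 \<Rightarrow> nat \<Rightarrow> space3 \<Rightarrow> space3 \<Rightarrow> bool"
  for B :: "space3 set" and x :: "real^2" where
  incoming: "(\<forall>z\<ge>h. (x, z) \<notin> B) \<Longrightarrow> after_reflections B x 0 (x, h) (0, -1)"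
| reflection: "\<lbrakk> after_reflections B x k p w; t > 0; \<forall>s\<in>{0<..<t}. p + s *\<^sub>R w \<notin> B;
      unit_normal (frontier B) (p + t *\<^sub>R w) n \<rbrakk>
      \<Longrightarrow> after_reflections B x (Suc k) (p + t *\<^sub>R w) (reflect n w)"

definition scatters_to :: "space3 set \<Rightarrow> real^2 \<Rightarrow> space3 \<Rightarrow> bool" where
  "scatters_to B x w \<longleftrightarrow> (\<exists>k p. after_reflections B x k p w \<and> (\<forall>t>0. p + t *\<^sub>R w \<notin> B))"

definition scattering_defined :: "space3 set \<Rightarrow> real^2 \<Rightarrow> bool" where
  "scattering_defined B x \<longleftrightarrow> (\<exists>w. scatters_to B x w)"

definition final_velocity :: "space3 set \<Rightarrow> real^2 \<Rightarrow> space3" where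
  "final_velocity B x = (THE w. scatters_to B x w)"

definition regular_scattering :: "space3 set \<Rightarrow> bool" where
  "regular_scattering B \<longleftrightarrow>
     (AE x in lebesgue. scattering_defined B x) \<and>
     final_velocity B \<in> borel_measurable (lebesgue_on {x. scattering_defined B x})"


section \<open>Classes of bodies and the resistance\<close>

text \<open>A body is a closed set which is the closure of its interior.\<close>

definition bodies :: "(real^2) set \<Rightarrow> real \<Rightarrow> space3 set set" where
  "bodies \<Omega> M = {B. closure (interior B) = B \<and>
     piecewise_smooth_surface (frontier B - frontier \<Omega> \<times> UNIV) \<and>
     closure \<Omega> \<times> {0} \<subseteq> B \<and> B \<subseteq> closure \<Omega> \<times> {0..M} \<and>
     regular_scattering B}"

definition double_impact :: "space3 set \<Rightarrow> bool" where
  "double_impact B \<longleftrightarrow> (\<forall>x k p w. after_reflections B x k p w \<longrightarrow> k \<le> 2)"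

definition dic_bodies :: "(real^2) set \<Rightarrow> real \<Rightarrow> space3 set set" where
  "dic_bodies \<Omega> M = {B \<in> bodies \<Omega> M. connected B \<and> double_impact B}"

definition resistance :: "(real^2) set \<Rightarrow> space3 set \<Rightarrow> real" where
  "resistance \<Omega> B = (LINT x:\<Omega>|lebesgue. (1 + snd (final_velocity B x)) / 2)"

end

theory Submission
  imports Defs "HOL-Number_Theory.Cong"
begin

text \<open>Almost every particle should leave nearly along its initial direction. It is first reflected,
  by a small slat of slope close to \<open>-1\<close>, into a nearly horizontal flight towards the boundary
  of \<open>\<Omega>\<close>, and then, by a short mirror near that boundary, steeply downwards, so that it leaves the
  cylinder over \<open>\<Omega>\<close> above the floor. All this happens in planes \<open>x\<^sub>2 = const\<close>, and walls parallel
  to these planes make the body connected.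

  The difficulty is that \<open>M\<close> may be small compared with \<open>\<Omega>\<close>. Hence the slats form a row of \<open>Q\<close> short
  ramps of equal height, and a flight starting on one ramp has to cross all later ones. Ramp \<open>q\<close> is
  divided into \<open>n\<close> cells, and the cells whose number is congruent to \<open>0, \<dots>, 6\<close> modulo a large prime
  \<open>P q\<close> are left empty. A slight upward tilt of a flight lowers the number of the cell where it crosses
  the \<open>k\<close>-th next ramp by \<open>k \<theta>\<close>, and by the Chinese remainder theorem one \<open>\<theta>\<close> leads it through empty
  cells of all later ramps. As \<open>n\<close> may be any large multiple of the product of the primes, the tilt is
  as small as desired.

  Particles that miss the slats hit a horizontal face and return upwards, but they form a small
  portion of the flow.\<close>

section \<open>Uniqueness of billiard scattering\<close>

text \<open>A single ramp of slope close to \<open>-1\<close> under a whole chord of \<Omega> would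
  be about as high as the chord is long. With ramps of length \<open>D\<close> the height is
  \<open>D\<close>, at the price of the crossings. These can be arranged because of an exact
  formula: a flight of slope \<open>t\<close> from cell \<open>i\<close> passes cell
  \<open>j\<close> of the \<open>k\<close>-th next ramp at height
  \<open>w * (1 + t) * (j - i + k * \<theta>)\<close> above it, up to offsets smaller than
  \<open>2 * w\<close>, provided that \<open>t * n = \<theta> * (1 + t)\<close>. Seven empty
  residues leave room for the offsets and for the thickness of a slat.

  The lower edge of a mirror has slope \<open>-(1 - \<epsilon>)\<close> and not \<open>-1\<close>.
  The particle then keeps a small drift, of order \<epsilon>, away from the slats and out of the
  cylinder, and it falls more steeply than the mirror. The mirror length and its distance from the
  boundary are of order \<open>\<epsilon> * M\<close>, to match this drift.

  The double impact condition concerns every particle, also one that hits an edge. Hence reflections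
  are computed from an arbitrary unit normal, if there is one, and the existence of normals is
  established only for generic particles.\<close>

lemma Ck_on_const: "Ck_on k (\<lambda>x. c) U"
  by (induction k arbitrary: c) auto

lemma smooth_on_affine:
  assumes "bounded_linear f"
  shows "smooth_on (\<lambda>x. c + f x) U"
proof -
  have d: "((\<lambda>x. c + f x) has_derivative f) (at x)" for x
    by (auto intro!: derivative_eq_intros bounded_linear_imp_has_derivative assms)
  have "Ck_on k (\<lambda>x. c + f x) U" for k
  proof (cases k)
    case 0
    then show ?thesis
      using d has_derivative_continuous continuous_at_imp_continuous_on
      by (metis Ck_on.simps(1))
  next
    case (Suc k)
    have "frechet_derivative (\<lambda>x. c + f x) (at x) = f" for x
      using frechet_derivative_at[OF d] by simp
    then show ?thesis using d Suc by (auto simp: differentiable_def Ck_on_const)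
  qed
  then show ?thesis by (simp add: smooth_on_def)
qed

lemma smooth_arc_linepath:
  fixes a b :: "'a::euclidean_space"
  assumes "a \<noteq> b"
  shows "smooth_arc (linepath a b)"
proof -
  have "bounded_linear (\<lambda>x::real. x *\<^sub>R (b - a))"
    by (rule bounded_linear_scaleR_left)
  from smooth_on_affine[OF this, of a UNIV] have "smooth_on (linepath a b) UNIV"
    by (simp add: linepath_def algebra_simps)
  then show ?thesis
    using assms by (auto simp: smooth_arc_def intro!: exI[of _ UNIV])
qed

text \<open>The defining function vanishes along the ray, so its one-sided derivative
  \<open>c * (n \<bullet> v)\<close> is zero. A one-sided ray suffices, so the lemma also applies at
  boundary points of a face.\<close>

lemma unit_normal_tangent:
  assumes "unit_normal S p n" "e > 0" "\<And>s. 0 < s \<Longrightarrow> s < e \<Longrightarrow> p + s *\<^sub>R v \<in> S"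
  shows "n \<bullet> v = 0"
proof -
  obtain W g c where W: "open W" "p \<in> W" "S \<inter> W = {y \<in> W. g y = (0::real)}" "c \<noteq> 0"
      and g: "GDERIV g p :> c *\<^sub>R n" and p: "p \<in> S"
    using assms(1) by (auto simp: unit_normal_def)
  have gp: "g p = 0" using W p by blast
  have *: "((\<lambda>s. p + s *\<^sub>R v) has_derivative (\<lambda>s. s *\<^sub>R v)) (at 0 within {0<..})"
    by (auto intro!: derivative_eq_intros)
  have "((\<lambda>s. g (p + s *\<^sub>R v)) has_derivative (\<lambda>s. (s *\<^sub>R v) \<bullet> (c *\<^sub>R n))) (at 0 within {0<..})"
    using diff_chain_within[OF *, of g "\<lambda>h. h \<bullet> (c *\<^sub>R n)"] g
    by (simp add: gderiv_def o_def has_derivative_at_withinI)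
  then have "((\<lambda>s. g (p + s *\<^sub>R v)) has_field_derivative (c * (n \<bullet> v))) (at 0 within {0<..})"
    unfolding has_field_derivative_def by (rule back_subst[of "\<lambda>d. (_ has_derivative d) _"])
      (auto simp: inner_commute mult_ac)
  then have lim: "((\<lambda>s. g (p + s *\<^sub>R v) / s) \<longlongrightarrow> c * (n \<bullet> v)) (at 0 within {0<..})"
    by (simp add: has_field_derivative_iff gp)
  have "((\<lambda>s. p + s *\<^sub>R v) \<longlongrightarrow> p + 0 *\<^sub>R v) (at 0 within {0<..})"
    by (intro tendsto_intros)
  then have "eventually (\<lambda>s. p + s *\<^sub>R v \<in> W) (at 0 within {0<..})"
    using W by (simp add: topological_tendstoD)
  moreover have "eventually (\<lambda>s. s > 0 \<and> s < e) (at 0 within {0<..})"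
    using assms(2) eventually_at_right_real by fastforce
  ultimately have "eventually (\<lambda>s. g (p + s *\<^sub>R v) / s = 0) (at 0 within {0<..})"
  proof eventually_elim
    case (elim s)
    then have "p + s *\<^sub>R v \<in> S \<inter> W" using assms(3) by auto
    then show ?case using W by auto
  qed
  then have "((\<lambda>s. g (p + s *\<^sub>R v) / s) \<longlongrightarrow> 0) (at 0 within {0<..})"
    by (simp add: tendsto_eventually)
  with lim have "c * (n \<bullet> v) = 0"
    by (rule tendsto_unique[rotated]) (simp add: trivial_limit_at_right_real)
  then show ?thesis using W by simp
qed

text \<open>The two normals may come from different defining functions \<open>g\<close> and
  \<open>g'\<close>. If they were not parallel, the part \<open>v\<close> of \<open>m\<close>
  orthogonal to \<open>n\<close> would be nonzero. Along the short segment
  \<open>p + s *\<^sub>R (v + r *\<^sub>R n)\<close> the function \<open>g\<close> changes sign with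
  \<open>r\<close>, so it has a zero, which is a point of \<open>S\<close>; but there
  \<open>g'\<close> is close to \<open>c' * s * (1 - k\<^sup>2 + r * k)\<close> and cannot
  vanish.\<close>

lemma unit_normal_unique:
  assumes n: "unit_normal S p n" and m: "unit_normal S p m"
  shows "m = n \<or> m = - n"
proof (rule ccontr)
  assume neq: "\<not> (m = n \<or> m = - n)"
  obtain W g c where W: "open W" "p \<in> W" "S \<inter> W = {y \<in> W. g y = (0::real)}" "c \<noteq> 0" "smooth_on g W"
      and g: "GDERIV g p :> c *\<^sub>R n" and p: "p \<in> S" and nn: "norm n = 1"
    using n by (auto simp: unit_normal_def)
  obtain W' g' c' where W': "open W'" "p \<in> W'" "S \<inter> W' = {y \<in> W'. g' y = (0::real)}" "c' \<noteq> 0"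
      and g': "GDERIV g' p :> c' *\<^sub>R m" and nm: "norm m = 1"
    using m by (auto simp: unit_normal_def)
  have gp: "g p = 0" "g' p = 0" using W W' p by blast+
  define k where "k = m \<bullet> n"
  have nn1: "n \<bullet> n = 1" "m \<bullet> m = 1" using nn nm by (simp_all add: dot_square_norm)
  define v where "v = m - k *\<^sub>R n"
  have vn: "v \<bullet> n = 0" by (simp add: v_def k_def inner_diff_left nn1)
  have kl: "\<bar>k\<bar> \<le> 1" using Cauchy_Schwarz_ineq2[of m n] nn nm by (simp add: k_def)
  have vv: "v \<bullet> v = 1 - k\<^sup>2"
    by (simp add: v_def inner_diff_left inner_diff_right nn1 k_def inner_commute power2_eq_square)
  have vm: "v \<bullet> m = 1 - k\<^sup>2"
    by (simp add: v_def inner_diff_left inner_diff_right nn1 k_def inner_commute power2_eq_square)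
  have k1: "1 - k\<^sup>2 > 0"
  proof (rule ccontr)
    assume "\<not> 1 - k\<^sup>2 > 0"
    then have "v \<bullet> v \<le> 0" using vv by simp
    then have "v = 0" by (metis inner_gt_zero_iff not_le)
    then have mk: "m = k *\<^sub>R n" by (simp add: v_def)
    then have "\<bar>k\<bar> = 1" using nn nm by simp
    then have "k = 1 \<or> k = -1" by linarith
    with mk neq show False by auto
  qed
  \<comment> \<open>For \<open>\<bar>r\<bar> \<le> \<eta>\<close> the term \<open>r * k\<close>
    takes away at most half of \<open>1 - k\<^sup>2\<close>.\<close>
  define \<eta> where "\<eta> = (1 - k\<^sup>2) / 2"
  have eta: "\<eta> > 0" "\<eta> \<le> 1/2" using k1 by (simp_all add: \<eta>_def)
  have nv: "norm v \<le> 1"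
    using vv by (simp add: norm_eq_sqrt_inner)
  have n2: "norm (v + r *\<^sub>R n) \<le> 2" if "\<bar>r\<bar> \<le> \<eta>" for r
  proof -
    have "norm (v + r *\<^sub>R n) \<le> norm v + \<bar>r\<bar>" using norm_triangle_ineq[of v "r *\<^sub>R n"] nn by simp
    then show ?thesis using that eta nv by simp
  qed
  have "GDERIV g p :> c *\<^sub>R n \<longleftrightarrow> (g has_derivative (\<lambda>h. h \<bullet> (c *\<^sub>R n))) (at p)"
    by (simp add: gderiv_def)
  with g have gd: "(g has_derivative (\<lambda>h. h \<bullet> (c *\<^sub>R n))) (at p)" by simp
  from g' have gd': "(g' has_derivative (\<lambda>h. h \<bullet> (c' *\<^sub>R m))) (at p)" by (simp add: gderiv_def)
  \<comment> \<open>Displacements on the segment are at most \<open>2 * s\<close>, so the errors of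
    the linear approximations are at most two thirds of \<open>\<bar>c\<bar> * s * \<eta>\<close>
    and \<open>\<bar>c'\<bar> * s * \<eta>\<close>.\<close>
  define e where "e = \<bar>c\<bar> * \<eta> / 3"
  define e' where "e' = \<bar>c'\<bar> * \<eta> / 3"
  have ee: "e > 0" "e' > 0" using W W' eta by (simp_all add: e_def e'_def)
  obtain d where d: "d > 0" "\<And>y. norm (y - p) < d \<Longrightarrow> \<bar>g y - g p - (y - p) \<bullet> (c *\<^sub>R n)\<bar> \<le> e * norm (y - p)"
    using gd ee unfolding has_derivative_at_alt by (metis real_norm_def)
  obtain d' where d': "d' > 0" "\<And>y. norm (y - p) < d' \<Longrightarrow> \<bar>g' y - g' p - (y - p) \<bullet> (c' *\<^sub>R m)\<bar> \<le> e' * norm (y - p)"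
    using gd' ee unfolding has_derivative_at_alt by (metis real_norm_def)
  obtain r1 where r1: "r1 > 0" "ball p r1 \<subseteq> W" using W open_contains_ball by blast
  obtain r2 where r2: "r2 > 0" "ball p r2 \<subseteq> W'" using W' open_contains_ball by blast
  define s where "s = Min {d, d', r1, r2} / 3"
  have "Min {d, d', r1, r2} > 0" using d d' r1 r2 by simp
  then have s0: "s > 0" by (simp add: s_def)
  have "2 * s < Min {d, d', r1, r2}" using s0 unfolding s_def by linarith
  then have s: "2 * s < d" "2 * s < d'" "2 * s < r1" "2 * s < r2" by simp_all
  define q where "q r = p + s *\<^sub>R (v + r *\<^sub>R n)" for r
  have qn: "norm (q r - p) \<le> 2 * s" if "\<bar>r\<bar> \<le> \<eta>" for r
    using n2[OF that] s0 by (simp add: q_def)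
  have qW: "q r \<in> W" "q r \<in> W'" if "\<bar>r\<bar> \<le> \<eta>" for r
  proof -
    have "dist p (q r) < r1" "dist p (q r) < r2" using qn[OF that] s by (auto simp: dist_norm norm_minus_commute)
    then show "q r \<in> W" "q r \<in> W'" using r1 r2 by auto
  qed
  have gq: "\<bar>g (q r) - c * s * r\<bar> \<le> e * (2 * s)" if "\<bar>r\<bar> \<le> \<eta>" for r
  proof -
    have D: "(q r - p) \<bullet> (c *\<^sub>R n) = c * s * r"
      by (simp add: q_def inner_add_left vn nn1)
    then have "\<bar>g (q r) - c * s * r\<bar> \<le> e * norm (q r - p)"
      using d(2)[of "q r"] qn[OF that] s gp unfolding D by simp
    also have "\<dots> \<le> e * (2 * s)" using qn[OF that] ee by simp
    finally show ?thesis .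
  qed
  have gq': "\<bar>g' (q r) - c' * s * ((1 - k\<^sup>2) + r * k)\<bar> \<le> e' * (2 * s)" if "\<bar>r\<bar> \<le> \<eta>" for r
  proof -
    have D: "(q r - p) \<bullet> (c' *\<^sub>R m) = c' * s * ((1 - k\<^sup>2) + r * k)"
    proof -
      have "(v + r *\<^sub>R n) \<bullet> m = (1 - k\<^sup>2) + r * k"
        by (simp only: inner_add_left vm k_def inner_scaleR_left inner_commute[of m n])
      then show ?thesis by (simp add: q_def)
    qed
    then have "\<bar>g' (q r) - c' * s * ((1 - k\<^sup>2) + r * k)\<bar> \<le> e' * norm (q r - p)"
      using d'(2)[of "q r"] qn[OF that] s gp unfolding D by simp
    also have "\<dots> \<le> e' * (2 * s)" using qn[OF that] ee by simp
    finally show ?thesis .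
  qed
  have cont: "continuous_on {-\<eta>..\<eta>} (\<lambda>r. c * g (q r))"
  proof -
    have "continuous_on W g" using W(5) unfolding smooth_on_def by (metis Ck_on.simps(1))
    moreover have "continuous_on {-\<eta>..\<eta>} q" unfolding q_def by (intro continuous_intros)
    ultimately have "continuous_on {-\<eta>..\<eta>} (\<lambda>r. g (q r))"
      using qW by (auto intro!: continuous_on_compose2[of W g] simp: abs_le_iff)
    then show ?thesis by (intro continuous_intros)
  qed
  have bnd: "\<bar>c * g (q r) - c\<^sup>2 * s * r\<bar> \<le> c\<^sup>2 * s * \<eta>" if "\<bar>r\<bar> \<le> \<eta>" for r
  proof -
    have "c * g (q r) - c\<^sup>2 * s * r = c * (g (q r) - c * s * r)" by (simp add: algebra_simps power2_eq_square)
    then have "\<bar>c * g (q r) - c\<^sup>2 * s * r\<bar> \<le> \<bar>c\<bar> * (e * (2 * s))"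
      using gq[OF that] by (simp add: abs_mult mult_left_mono)
    also have "\<dots> = (2/3) * (c\<^sup>2 * s * \<eta>)" by (simp add: e_def power2_eq_square algebra_simps abs_mult_self_eq)
    also have "\<dots> \<le> c\<^sup>2 * s * \<eta>" using s0 eta by (simp)
    finally show ?thesis .
  qed
  have "c * g (q (-\<eta>)) \<le> 0" "c * g (q \<eta>) \<ge> 0"
    using bnd[of "-\<eta>"] bnd[of \<eta>] eta by (auto simp: abs_le_iff)
  then obtain r where r: "-\<eta> \<le> r" "r \<le> \<eta>" "c * g (q r) = 0"
    using IVT'[of "\<lambda>r. c * g (q r)" "-\<eta>" 0 \<eta>] cont eta by auto
  then have ra: "\<bar>r\<bar> \<le> \<eta>" by (simp add: abs_le_iff)
  have "q r \<in> S" using r W(3,4) qW[OF ra] by auto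
  then have "g' (q r) = 0" using W'(3) qW[OF ra] by blast
  with gq'[OF ra] have *: "\<bar>c' * s * ((1 - k\<^sup>2) + r * k)\<bar> \<le> e' * (2 * s)" by simp
  have "\<bar>r * k\<bar> \<le> \<eta> * 1" using ra kl by (simp only: abs_mult) (intro mult_mono, auto)
  then have "(1 - k\<^sup>2) + r * k \<ge> \<eta>" using k1 by (auto simp: \<eta>_def abs_le_iff)
  then have "\<bar>c'\<bar> * s * \<eta> \<le> \<bar>c' * s * ((1 - k\<^sup>2) + r * k)\<bar>"
    using s0 eta by (simp add: abs_mult mult_left_mono)
  with * have "\<bar>c'\<bar> * s * \<eta> \<le> e' * (2 * s)" by linarith
  also have "e' * (2 * s) = (2/3) * (\<bar>c'\<bar> * s * \<eta>)" by (simp add: e'_def)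
  finally have "\<bar>c'\<bar> * s * \<eta> \<le> (2/3) * (\<bar>c'\<bar> * s * \<eta>)" .
  moreover have "\<bar>c'\<bar> * s * \<eta> > 0" using W' s0 eta by simp
  ultimately show False by linarith
qed

section \<open>Reflections and trajectories are determined by the body\<close>

lemma reflect_minus: "reflect (- n) w = reflect n w"
  by (simp add: reflect_def)

lemma norm_reflect:
  assumes "norm n = 1"
  shows "norm (reflect n w) = norm w"
proof -
  have "n \<bullet> n = 1" using assms by (simp add: dot_square_norm)
  then have "reflect n w \<bullet> reflect n w = w \<bullet> w"
    by (simp add: reflect_def inner_diff_left inner_diff_right inner_commute algebra_simps)
  then show ?thesis by (simp add: norm_eq_sqrt_inner)
qed

lemma reflect_unique:
  "unit_normal S p n \<Longrightarrow> unit_normal S p m \<Longrightarrow> reflect m w = reflect n w"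
  using unit_normal_unique[of S p n m] by (auto simp: reflect_minus)

lemma after_reflections_0:
  "after_reflections B x 0 p w \<longleftrightarrow> (\<exists>h. p = (x, h) \<and> w = (0, -1) \<and> (\<forall>z\<ge>h. (x, z) \<notin> B))"
  by (subst after_reflections.simps) auto

lemma after_reflections_Suc:
  "after_reflections B x (Suc k) p' w' \<longleftrightarrow>
    (\<exists>p w t n. after_reflections B x k p w \<and> t > 0 \<and> (\<forall>s\<in>{0<..<t}. p + s *\<^sub>R w \<notin> B) \<and>
       unit_normal (frontier B) (p + t *\<^sub>R w) n \<and> p' = p + t *\<^sub>R w \<and> w' = reflect n w)"
  by (subst after_reflections.simps) fastforce

lemma unit_normal_mem: "unit_normal S p n \<Longrightarrow> p \<in> S"
  by (simp add: unit_normal_def)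

text \<open>The arbitrary starting height of the rule \<open>incoming\<close> disappears here: the
  first reflection takes place at the highest point of \<open>B\<close> over
  \<open>x\<close>.\<close>

lemma first_reflection:
  assumes "closed B"
  shows "after_reflections B x (Suc 0) p w \<longleftrightarrow>
    (\<exists>z n. p = (x, z) \<and> (x, z) \<in> B \<and> (\<forall>z'>z. (x, z') \<notin> B) \<and>
       unit_normal (frontier B) (x, z) n \<and> w = reflect n (0, -1))" (is "?L \<longleftrightarrow> ?R")
proof
  assume ?L
  then obtain h t n where *: "\<forall>z\<ge>h. (x, z) \<notin> B" "t > 0"
      "\<forall>s\<in>{0<..<t}. (x, h) + s *\<^sub>R (0, -1) \<notin> B"
      "unit_normal (frontier B) ((x, h) + t *\<^sub>R (0, -1)) n"
      "p = (x, h) + t *\<^sub>R (0, -1)" "w = reflect n (0, -1)"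
    unfolding after_reflections_Suc after_reflections_0 by blast
  have "(x, z') \<notin> B" if "z' > h - t" for z'
  proof (cases "z' \<ge> h")
    case False
    then show ?thesis using *(3)[rule_format, of "h - z'"] that by auto
  qed (use * in auto)
  moreover have "(x, h - t) \<in> B"
    using unit_normal_mem[OF *(4)] assms frontier_subset_closed by auto
  ultimately show ?R using * by (intro exI[of _ "h - t"] exI[of _ n]) auto
next
  assume ?R
  then obtain z n where *: "p = (x, z)" "\<forall>z'>z. (x, z') \<notin> B"
    "unit_normal (frontier B) (x, z) n" "w = reflect n (0, -1)" by blast
  show ?L unfolding after_reflections_Suc after_reflections_0
    using * by (intro exI[of _ "(x, z + 1)"] exI[of _ "(0, -1)"] exI[of _ 1] exI[of _ n]) auto
qed

text \<open>Stated from the first reflection on, since the point is not unique for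
  \<open>k = 0\<close>. In the induction step the hitting time is the first positive time in
  \<open>B\<close>, and two unit normals there agree up to sign.\<close>

lemma after_reflections_unique:
  assumes "closed B" "after_reflections B x (Suc k) p w" "after_reflections B x (Suc k) p' w'"
  shows "p = p' \<and> w = w'"
  using assms(2,3)
proof (induction k arbitrary: p w p' w')
  case 0
  then obtain z n z' n' where
    *: "p = (x, z)" "(x, z) \<in> B" "\<forall>y>z. (x, y) \<notin> B" "unit_normal (frontier B) (x, z) n" "w = reflect n (0, -1)"
       "p' = (x, z')" "(x, z') \<in> B" "\<forall>y>z'. (x, y) \<notin> B" "unit_normal (frontier B) (x, z') n'" "w' = reflect n' (0, -1)"
    unfolding first_reflection[OF assms(1)] by blast
  then have "z = z'" using linorder_neqE_linordered_idom by blast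
  then show ?case using * reflect_unique by blast
next
  case (Suc k)
  obtain p0 w0 t n where
    1: "after_reflections B x (Suc k) p0 w0" "t > 0" "\<forall>s\<in>{0<..<t}. p0 + s *\<^sub>R w0 \<notin> B"
      "unit_normal (frontier B) (p0 + t *\<^sub>R w0) n" "p = p0 + t *\<^sub>R w0" "w = reflect n w0"
    using Suc.prems(1) by (subst (asm) after_reflections_Suc) blast
  obtain p1 w1 t' n' where
    2: "after_reflections B x (Suc k) p1 w1" "t' > 0" "\<forall>s\<in>{0<..<t'}. p1 + s *\<^sub>R w1 \<notin> B"
      "unit_normal (frontier B) (p1 + t' *\<^sub>R w1) n'" "p' = p1 + t' *\<^sub>R w1" "w' = reflect n' w1"
    using Suc.prems(2) by (subst (asm) after_reflections_Suc) blast
  have e: "p1 = p0" "w1 = w0" using Suc.IH 1(1) 2(1) by blast+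
  have "p0 + t *\<^sub>R w0 \<in> B" "p0 + t' *\<^sub>R w0 \<in> B"
    using unit_normal_mem[OF 1(4)] unit_normal_mem[OF 2(4)] assms(1) frontier_subset_closed e by auto
  then have "t = t'" using 1(2,3) 2(2,3) e
    by (metis greaterThanLessThan_iff linorder_neqE_linordered_idom)
  then show ?case using 1 2 e reflect_unique by blast
qed

lemma after_reflections_prefix:
  assumes "after_reflections B x k' p' w'" "k < k'"
  shows "\<exists>p w. after_reflections B x (Suc k) p w"
  using assms
proof (induction k' arbitrary: p' w')
  case (Suc k')
  show ?case
  proof (cases "k = k'")
    case True
    then show ?thesis using Suc.prems by blast
  next
    case False
    obtain p w where "after_reflections B x k' p w"
      using Suc.prems(1) by (subst (asm) after_reflections_Suc) blast
    then show ?thesis using Suc False by (metis less_SucE)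
  qed
qed simp

text \<open>A further reflection point would belong to \<open>frontier B\<close>, hence to
  \<open>B\<close>, and lie on the path that is assumed free. For \<open>k > 0\<close> the state
  after \<open>k\<close> reflections is unique; for \<open>k = 0\<close> the whole vertical line
  misses \<open>B\<close>.\<close>

lemma scatters_to_terminal:
  assumes "closed B" "after_reflections B x k p w" "\<forall>t>0. p + t *\<^sub>R w \<notin> B"
  shows "\<not> after_reflections B x (Suc k) p' w'"
proof
  assume A: "after_reflections B x (Suc k) p' w'"
  show False
  proof (cases k)
    case 0
    then obtain h where h: "p = (x, h)" "w = (0, -1)" "\<forall>z\<ge>h. (x, z) \<notin> B"
      using assms(2) by (auto simp: after_reflections_0)
    from A 0 obtain z where z: "(x, z) \<in> B" using first_reflection[OF assms(1)] by auto
    show False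
    proof (cases "z \<ge> h")
      case False
      then show False using assms(3)[rule_format, of "h - z"] h z by auto
    qed (use h z in auto)
  next
    case (Suc j)
    obtain p0 w0 t n where
      1: "after_reflections B x k p0 w0" "t > 0" "unit_normal (frontier B) (p0 + t *\<^sub>R w0) n"
      using A by (subst (asm) after_reflections_Suc) blast
    then have "p0 = p" "w0 = w" using after_reflections_unique[OF assms(1)] assms(2) Suc by blast+
    moreover have "p0 + t *\<^sub>R w0 \<in> B"
      using unit_normal_mem[OF 1(3)] assms(1) frontier_subset_closed by auto
    ultimately show False using assms(3) 1(2) by auto
  qed
qed

text \<open>If the numbers of reflections differed, the longer trajectory would continue beyond the
  final state of the shorter one.\<close>

lemma scatters_to_unique:
  assumes "closed B" "scatters_to B x w" "scatters_to B x w'"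
  shows "w' = w"
proof -
  obtain k p where 1: "after_reflections B x k p w" "\<forall>t>0. p + t *\<^sub>R w \<notin> B"
    using assms(2) by (auto simp: scatters_to_def)
  obtain k' p' where 2: "after_reflections B x k' p' w'" "\<forall>t>0. p' + t *\<^sub>R w' \<notin> B"
    using assms(3) by (auto simp: scatters_to_def)
  have "\<not> k < k'" "\<not> k' < k"
    using after_reflections_prefix scatters_to_terminal[OF assms(1)] 1 2 by meson+
  then have "k = k'" by simp
  then show ?thesis
    using after_reflections_unique[OF assms(1), of x _ p w p' w'] 1 2
    by (cases k) (auto simp: after_reflections_0)
qed

lemma final_velocity_eq: "closed B \<Longrightarrow> scatters_to B x w \<Longrightarrow> final_velocity B x = w"
  unfolding final_velocity_def using scatters_to_unique by blast

lemma norm_after_reflections: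
  "after_reflections B x k p w \<Longrightarrow> norm w = 1"
  by (induction rule: after_reflections.induct) (auto simp: norm_Pair norm_reflect unit_normal_def)

lemma final_velocity_bounds:
  assumes "closed B" "scattering_defined B x"
  shows "\<bar>snd (final_velocity B x)\<bar> \<le> 1"
proof -
  obtain w where w: "scatters_to B x w" using assms(2) by (auto simp: scattering_defined_def)
  then have "norm w = 1" unfolding scatters_to_def using norm_after_reflections by blast
  then show ?thesis using final_velocity_eq[OF assms(1) w] norm_snd_le[of "snd w" "fst w"] by simp
qed

text \<open>Reflections preserve the norm of the velocity, so the integrand is nonnegative wherever
  the scattering is defined.\<close>

lemma resistance_nonneg:
  assumes "B \<in> bodies \<Omega> M"
  shows "resistance \<Omega> B \<ge> 0"
proof -
  have c: "closed B" using assms by (metis (mono_tags, lifting) bodies_def closed_closure mem_Collect_eq)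
  have "AE x in lebesgue. scattering_defined B x"
    using assms by (simp add: bodies_def regular_scattering_def)
  then have "AE x in lebesgue. 0 \<le> indicator \<Omega> x *\<^sub>R ((1 + snd (final_velocity B x)) / 2)"
  proof eventually_elim
    case (elim x)
    then show ?case using final_velocity_bounds[OF c elim] by (auto simp: indicator_def abs_le_iff)
  qed
  then show ?thesis
    unfolding resistance_def set_lebesgue_integral_def by (rule integral_nonneg_AE)
qed

section \<open>Frontiers of polyhedral bodies\<close>

text \<open>Equality of sign vectors with respect to the hyperplanes
  \<open>a \<bullet> x = b\<close>. The classes are the relatively open faces of the arrangement
  \<open>A\<close>.\<close>

definition same_side :: "('a::euclidean_space \<times> real) set \<Rightarrow> 'a \<Rightarrow> 'a \<Rightarrow> bool" where
  "same_side A x y \<longleftrightarrow> (\<forall>(a, b)\<in>A. sgn (a \<bullet> x - b) = sgn (a \<bullet> y - b))"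

text \<open>Says that \<open>B\<close> is a union of faces of the arrangement. In this form the
  property passes to unions of bodies, however they overlap.\<close>

definition invariant_under :: "('a::euclidean_space \<times> real) set \<Rightarrow> 'a set \<Rightarrow> bool" where
  "invariant_under A B \<longleftrightarrow> (\<forall>x y. same_side A x y \<longrightarrow> x \<in> B \<longrightarrow> y \<in> B)"

text \<open>Excludes that one plane is listed twice, with proportional equations.\<close>

definition reduced :: "('a::euclidean_space \<times> real) set \<Rightarrow> bool" where
  "reduced A \<longleftrightarrow> (\<forall>(a, b)\<in>A. a \<noteq> 0) \<and>
     (\<forall>(a, b)\<in>A. \<forall>(a', b')\<in>A. \<forall>k. a' = k *\<^sub>R a \<longrightarrow> k = 1)"

text \<open>These are the generic points of the planes: their face has codimension one.\<close>

definition only_plane :: "('a::euclidean_space \<times> real) set \<Rightarrow> 'a \<Rightarrow> 'a \<Rightarrow> real \<Rightarrow> bool" where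
  "only_plane A q a b \<longleftrightarrow> (a, b) \<in> A \<and> a \<bullet> q = b \<and> (\<forall>(a', b')\<in>A. a' \<bullet> q = b' \<longrightarrow> a' = a \<and> b' = b)"

lemma same_side_sym: "same_side A x y \<Longrightarrow> same_side A y x"
  by (auto simp: same_side_def split: prod.splits)

lemma same_side_refl [simp]: "same_side A x x"
  by (auto simp: same_side_def)

lemma same_side_trans: "same_side A x y \<Longrightarrow> same_side A y z \<Longrightarrow> same_side A x z"
  by (auto simp: same_side_def split: prod.splits)

lemma invariant_underD: "invariant_under A B \<Longrightarrow> same_side A x y \<Longrightarrow> x \<in> B \<longleftrightarrow> y \<in> B"
  unfolding invariant_under_def using same_side_sym by blast

lemma sgn_stable:
  assumes "finite A"
  obtains r where "r > 0"
    "\<And>y a b. dist q y < r \<Longrightarrow> (a, b) \<in> A \<Longrightarrow> a \<bullet> q \<noteq> b \<Longrightarrow> sgn (a \<bullet> y - b) = sgn (a \<bullet> q - b)"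
proof -
  define T where "T = (\<lambda>(a, b). {y. a \<bullet> q \<noteq> b \<longrightarrow> (a \<bullet> q - b) * (a \<bullet> y - b) > 0})"
  have op: "open (T h)" for h
  proof (cases h)
    case (Pair a b)
    show ?thesis
    proof (cases "a \<bullet> q = b")
      case True
      then show ?thesis by (simp add: T_def Pair)
    next
      case False
      then have "T h = {y. (a \<bullet> q - b) * (a \<bullet> y - b) > 0}" by (simp add: T_def Pair)
      then show ?thesis by (auto intro!: open_Collect_less continuous_intros)
    qed
  qed
  have "q \<in> (\<Inter>h\<in>A. T h)" by (auto simp: T_def power2_eq_square[symmetric])
  moreover have "open (\<Inter>h\<in>A. T h)" using assms op by (intro open_INT) auto
  ultimately obtain r where r: "r > 0" "ball q r \<subseteq> (\<Inter>h\<in>A. T h)"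
    using open_contains_ball by blast
  show ?thesis
  proof
    fix y a b assume *: "dist q y < r" "(a, b) \<in> A" "a \<bullet> q \<noteq> b"
    then have "y \<in> T (a, b)" using r(2) by auto
    with *(3) have "(a \<bullet> q - b) * (a \<bullet> y - b) > 0" by (simp add: T_def)
    then show "sgn (a \<bullet> y - b) = sgn (a \<bullet> q - b)" by (auto simp: zero_less_mult_iff)
  qed fact
qed

text \<open>The same single plane passes through \<open>q\<close> and \<open>q'\<close>, so a point
  near \<open>q'\<close> on a given side of it has the sign vector of every point near
  \<open>q\<close> on that side. Hence a point outside \<open>B\<close> near \<open>q\<close> yields
  one near \<open>q'\<close>.\<close>

lemma frontier_only_plane_cell:
  assumes "finite A" "closed B" "invariant_under A B"
    and q: "q \<in> frontier B" "only_plane A q a b" "a \<noteq> 0" and q': "same_side A q q'"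
  shows "q' \<in> frontier B"
proof -
  have qa: "a \<bullet> q = b" "(a, b) \<in> A" using q by (auto simp: only_plane_def)
  have "sgn (a \<bullet> q - b) = sgn (a \<bullet> q' - b)" using q' qa(2) unfolding same_side_def by fastforce
  then have qa': "a \<bullet> q' = b" using qa by (simp add: sgn_0_0)
  have "q \<in> B" using q assms(2) frontier_subset_closed by blast
  then have "q' \<in> B" using invariant_underD[OF assms(3) q'] by simp
  moreover have "\<exists>y. y \<notin> B \<and> dist y q' < e" if "e > 0" for e
  proof -
    obtain r where r: "r > 0"
      "\<And>y a b. dist q y < r \<Longrightarrow> (a, b) \<in> A \<Longrightarrow> a \<bullet> q \<noteq> b \<Longrightarrow> sgn (a \<bullet> y - b) = sgn (a \<bullet> q - b)"
      using sgn_stable[OF assms(1)] by metis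
    obtain r' where r': "r' > 0"
      "\<And>y a b. dist q' y < r' \<Longrightarrow> (a, b) \<in> A \<Longrightarrow> a \<bullet> q' \<noteq> b \<Longrightarrow> sgn (a \<bullet> y - b) = sgn (a \<bullet> q' - b)"
      using sgn_stable[OF assms(1)] by metis
    obtain y where y: "y \<notin> B" "dist q y < r"
      using q(1) r(1) unfolding frontier_straddle by blast
    define \<sigma> where "\<sigma> = sgn (a \<bullet> y - b)"
    define k where "k = min e r' / (2 * norm a)"
    have k: "k > 0" using that r' q(3) by (simp add: k_def)
    \<comment> \<open>\<open>z\<close> lies on the same side of the plane as \<open>y\<close>; the
      factor \<open>\<sigma>\<close> may be \<open>0\<close>, and then
      \<open>z = q'\<close>.\<close>
    define z where "z = q' + (\<sigma> * k / norm a * norm a) *\<^sub>R a"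
    have "a \<bullet> z - b = \<sigma> * (k * (a \<bullet> a))" using qa' q(3) by (simp add: z_def inner_add_right)
    moreover have "sgn (k * (a \<bullet> a)) = 1" using k q(3) by (intro sgn_pos) simp
    ultimately have sz: "sgn (a \<bullet> z - b) = \<sigma>"
      by (metis \<sigma>_def mult.right_neutral sgn_mult sgn_sgn)
    have "dist q' z \<le> k * norm a" using k q(3)
      by (auto simp: z_def dist_norm abs_mult \<sigma>_def abs_sgn_eq)
    also have "k * norm a = min e r' / 2" using q(3) by (simp add: k_def)
    also have "min e r' / 2 < min e r'" using that r' by linarith
    finally have dz: "dist q' z < e" "dist q' z < r'" by auto
    have "same_side A y z" unfolding same_side_def
    proof (intro ballI, clarify)
      fix a' b' assume h: "(a', b') \<in> A"
      show "sgn (a' \<bullet> y - b') = sgn (a' \<bullet> z - b')"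
      proof (cases "a' \<bullet> q = b'")
        case True
        then have "a' = a \<and> b' = b" using q(2) h unfolding only_plane_def by blast
        then show ?thesis using sz \<sigma>_def by simp
      next
        case False
        have e: "sgn (a' \<bullet> q - b') = sgn (a' \<bullet> q' - b')" using q' h unfolding same_side_def by blast
        with False have "a' \<bullet> q' \<noteq> b'" by (auto simp: sgn_0_0)
        then show ?thesis using r(2)[OF y(2) h False] r'(2)[OF dz(2) h] e by simp
      qed
    qed
    then have "z \<notin> B" using y invariant_underD[OF assms(3)] by blast
    then show ?thesis using dz by (auto simp: dist_commute)
  qed
  ultimately show ?thesis unfolding frontier_straddle
    by (metis dist_commute dist_self)
qed

text \<open>Near \<open>q\<close> the sign vector depends only on the side of one plane. Points of
  the plane have the sign vector of \<open>q\<close>; off the plane the sign vector is locally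
  constant, which leaves no frontier there.\<close>

lemma frontier_only_plane_local:
  assumes "finite A" "closed B" "closure (interior B) = B" "invariant_under A B"
    and q: "q \<in> frontier B" "only_plane A q a b" "a \<noteq> 0"
  obtains r where "r > 0" "\<And>y. dist q y < r \<Longrightarrow> y \<in> frontier B \<longleftrightarrow> a \<bullet> y = b"
proof -
  obtain r where r: "r > 0"
      "\<And>y a b. dist q y < r \<Longrightarrow> (a, b) \<in> A \<Longrightarrow> a \<bullet> q \<noteq> b \<Longrightarrow> sgn (a \<bullet> y - b) = sgn (a \<bullet> q - b)"
    using sgn_stable[OF assms(1)] by metis
  have qa: "a \<bullet> q = b" "(a, b) \<in> A" using q by (auto simp: only_plane_def)
  have qB: "q \<in> B" using q assms(2) frontier_subset_closed by blast
  have ss: "same_side A y z" if "dist q y < r" "dist q z < r" "sgn (a \<bullet> y - b) = sgn (a \<bullet> z - b)" for y z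
    unfolding same_side_def
  proof (intro ballI, clarify)
    fix a' b' assume h: "(a', b') \<in> A"
    show "sgn (a' \<bullet> y - b') = sgn (a' \<bullet> z - b')"
    proof (cases "a' \<bullet> q = b'")
      case True
      then have "a' = a \<and> b' = b" using q(2) h unfolding only_plane_def by blast
      then show ?thesis using that by simp
    next
      case False
      then show ?thesis using r(2)[OF that(1) h False] r(2)[OF that(2) h False] by simp
    qed
  qed
  have "y \<in> frontier B" if y: "dist q y < r" "a \<bullet> y = b" for y
    using frontier_only_plane_cell[OF assms(1,2,4) q] ss[of q y] r(1) y qa by simp
  moreover have "a \<bullet> y = b" if y: "dist q y < r" "y \<in> frontier B" for y
  proof (rule ccontr)
    assume ne: "a \<bullet> y \<noteq> b"
    define U where "U = {z. (a \<bullet> y - b) * (a \<bullet> z - b) > 0} \<inter> ball q r"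
    have sU: "same_side A y z" if "z \<in> U" for z
      using that by (intro ss y) (auto simp: U_def zero_less_mult_iff)
    have "open U" unfolding U_def
      by (intro open_Int open_Collect_less continuous_intros) auto
    moreover have "y \<in> U" using ne y by (auto simp: U_def power2_eq_square[symmetric])
    ultimately obtain e where "e > 0" "ball y e \<subseteq> U" using open_contains_ball by blast
    then show False
      using y(2) sU invariant_underD[OF assms(4)] unfolding frontier_straddle
      by (metis in_mono mem_ball dist_commute)
  qed
  ultimately show ?thesis using that r(1) by blast
qed

lemma unit_normal_only_plane:
  assumes "finite A" "closed B" "closure (interior B) = B" "invariant_under A B"
    and q: "q \<in> frontier B" "only_plane A q a b" "a \<noteq> (0::space3)"
  shows "unit_normal (frontier B) q (a /\<^sub>R norm a)"
proof -
  obtain r where r: "r > 0" "\<And>y. dist q y < r \<Longrightarrow> y \<in> frontier B \<longleftrightarrow> a \<bullet> y = b"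
    using frontier_only_plane_local[OF assms] by blast
  have lin: "bounded_linear (\<lambda>y. a \<bullet> y)" by (rule bounded_linear_inner_right)
  have "smooth_on (\<lambda>y. - b + a \<bullet> y) (ball q r)" by (rule smooth_on_affine[OF lin])
  moreover have "GDERIV (\<lambda>y. - b + a \<bullet> y) q :> norm a *\<^sub>R (a /\<^sub>R norm a)"
    using q(3) by (auto simp: gderiv_def inner_commute intro!: derivative_eq_intros)
  moreover have "frontier B \<inter> ball q r = {y \<in> ball q r. - b + a \<bullet> y = 0}"
    using r(2) by auto
  ultimately show ?thesis
    unfolding unit_normal_def using q r(1)
    by (intro conjI exI[of _ "ball q r"] exI[of _ "\<lambda>y. - b + a \<bullet> y"] exI[of _ "norm a"]) auto
qed

lemma frontier_meets_plane:
  assumes "finite A" "invariant_under A B" "q \<in> frontier B"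
  shows "\<exists>a b. (a, b) \<in> A \<and> a \<bullet> q = b"
proof (rule ccontr)
  assume no: "\<not> ?thesis"
  obtain e where e: "e > 0"
    "\<And>y a b. dist q y < e \<Longrightarrow> (a, b) \<in> A \<Longrightarrow> a \<bullet> q \<noteq> b \<Longrightarrow> sgn (a \<bullet> y - b) = sgn (a \<bullet> q - b)"
    using sgn_stable[OF assms(1)] by metis
  have "same_side A q z" if "dist q z < e" for z
    using e(2)[OF that] no unfolding same_side_def by fastforce
  then have "z \<in> B \<longleftrightarrow> q \<in> B" if "dist q z < e" for z
    using invariant_underD[OF assms(2)] that by blast
  then show False using assms(3) e(1) unfolding frontier_straddle by blast
qed

text \<open>A segment from an interior point to a nearby exterior point crosses the frontier, and for a
  generic choice of its ends it avoids all intersections of two planes.\<close>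

lemma frontier_generic_dense:
  fixes B :: "'a::euclidean_space set"
  assumes A: "finite A" "reduced A" and B: "closure (interior B) = B" "invariant_under A B"
    and p: "p \<in> frontier B" and U: "open U" "p \<in> U"
  shows "\<exists>q\<in>U \<inter> frontier B. \<exists>a b. only_plane A q a b"
proof -
  obtain r where r: "r > 0" "ball p r \<subseteq> U" using U open_contains_ball by blast
  have clB: "closed B" using B(1) by (metis closed_closure)
  have pB: "p \<in> B" using p clB frontier_subset_closed by blast
  have npl: "a \<noteq> 0" if "(a, b) \<in> A" for a b using A(2) that unfolding reduced_def by blast
  have neg1: "negligible (\<Union>(a, b)\<in>A. {y. a \<bullet> y = b})"
    using A(1) npl by (intro negligible_Union) (auto intro!: negligible_hyperplane)
  have "interior B \<inter> ball p r \<noteq> {}"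
    using pB B(1) r(1) by (metis Int_commute centre_in_ball disjoint_iff open_Int_closure_eq_empty open_ball)
  then have "\<not> negligible (interior B \<inter> ball p r)"
    using open_not_negligible open_interior open_ball by (metis open_Int)
  then have "\<not> interior B \<inter> ball p r \<subseteq> (\<Union>(a, b)\<in>A. {y. a \<bullet> y = b})"
    using neg1 negligible_subset by blast
  then obtain o0 where o0: "o0 \<in> interior B" "o0 \<in> ball p r" "\<And>a b. (a, b) \<in> A \<Longrightarrow> a \<bullet> o0 \<noteq> b" by blast
  \<comment> \<open>The hyperplane through \<open>o0\<close> and the intersection of the two planes.
    A segment from \<open>o0\<close> to a point outside all these hyperplanes meets no intersection
    of two planes.\<close>
  define N where "N = (\<lambda>((a, b), (a', b')). {y. ((a \<bullet> o0 - b) *\<^sub>R a' - (a' \<bullet> o0 - b') *\<^sub>R a) \<bullet> y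
      = (a \<bullet> o0 - b) * b' - (a' \<bullet> o0 - b') * b})"
  define I where "I = {(h, h'). h \<in> A \<and> h' \<in> A \<and> fst h \<noteq> fst h'}"
  have neg2: "negligible (\<Union>(N ` I))"
  proof (rule negligible_Union)
    have "I \<subseteq> A \<times> A" by (auto simp: I_def)
    then show "finite (N ` I)" using A(1) finite_subset by blast
    fix t assume "t \<in> N ` I"
    then obtain a b a' b' where t: "t = N ((a, b), (a', b'))" "(a, b) \<in> A" "(a', b') \<in> A" "a \<noteq> a'"
      by (auto simp: I_def)
    have "(a \<bullet> o0 - b) *\<^sub>R a' - (a' \<bullet> o0 - b') *\<^sub>R a \<noteq> 0"
    proof
      assume *: "(a \<bullet> o0 - b) *\<^sub>R a' - (a' \<bullet> o0 - b') *\<^sub>R a = 0"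
      have "a' = (1 / (a \<bullet> o0 - b)) *\<^sub>R ((a \<bullet> o0 - b) *\<^sub>R a')" using o0(3)[OF t(2)] by simp
      also have "\<dots> = ((a' \<bullet> o0 - b') / (a \<bullet> o0 - b)) *\<^sub>R a" using * by simp
      finally have "a' = ((a' \<bullet> o0 - b') / (a \<bullet> o0 - b)) *\<^sub>R a" .
      moreover from this have "(a' \<bullet> o0 - b') / (a \<bullet> o0 - b) = 1" using A(2) t unfolding reduced_def by blast
      ultimately show False using t(4) by simp
    qed
    then show "negligible t" unfolding t(1) N_def by (auto intro!: negligible_hyperplane)
  qed
  have "\<exists>y. y \<notin> B \<and> dist p y < r" using p r(1) unfolding frontier_straddle by blast
  then have "- B \<inter> ball p r \<noteq> {}" by auto
  then have "\<not> negligible (- B \<inter> ball p r)"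
    using open_not_negligible clB open_ball by (metis open_Compl open_Int)
  then have "\<not> - B \<inter> ball p r \<subseteq> \<Union>(N ` I)" using neg2 negligible_subset by blast
  then obtain y where y: "y \<notin> B" "y \<in> ball p r" "y \<notin> \<Union>(N ` I)" by blast
  have "o0 \<in> B" using o0 interior_subset by blast
  then have "closed_segment o0 y \<inter> frontier B \<noteq> {}"
    using y by (intro connected_Int_frontier) auto
  then obtain q where q: "q \<in> closed_segment o0 y" "q \<in> frontier B" by blast
  then obtain s where s: "0 \<le> s" "s \<le> 1" "q = (1 - s) *\<^sub>R o0 + s *\<^sub>R y" by (auto simp: in_segment)
  have "closed_segment o0 y \<subseteq> ball p r"
    using o0(2) y(2) by (simp add: closed_segment_subset)
  then have qU: "q \<in> U" using q r(2) by blast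
  have ex: "\<exists>a b. (a, b) \<in> A \<and> a \<bullet> q = b" using frontier_meets_plane[OF A(1) B(2) q(2)] .
  have un: "a' = a \<and> b' = b" if h: "(a, b) \<in> A" "(a', b') \<in> A" "a \<bullet> q = b" "a' \<bullet> q = b'" for a b a' b'
  proof (rule ccontr)
    assume ne: "\<not> (a' = a \<and> b' = b)"
    then have aa: "a \<noteq> a'" using h by blast
    have s0: "s \<noteq> 0" using s(3) o0(3)[OF h(1)] h(3) by auto
    \<comment> \<open>\<open>\<psi>\<close> is affine and vanishes at \<open>o0\<close> and at
      \<open>q\<close>, hence also at \<open>y\<close>, against the choice of
      \<open>y\<close>.\<close>
    define \<psi> where "\<psi> z = (a \<bullet> o0 - b) * (a' \<bullet> z - b') - (a' \<bullet> o0 - b') * (a \<bullet> z - b)" for z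
    have "\<psi> q = (1 - s) * \<psi> o0 + s * \<psi> y"
      unfolding s(3) \<psi>_def by (simp add: inner_add_right algebra_simps)
    moreover have "\<psi> q = 0" "\<psi> o0 = 0" using h by (simp_all add: \<psi>_def)
    ultimately have "\<psi> y = 0" using s0 by simp
    then have "y \<in> N ((a, b), (a', b'))" by (simp add: N_def \<psi>_def inner_diff_left algebra_simps)
    moreover have "((a, b), (a', b')) \<in> I" using h aa by (simp add: I_def)
    ultimately show False using y(3) by blast
  qed
  from ex obtain a b where "(a, b) \<in> A" "a \<bullet> q = b" by blast
  then have "only_plane A q a b" using un unfolding only_plane_def by blast
  then show ?thesis using qU q by blast
qed

section \<open>Faces of the frontier as smooth patches\<close>

lemma planar_region_convex_polygon:
  assumes "polytope K" "interior K \<noteq> {}"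
  shows "planar_region K"
proof -
  have cv: "convex K" "compact K" "polyhedron K"
    using assms(1) polytope_imp_convex polytope_imp_compact polytope_imp_polyhedron by auto
  have "closure (interior K) = K"
    using convex_closure_interior[OF cv(1) assms(2)] cv(2) by (simp add: compact_imp_closed)
  moreover have "\<exists>\<Gamma>. finite \<Gamma> \<and> (\<forall>\<gamma>\<in>\<Gamma>. smooth_arc \<gamma>) \<and> frontier K = (\<Union>\<gamma>\<in>\<Gamma>. path_image \<gamma>)"
  proof -
    have ad: "aff_dim K = 2" using aff_dim_nonempty_interior[OF assms(2)] by simp
    \<comment> \<open>A facet of a planar polytope is compact, convex and one-dimensional, hence a
      segment.\<close>
    have "\<exists>\<gamma>. smooth_arc \<gamma> \<and> path_image \<gamma> = F" if F: "F facet_of K" for F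
    proof -
      have "polytope F" using F assms(1) by (metis face_of_polytope_polytope facet_of_def)
      moreover have "aff_dim F = 1" using F ad by (simp add: facet_of_def)
      moreover have "F \<noteq> {}" using F by (simp add: facet_of_def)
      ultimately obtain a b where ab: "F = closed_segment a b"
        using compact_convex_collinear_segment polytope_imp_compact polytope_imp_convex collinear_aff_dim
        by (metis order_refl)
      have "a \<noteq> b" using \<open>aff_dim F = 1\<close> ab by auto
      then show ?thesis using smooth_arc_linepath ab by (metis path_image_linepath)
    qed
    then obtain G where G: "\<And>F. F facet_of K \<Longrightarrow> smooth_arc (G F) \<and> path_image (G F) = F" by metis
    have "frontier K = \<Union>{F. F facet_of K}"
      using rel_frontier_of_polyhedron[OF cv(3)] rel_frontier_nonempty_interior[OF assms(2)] by simp
    also have "\<dots> = (\<Union>\<gamma>\<in>G ` {F. F facet_of K}. path_image \<gamma>)" using G by auto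
    finally show ?thesis using G finite_polyhedron_facets[OF cv(3)]
      by (intro exI[of _ "G ` {F. F facet_of K}"]) auto
  qed
  ultimately show ?thesis using cv unfolding planar_region_def by blast
qed

text \<open>The degenerate case \<open>a = 0\<close> is included because a plane parallel to a face
  restricts to a constant condition on it.\<close>

lemma polyhedron_closure_halfspace:
  fixes a :: "'a::euclidean_space"
  shows "polyhedron (closure {x. a \<bullet> x < b})" "polyhedron (closure {x. a \<bullet> x > b})"
  by (cases "a = 0"; cases "0 < b"; cases "b < 0"; simp add: polyhedron_halfspace_le polyhedron_halfspace_ge closure_halfspace_lt closure_halfspace_gt)+

definition cell :: "('a::euclidean_space \<times> real) set \<Rightarrow> 'a \<Rightarrow> 'a set" where
  "cell A q = {y. same_side A q y}"

lemma cell_mem [simp]: "q \<in> cell A q"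
  by (simp add: cell_def)

lemma finite_cells:
  assumes "finite A"
  shows "finite (range (cell A))"
proof -
  have "cell A q \<in> (\<lambda>\<sigma>. {y. \<forall>h\<in>A. sgn (fst h \<bullet> y - snd h) = \<sigma> h}) ` (PiE A (\<lambda>_. {-1, 0, 1::real}))" for q
    by (rule image_eqI[of _ _ "restrict (\<lambda>h. sgn (fst h \<bullet> q - snd h)) A"])
       (auto simp: cell_def same_side_def sgn_real_def split: prod.splits)
  moreover have "finite (PiE A (\<lambda>_. {-1, 0, 1::real}))" using assms by (intro finite_PiE) auto
  ultimately show ?thesis by (meson finite_imageI finite_subset image_subsetI)
qed

text \<open>In linear coordinates \<open>f\<close> on the only plane through \<open>q\<close>, the
  cell becomes a bounded open convex set \<open>U\<close>, cut out by the half-planes that the other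
  planes induce. Its closure is a convex polygon.\<close>

lemma cell_patch:
  fixes A :: "(space3 \<times> real) set"
  assumes A: "finite A" and q: "only_plane A q a b" "a \<noteq> 0" and bd: "bounded (cell A q)"
  obtains K \<phi> where "surface_patch K \<phi>" "\<phi> ` K = closure (cell A q)" "inj \<phi>"
    "\<phi> ` interior K = cell A q"
proof -
  have qa: "(a, b) \<in> A" "a \<bullet> q = b" using q by (auto simp: only_plane_def)
  have "dim (UNIV :: (real^2) set) = dim {v. a \<bullet> v = 0}"
    using dim_hyperplane[OF q(2)] by (simp add: DIM_prod)
  then obtain f :: "real^2 \<Rightarrow> space3" where f: "linear f" "f ` UNIV = {v. a \<bullet> v = 0}" "inj f"
    using subspace_isomorphism[of "UNIV :: (real^2) set" "{v. a \<bullet> v = 0}"] subspace_hyperplane[of a] by auto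
  define \<phi> where "\<phi> u = q + f u" for u
  have bl: "bounded_linear f" using f(1) linear_conv_bounded_linear by blast
  define T where "T h = {u. fst h \<bullet> f u > snd h - fst h \<bullet> q}" for h
  define T' where "T' h = {u. fst h \<bullet> f u < snd h - fst h \<bullet> q}" for h
  define F where "F = (\<lambda>h. if fst h \<bullet> q > snd h then T h else T' h) ` (A - {(a, b)})"
  have linh: "\<exists>w. \<forall>u. fst h \<bullet> f u = w \<bullet> u" for h :: "space3 \<times> real"
    by (metis adjoint_works f(1) inner_commute)
  obtain g where g: "\<And>(h :: space3 \<times> real) u. fst h \<bullet> f u = g h \<bullet> u" using linh by metis
  have Tg: "T h = {u. g h \<bullet> u > snd h - fst h \<bullet> q}" "T' h = {u. g h \<bullet> u < snd h - fst h \<bullet> q}" for h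
    by (simp_all add: T_def T'_def g)
  define U where "U = \<Inter>F"
  have finF: "finite F" using A by (simp add: F_def)
  have conv: "convex S \<and> open S \<and> polyhedron (closure S)" if "S \<in> F" for S
    using that by (auto simp: F_def Tg convex_halfspace_gt convex_halfspace_lt open_halfspace_gt open_halfspace_lt polyhedron_closure_halfspace)
  have oU: "open U" "convex U" using conv finF unfolding U_def
    by (auto intro: open_Inter convex_Inter)
  have ne: "fst h \<bullet> q \<noteq> snd h" if "h \<in> A - {(a, b)}" for h
    using q(1) that unfolding only_plane_def by (metis (mono_tags, lifting) Diff_iff case_prodD insert_iff prod.collapse)
  have U0: "0 \<in> U"
  proof -
    have "0 \<in> (if fst h \<bullet> q > snd h then T h else T' h)" if "h \<in> A - {(a, b)}" for h
      using ne[OF that] by (auto simp: T_def T'_def linear_0[OF f(1)])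
    then show ?thesis unfolding U_def F_def by blast
  qed
  have UU: "u \<in> U \<longleftrightarrow> \<phi> u \<in> cell A q" for u
  proof -
    have "u \<in> U \<longleftrightarrow> (\<forall>h\<in>A - {(a, b)}. sgn (fst h \<bullet> q - snd h) = sgn (fst h \<bullet> \<phi> u - snd h))"
    proof -
      have "(u \<in> (if fst h \<bullet> q > snd h then T h else T' h)) \<longleftrightarrow> sgn (fst h \<bullet> q - snd h) = sgn (fst h \<bullet> \<phi> u - snd h)"
        if "h \<in> A - {(a, b)}" for h
        using ne[OF that] by (auto simp: T_def T'_def \<phi>_def inner_add_right sgn_real_def)
      then have "(\<forall>h\<in>A - {(a, b)}. u \<in> (if fst h \<bullet> q > snd h then T h else T' h)) \<longleftrightarrow>
          (\<forall>h\<in>A - {(a, b)}. sgn (fst h \<bullet> q - snd h) = sgn (fst h \<bullet> \<phi> u - snd h))"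
        by (rule ball_cong[OF refl])
      then show ?thesis unfolding U_def F_def INT_iff .
    qed
    moreover have "sgn (a \<bullet> q - b) = sgn (a \<bullet> \<phi> u - b)"
    proof -
      have "f u \<in> {v. a \<bullet> v = 0}" using f(2) by blast
      then show ?thesis by (simp add: \<phi>_def inner_add_right)
    qed
    moreover have "\<phi> u \<in> cell A q \<longleftrightarrow> (\<forall>h\<in>A. sgn (fst h \<bullet> q - snd h) = sgn (fst h \<bullet> \<phi> u - snd h))"
      by (simp add: cell_def same_side_def case_prod_unfold)
    moreover have "(\<forall>h\<in>A. R h) \<longleftrightarrow> R (a, b) \<and> (\<forall>h\<in>A - {(a, b)}. R h)" for R
      using qa(1) by blast
    ultimately show ?thesis by simp
  qed
  have onto: "y \<in> range \<phi>" if "y \<in> cell A q" for y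
  proof -
    have "sgn (a \<bullet> q - b) = sgn (a \<bullet> y - b)" using that qa(1) unfolding cell_def same_side_def by fastforce
    then have "y - q \<in> f ` UNIV" using qa(2) f(2) by (simp add: inner_diff_right sgn_0_0)
    then obtain u where "y - q = f u" by blast
    then have "y = \<phi> u" by (simp add: \<phi>_def algebra_simps)
    then show ?thesis by blast
  qed
  have im: "\<phi> ` U = cell A q" using UU onto by blast
  define K where "K = closure U"
  have "\<phi> ` K = (+) q ` (f ` closure U)" by (auto simp: \<phi>_def K_def)
  also have "\<dots> = (+) q ` closure (f ` U)" using closure_injective_linear_image[OF f(1,3)] by simp
  also have "\<dots> = closure ((+) q ` (f ` U))" by (rule closure_translation[symmetric])
  also have "(+) q ` (f ` U) = \<phi> ` U" by (auto simp: \<phi>_def)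
  finally have cl: "\<phi> ` K = closure (cell A q)" using im by simp
  have "inj \<phi>" using f(3) by (auto simp: inj_def \<phi>_def)
  have intK: "interior K = U" unfolding K_def using oU
    by (metis convex_interior_closure interior_open)
  have "bounded (f ` U)"
  proof -
    have "f ` U = (+) (- q) ` (\<phi> ` U)" by (auto simp: \<phi>_def image_image)
    then show ?thesis using bd im by (simp add: bounded_translation_minus)
  qed
  then have "bounded U"
  proof -
    assume b: "bounded (f ` U)"
    obtain B where B: "B > 0" "\<And>x. B * norm x \<le> norm (f x)"
      using linear_inj_bounded_below_pos[OF f(1,3)] by blast
    obtain C where C: "\<And>x. x \<in> f ` U \<Longrightarrow> norm x \<le> C" using b unfolding bounded_iff by blast
    have "norm x \<le> C / B" if "x \<in> U" for x
    proof -
      have "B * norm x \<le> C" using C[of "f x"] B(2)[of x] that by force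
      then show ?thesis using B(1) by (simp add: field_simps)
    qed
    then show ?thesis unfolding bounded_iff by blast
  qed
  then have "bounded K" by (simp add: K_def bounded_closure)
  \<comment> \<open>Closure commutes with the intersection of open convex sets that have a common
    point, here \<open>0\<close>.\<close>
  have "K = \<Inter>{closure S |S. S \<in> F}" unfolding K_def U_def
    using closure_Inter_convex_open[of F] conv U0 U_def by auto
  also have "\<dots> = \<Inter>(closure ` F)" by auto
  finally have "polyhedron K" using finF conv by (auto intro!: polyhedron_Inter)
  then have "polytope K" using \<open>bounded K\<close> by (simp add: polytope_eq_bounded_polyhedron)
  then have "planar_region K" using planar_region_convex_polygon intK U0 by blast
  moreover have "inj (frechet_derivative \<phi> (at u))" for u
  proof -
    have "(\<phi> has_derivative f) (at u)" unfolding \<phi>_def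
      by (auto intro!: derivative_eq_intros bounded_linear_imp_has_derivative bl)
    then have "frechet_derivative \<phi> (at u) = f" using frechet_derivative_at by metis
    then show ?thesis using f(3) by simp
  qed
  moreover have "smooth_on \<phi> UNIV" using smooth_on_affine[OF bl, of q UNIV] by (simp add: \<phi>_def[abs_def])
  ultimately have "surface_patch K \<phi>" unfolding surface_patch_def by blast
  then show ?thesis using that cl \<open>inj \<phi>\<close> im intK by metis
qed

text \<open>The patches are the closures of the faces of generic frontier points. They cover the
  frontier, since generic points are dense in it and there are finitely many faces.\<close>

lemma frontier_patches:
  fixes B :: "space3 set"
  assumes A: "finite A" "reduced A" and B: "compact B" "closure (interior B) = B" "invariant_under A B"
  obtains n :: nat and K \<phi> where "\<And>i. i < n \<Longrightarrow> surface_patch (K i) (\<phi> i)"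
    "frontier B = (\<Union>i<n. \<phi> i ` K i)"
    "\<And>i j u v. i < n \<Longrightarrow> j < n \<Longrightarrow> u \<in> interior (K i) \<Longrightarrow> v \<in> K j \<Longrightarrow> \<phi> i u = \<phi> j v \<Longrightarrow> i = j \<and> u = v"
proof -
  define CC where "CC = {cell A q | q a b. q \<in> frontier B \<and> only_plane A q a b}"
  have clB: "closed B" using B(1) compact_imp_closed by blast
  have "CC \<subseteq> range (cell A)" by (auto simp: CC_def)
  then have fin: "finite CC" using finite_cells[OF A(1)] finite_subset by blast
  have nz: "a \<noteq> 0" if "only_plane A q a b" for q a b
    using that A(2) unfolding only_plane_def reduced_def by blast
  have sub: "c \<subseteq> frontier B" if "c \<in> CC" for c
    using that frontier_only_plane_cell[OF A(1) clB B(3)] nz unfolding CC_def cell_def by blast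
  have "compact (frontier B)" using B(1) by (rule compact_frontier)
  then have bdc: "bounded c" if "c \<in> CC" for c
    using sub[OF that] bounded_subset compact_imp_bounded by blast
  have "\<exists>K \<phi>. surface_patch K \<phi> \<and> \<phi> ` K = closure c \<and> inj \<phi> \<and> \<phi> ` interior K = c" if c: "c \<in> CC" for c
  proof -
    obtain q a b where q: "c = cell A q" "only_plane A q a b" using c by (auto simp: CC_def)
    show ?thesis using cell_patch[OF A(1) q(2) nz[OF q(2)]] bdc[OF c] q(1) by metis
  qed
  then obtain KK \<Phi> where P: "\<And>c. c \<in> CC \<Longrightarrow> surface_patch (KK c) (\<Phi> c) \<and> \<Phi> c ` KK c = closure c
      \<and> inj (\<Phi> c) \<and> \<Phi> c ` interior (KK c) = c" by metis
  obtain e :: "nat \<Rightarrow> space3 set" and n where e: "CC = e ` {i. i < n}" "inj_on e {i. i < n}"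
    using finite_imp_nat_seg_image_inj_on[OF fin] by blast
  have eC: "e i \<in> CC" if "i < n" for i using e(1) that by blast
  have fr: "frontier B = (\<Union>c\<in>CC. closure c)"
  proof
    show "(\<Union>c\<in>CC. closure c) \<subseteq> frontier B" using sub closure_minimal frontier_closed by blast
    have cl: "closed (\<Union>c\<in>CC. closure c)" using fin by blast
    show "frontier B \<subseteq> (\<Union>c\<in>CC. closure c)"
    proof (rule ccontr)
      assume "\<not> ?thesis"
      then obtain p where p: "p \<in> frontier B" "p \<in> - (\<Union>c\<in>CC. closure c)" by blast
      have "open (- (\<Union>c\<in>CC. closure c))" using cl by blast
      then obtain q a b where q: "q \<in> - (\<Union>c\<in>CC. closure c)" "q \<in> frontier B" "only_plane A q a b"
        using frontier_generic_dense[OF A B(2,3) p(1) _ p(2)] by blast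
      then have "cell A q \<in> CC" unfolding CC_def by blast
      then show False using q(1) closure_subset cell_mem by blast
    qed
  qed
  \<comment> \<open>The plane of \<open>c'\<close> contains \<open>y\<close>, so it is the only
    plane through \<open>y\<close>, which is the plane of \<open>c\<close>. A point of
    \<open>c'\<close> close to \<open>y\<close> then has the sign vector of \<open>y\<close>, and
    the two faces coincide.\<close>
  have disj: "c = c'" if y: "c \<in> CC" "c' \<in> CC" "y \<in> c" "y \<in> closure c'" for c c' y
  proof -
    obtain q a b where q: "c = cell A q" "only_plane A q a b" using y(1) by (auto simp: CC_def)
    obtain q' a' b' where q': "c' = cell A q'" "only_plane A q' a' b'" using y(2) by (auto simp: CC_def)
    have yq: "same_side A q y" using y(3) q by (simp add: cell_def)
    have zer: "\<alpha> \<bullet> y = \<beta> \<longleftrightarrow> \<alpha> \<bullet> q = \<beta>" if "(\<alpha>, \<beta>) \<in> A" for \<alpha> \<beta>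
    proof -
      have "sgn (\<alpha> \<bullet> q - \<beta>) = sgn (\<alpha> \<bullet> y - \<beta>)" using yq that unfolding same_side_def by blast
      then show ?thesis by (metis eq_iff_diff_eq_0 sgn_0_0)
    qed
    have q'A: "(a', b') \<in> A" "a' \<bullet> q' = b'" using q'(2) by (auto simp: only_plane_def)
    have inpl: "a' \<bullet> z = b'" if "z \<in> c'" for z
    proof -
      have "sgn (a' \<bullet> q' - b') = sgn (a' \<bullet> z - b')" using that q'A(1) unfolding q'(1) cell_def same_side_def by blast
      then show ?thesis using q'A(2) by (simp add: sgn_0_0)
    qed
    have "closure c' \<subseteq> {z. a' \<bullet> z = b'}" using inpl by (intro closure_minimal closed_hyperplane) auto
    then have "a' \<bullet> y = b'" using y(4) by blast
    then have ab: "a' = a" "b' = b" using q(2) zer[OF q'A(1)] q'A(1) unfolding only_plane_def by blast+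
    obtain r where r: "r > 0"
      "\<And>z \<alpha> \<beta>. dist y z < r \<Longrightarrow> (\<alpha>, \<beta>) \<in> A \<Longrightarrow> \<alpha> \<bullet> y \<noteq> \<beta> \<Longrightarrow> sgn (\<alpha> \<bullet> z - \<beta>) = sgn (\<alpha> \<bullet> y - \<beta>)"
      using sgn_stable[OF A(1)] by metis
    obtain z where z: "z \<in> c'" "dist z y < r" using y(4) r(1) by (meson closure_approachable)
    have "same_side A y z" unfolding same_side_def
    proof (intro ballI, clarify)
      fix \<alpha> \<beta> assume h: "(\<alpha>, \<beta>) \<in> A"
      show "sgn (\<alpha> \<bullet> y - \<beta>) = sgn (\<alpha> \<bullet> z - \<beta>)"
      proof (cases "\<alpha> \<bullet> y = \<beta>")
        case True
        then have "\<alpha> = a" "\<beta> = b" using zer[OF h] q(2) h unfolding only_plane_def by blast+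
        then show ?thesis using inpl[OF z(1)] ab True by simp
      next
        case False
        then show ?thesis using r(2)[OF _ h False] z(2) by (simp add: dist_commute)
      qed
    qed
    then have "same_side A q q'" using yq z(1) same_side_trans same_side_sym unfolding q'(1) cell_def by blast
    then show "c = c'" unfolding q(1) q'(1) cell_def using same_side_trans same_side_sym by blast
  qed
  show ?thesis
  proof (rule that[of n "\<lambda>i. KK (e i)" "\<lambda>i. \<Phi> (e i)"])
    show "surface_patch (KK (e i)) (\<Phi> (e i))" if "i < n" for i using P eC[OF that] by blast
    show "frontier B = (\<Union>i<n. \<Phi> (e i) ` KK (e i))"
      unfolding fr using P eC e(1) by auto
    fix i j u v assume *: "i < n" "j < n" "u \<in> interior (KK (e i))" "v \<in> KK (e j)" "\<Phi> (e i) u = \<Phi> (e j) v"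
    have "\<Phi> (e i) u \<in> e i" using P[OF eC[OF *(1)]] *(3) by blast
    moreover have "\<Phi> (e i) u \<in> closure (e j)" using P[OF eC[OF *(2)]] *(4,5) by (metis imageI)
    ultimately have "e i = e j" using disj eC * by blast
    then have "i = j" using e(2) * by (auto dest: inj_onD)
    moreover have "u = v" using P[OF eC[OF *(1)]] *(5) \<open>i = j\<close> by (simp add: inj_eq)
    ultimately show "i = j \<and> u = v" by blast
  qed
qed

section \<open>Bodies composed of a floor and prisms\<close>

text \<open>The normals are scaled so that proportional ones are equal, as \<open>reduced\<close>
  demands. The faces of all prisms lie in such planes.\<close>

definition canonical_planes :: "(space3 \<times> real) set" where
  "canonical_planes = {h. fst h = (axis 1 1, 0) \<or> fst h = (axis 2 1, 0) \<or> (\<exists>q. fst h = (- q *\<^sub>R axis 1 1, 1))}"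

lemma canonical_planes_components:
  assumes "(a, b) \<in> canonical_planes"
  shows "(fst a $ 1 = 1 \<and> fst a $ 2 = 0 \<and> snd a = 0) \<or> (fst a $ 1 = 0 \<and> fst a $ 2 = 1 \<and> snd a = 0) \<or>
    (fst a $ 2 = 0 \<and> snd a = 1)"
proof -
  have "axis 1 (1::real) $ 1 = 1" "axis 1 (1::real) $ (2::2) = 0" "axis 2 (1::real) $ (1::2) = 0" "axis 2 (1::real) $ (2::2) = 1"
    by (simp_all add: axis_def)
  then show ?thesis using assms unfolding canonical_planes_def by auto
qed

lemma reduced_canonical:
  assumes "A \<subseteq> canonical_planes"
  shows "reduced A"
proof -
  have "a \<noteq> 0" if "(a, b) \<in> A" for a b
    using canonical_planes_components[of a b] assms that by auto
  moreover have "k = 1" if "(a, b) \<in> A" "(a', b') \<in> A" "a' = k *\<^sub>R a" for a b a' b' k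
  proof -
    have e: "fst a' $ 1 = k * fst a $ 1" "fst a' $ 2 = k * fst a $ 2" "snd a' = k * snd a"
      using that(3) by simp_all
    have c: "(a, b) \<in> canonical_planes" "(a', b') \<in> canonical_planes" using that assms by blast+
    then show ?thesis
      using canonical_planes_components[of a b, OF c(1)] canonical_planes_components[of a' b', OF c(2)]
      unfolding e
      by (elim disjE conjE; simp)
  qed
  ultimately show ?thesis unfolding reduced_def by fast
qed

text \<open>One shape for walls, slats and mirrors, so that frontiers have to be analysed only
  once.\<close>

definition prism :: "real \<Rightarrow> real \<Rightarrow> real \<Rightarrow> real \<Rightarrow> real \<Rightarrow> real \<Rightarrow> real \<Rightarrow> real \<Rightarrow> space3 set" where
  "prism a b c d p q p' q' = {y. a \<le> fst y $ 1 \<and> fst y $ 1 \<le> b \<and> c \<le> fst y $ 2 \<and> fst y $ 2 \<le> d \<and>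
     p + q * fst y $ 1 \<le> snd y \<and> snd y \<le> p' + q' * fst y $ 1}"

definition is_prism :: "space3 set \<Rightarrow> bool" where
  "is_prism P \<longleftrightarrow> (\<exists>a b c d p q p' q'. a < b \<and> c < d \<and> (\<forall>x\<in>{a..b}. p + q * x < p' + q' * x) \<and>
     P = prism a b c d p q p' q')"

lemma is_prismI:
  assumes "a < b" "c < d" "\<And>x. a \<le> x \<Longrightarrow> x \<le> b \<Longrightarrow> p + q * x < p' + q' * x"
  shows "is_prism (prism a b c d p q p' q')"
  unfolding is_prism_def
  by (rule exI[of _ a], rule exI[of _ b], rule exI[of _ c], rule exI[of _ d],
      rule exI[of _ p], rule exI[of _ q], rule exI[of _ p'], rule exI[of _ q']) (use assms in auto)

lemma prism_mem: "(x, z) \<in> prism a b c d p q p' q' \<longleftrightarrow>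
   a \<le> x $ 1 \<and> x $ 1 \<le> b \<and> c \<le> x $ 2 \<and> x $ 2 \<le> d \<and> p + q * x $ 1 \<le> z \<and> z \<le> p' + q' * x $ 1"
  by (simp add: prism_def)

lemma closed_prism: "closed (prism a b c d p q p' q')"
  unfolding prism_def by (intro closed_Collect_conj closed_Collect_le continuous_intros)

lemma convex_prism: "convex (prism a b c d p q p' q')"
proof -
  have *: "convex {y :: space3. \<alpha> \<bullet> y \<le> \<beta>}" for \<alpha> \<beta> by (rule convex_halfspace_le)
  have e: "prism a b c d p q p' q' = {y. (- axis 1 1, 0) \<bullet> y \<le> - a} \<inter> {y. (axis 1 1, 0) \<bullet> y \<le> b} \<inter>
     {y. (- axis 2 1, 0) \<bullet> y \<le> - c} \<inter> {y. (axis 2 1, 0) \<bullet> y \<le> d} \<inter>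
     {y. (q *\<^sub>R axis 1 1, -1) \<bullet> y \<le> - p} \<inter> {y. (- q' *\<^sub>R axis 1 1, 1) \<bullet> y \<le> p'}"
    by (auto simp: prism_def inner_axis' algebra_simps)
  show ?thesis unfolding e by (intro convex_Int *)
qed

lemma bounded_prism: "bounded (prism a b c d p q p' q')"
proof -
  have "prism a b c d p q p' q' \<subseteq> cbox (vector [a, c]) (vector [b, d]) \<times>
    {p - \<bar>q\<bar> * (\<bar>a\<bar> + \<bar>b\<bar>) .. p' + \<bar>q'\<bar> * (\<bar>a\<bar> + \<bar>b\<bar>)}"
  proof clarify
    fix x z assume *: "(x, z) \<in> prism a b c d p q p' q'"
    then have "\<bar>x $ 1\<bar> \<le> \<bar>a\<bar> + \<bar>b\<bar>" by (auto simp: prism_mem)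
    then have "\<bar>q * x $ 1\<bar> \<le> \<bar>q\<bar> * (\<bar>a\<bar> + \<bar>b\<bar>)" "\<bar>q' * x $ 1\<bar> \<le> \<bar>q'\<bar> * (\<bar>a\<bar> + \<bar>b\<bar>)"
      by (auto simp: abs_mult mult_left_mono)
    then have "p - \<bar>q\<bar> * (\<bar>a\<bar> + \<bar>b\<bar>) \<le> z" "z \<le> p' + \<bar>q'\<bar> * (\<bar>a\<bar> + \<bar>b\<bar>)"
      using *[unfolded prism_mem] by (smt (verit))+
    then show "x \<in> cbox (vector [a, c]) (vector [b, d]) \<and> z \<in> {p - \<bar>q\<bar> * (\<bar>a\<bar> + \<bar>b\<bar>)..p' + \<bar>q'\<bar> * (\<bar>a\<bar> + \<bar>b\<bar>)}"
      using * by (auto simp: prism_mem mem_box_cart forall_2 vector_2)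
  qed
  then show ?thesis
    by (rule bounded_subset[rotated]) (intro bounded_Times bounded_cbox bounded_closed_interval)
qed

lemma compact_prism: "compact (prism a b c d p q p' q')"
  using closed_prism bounded_prism compact_eq_bounded_closed by blast

lemma prism_regular:
  assumes "a < b" "c < d" "\<forall>x\<in>{a..b}. p + q * x < p' + q' * x"
  shows "prism a b c d p q p' q' \<subseteq> closure (interior (prism a b c d p q p' q'))"
proof -
  define U where "U = {y :: space3. a < fst y $ 1 \<and> fst y $ 1 < b \<and> c < fst y $ 2 \<and> fst y $ 2 < d \<and>
     p + q * fst y $ 1 < snd y \<and> snd y < p' + q' * fst y $ 1}"
  have "open U" unfolding U_def by (intro open_Collect_conj open_Collect_less continuous_intros)
  moreover have "U \<subseteq> prism a b c d p q p' q'" by (auto simp: U_def prism_def)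
  ultimately have sub: "U \<subseteq> interior (prism a b c d p q p' q')" by (simp add: interior_maximal)
  define m where "m = (a + b) / 2"
  have "m \<in> {a..b}" using assms(1) by (simp add: m_def)
  then have "p + q * m < p' + q' * m" using assms(3) by blast
  then have "(vector [m, (c + d) / 2], ((p + q * m) + (p' + q' * m)) / 2) \<in> U"
    using assms by (auto simp: U_def m_def)
  then have "interior (prism a b c d p q p' q') \<noteq> {}" using sub by blast
  then show ?thesis using convex_closure_interior[OF convex_prism] closure_subset by metis
qed

definition prism_planes :: "real \<Rightarrow> real \<Rightarrow> real \<Rightarrow> real \<Rightarrow> real \<Rightarrow> real \<Rightarrow> real \<Rightarrow> real \<Rightarrow> (space3 \<times> real) set" where
  "prism_planes a b c d p q p' q' = {((axis 1 1, 0), a), ((axis 1 1, 0), b), ((axis 2 1, 0), c),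
     ((axis 2 1, 0), d), ((- q *\<^sub>R axis 1 1, 1), p), ((- q' *\<^sub>R axis 1 1, 1), p')}"

lemma prism_planes: "finite (prism_planes a b c d p q p' q')" "prism_planes a b c d p q p' q' \<subseteq> canonical_planes"
  unfolding prism_planes_def canonical_planes_def insert_subset mem_Collect_eq fst_conv by blast+

lemma invariant_prism: "invariant_under (prism_planes a b c d p q p' q') (prism a b c d p q p' q')"
  unfolding invariant_under_def
proof (intro allI impI)
  fix x y :: space3
  assume s: "same_side (prism_planes a b c d p q p' q') x y" and x: "x \<in> prism a b c d p q p' q'"
  have sg: "u \<le> v \<longleftrightarrow> u' \<le> v'" if "sgn (u - v) = sgn (u' - v')" for u v u' v' :: real
    using that by (auto simp: sgn_real_def split: if_splits)
  have sg': "v \<le> u \<longleftrightarrow> v' \<le> u'" if "sgn (u - v) = sgn (u' - v')" for u v u' v' :: real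
    using that by (auto simp: sgn_real_def split: if_splits)
  have in1: "(r *\<^sub>R axis i 1, t) \<bullet> w = r * fst w $ i + t * snd w" "(axis i 1, t) \<bullet> w = fst w $ i + t * snd w"
    for r t and i :: 2 and w :: space3
    by (simp_all add: inner_prod_def inner_axis')
  have s0: "sgn (\<alpha> \<bullet> x - \<beta>) = sgn (\<alpha> \<bullet> y - \<beta>)" if "(\<alpha>, \<beta>) \<in> prism_planes a b c d p q p' q'" for \<alpha> \<beta>
    using s that unfolding same_side_def by blast
  have m: "((axis 1 1, 0), a) \<in> prism_planes a b c d p q p' q'" "((axis 1 1, 0), b) \<in> prism_planes a b c d p q p' q'"
    "((axis 2 1, 0), c) \<in> prism_planes a b c d p q p' q'" "((axis 2 1, 0), d) \<in> prism_planes a b c d p q p' q'"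
    "((- q *\<^sub>R axis 1 1, 1), p) \<in> prism_planes a b c d p q p' q'" "((- q' *\<^sub>R axis 1 1, 1), p') \<in> prism_planes a b c d p q p' q'"
    unfolding prism_planes_def by blast+
  have s': "sgn (fst x $ 1 - a) = sgn (fst y $ 1 - a)" "sgn (fst x $ 1 - b) = sgn (fst y $ 1 - b)"
    "sgn (fst x $ 2 - c) = sgn (fst y $ 2 - c)" "sgn (fst x $ 2 - d) = sgn (fst y $ 2 - d)"
    "sgn (- q * fst x $ 1 + snd x - p) = sgn (- q * fst y $ 1 + snd y - p)"
    "sgn (- q' * fst x $ 1 + snd x - p') = sgn (- q' * fst y $ 1 + snd y - p')"
    using s0[OF m(1)] s0[OF m(2)] s0[OF m(3)] s0[OF m(4)] s0[OF m(5)] s0[OF m(6)]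
    unfolding in1 mult_zero_left mult_1_left add_0_right .
  have "p + q * fst x $ 1 \<le> snd x \<longleftrightarrow> p + q * fst y $ 1 \<le> snd y"
    using sg'[OF s'(5)] by (auto simp: algebra_simps)
  moreover have "snd x \<le> p' + q' * fst x $ 1 \<longleftrightarrow> snd y \<le> p' + q' * fst y $ 1"
    using sg[OF s'(6)] by (auto simp: algebra_simps)
  ultimately show "y \<in> prism a b c d p q p' q'"
    using x sg'[OF s'(1)] sg[OF s'(2)] sg'[OF s'(3)] sg[OF s'(4)] by (simp only: prism_def mem_Collect_eq)
qed

lemma same_side_mono: "same_side A x y \<Longrightarrow> A' \<subseteq> A \<Longrightarrow> same_side A' x y"
  by (auto simp: same_side_def)

lemma closure_interior_Union:
  assumes "finite \<C>" "\<And>C. C \<in> \<C> \<Longrightarrow> closed C \<and> C \<subseteq> closure (interior C)"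
  shows "closure (interior (\<Union>\<C>)) = \<Union>\<C>"
proof
  have "closed (\<Union>\<C>)" using assms by (intro closed_Union) auto
  then show "closure (interior (\<Union>\<C>)) \<subseteq> \<Union>\<C>" by (simp add: closure_minimal interior_subset)
  show "\<Union>\<C> \<subseteq> closure (interior (\<Union>\<C>))"
  proof (rule Union_least)
    fix C assume C: "C \<in> \<C>"
    then have "closure (interior C) \<subseteq> closure (interior (\<Union>\<C>))"
      by (intro closure_mono interior_mono Union_upper)
    then show "C \<subseteq> closure (interior (\<Union>\<C>))" using assms(2)[OF C] by blast
  qed
qed

lemma prism_union_planes:
  assumes "finite \<C>" "\<And>C. C \<in> \<C> \<Longrightarrow> is_prism C"
  obtains A where "finite A" "A \<subseteq> canonical_planes" "invariant_under A (\<Union>\<C>)"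
proof -
  have "\<forall>C\<in>\<C>. \<exists>A. finite A \<and> A \<subseteq> canonical_planes \<and> invariant_under A C"
  proof
    fix C assume C: "C \<in> \<C>"
    obtain a b c d p q p' q' where "C = prism a b c d p q p' q'"
      using assms(2)[OF C] unfolding is_prism_def by blast
    then show "\<exists>A. finite A \<and> A \<subseteq> canonical_planes \<and> invariant_under A C"
      using prism_planes[of a b c d p q p' q'] invariant_prism[of a b c d p q p' q'] by blast
  qed
  then obtain AA where "\<forall>C\<in>\<C>. finite (AA C) \<and> AA C \<subseteq> canonical_planes \<and> invariant_under (AA C) C"
    by (rule bchoice[THEN exE])
  then have AA: "finite (AA C) \<and> AA C \<subseteq> canonical_planes \<and> invariant_under (AA C) C" if "C \<in> \<C>" for C
    using that by blast
  show ?thesis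
  proof
    show "finite (\<Union>C\<in>\<C>. AA C)" using assms(1) AA by (intro finite_UN_I) auto
    show "(\<Union>C\<in>\<C>. AA C) \<subseteq> canonical_planes" using AA by (intro UN_least) auto
    show "invariant_under (\<Union>C\<in>\<C>. AA C) (\<Union>\<C>)" unfolding invariant_under_def
    proof (intro allI impI)
      fix x y assume s: "same_side (\<Union>C\<in>\<C>. AA C) x y" and "x \<in> \<Union>\<C>"
      then obtain C where C: "C \<in> \<C>" "x \<in> C" by blast
      have "same_side (AA C) x y" by (rule same_side_mono[OF s]) (use C(1) in blast)
      moreover have "invariant_under (AA C) C" using AA[OF C(1)] by blast
      ultimately have "y \<in> C" using invariant_underD C(2) by blast
      then show "y \<in> \<Union>\<C>" using C(1) by blast
    qed
  qed
qed

text \<open>A vertical plane fixes one coordinate of \<open>x\<close>, and two planes of different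
  slopes meet over a single value of \<open>x $ 1\<close>. Excluding finitely many values of each
  coordinate, rather than some null set, makes it possible to pull the condition back along
  flights.\<close>

lemma generic_only_plane:
  assumes A: "finite A" "A \<subseteq> canonical_planes"
  obtains F1 F2 where "finite F1" "finite F2"
    "\<And>x z a b. (a, b) \<in> A \<Longrightarrow> a \<bullet> (x, z) = b \<Longrightarrow> x $ 1 \<notin> F1 \<Longrightarrow> x $ 2 \<notin> F2 \<Longrightarrow> only_plane A (x, z) a b"
proof -
  \<comment> \<open>For two nonvertical planes the quotient is the abscissa where they cross. Pairs
    with denominator zero contribute the value \<open>0\<close>, which merely enlarges a finite
    set.\<close>
  define F1 where "F1 = snd ` A \<union> (\<lambda>(h, h'). (snd h - snd h') / (fst (fst h) $ 1 - fst (fst h') $ 1)) ` (A \<times> A)"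
  show ?thesis
  proof
    show "finite F1" "finite (snd ` A)" using A(1) by (simp_all add: F1_def)
    fix x :: "real^2" and z a b
    assume h: "(a, b) \<in> A" "a \<bullet> (x, z) = b" and x: "x $ 1 \<notin> F1" "x $ 2 \<notin> snd ` A"
    have form: "\<exists>q. \<alpha> = (- q *\<^sub>R axis 1 1, 1)" if \<alpha>: "(\<alpha>, \<beta>) \<in> A" "\<alpha> \<bullet> (x, z) = \<beta>" for \<alpha> \<beta>
    proof -
      have "(\<alpha>, \<beta>) \<in> canonical_planes" using \<alpha>(1) A(2) by (rule rev_subsetD)
      then consider "\<alpha> = (axis 1 1, 0)" | "\<alpha> = (axis 2 1, 0)" | "\<exists>q. \<alpha> = (- q *\<^sub>R axis 1 1, 1)"
        unfolding canonical_planes_def mem_Collect_eq fst_conv by (elim disjE)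
      then show ?thesis
      proof cases
        case 1
        then have "x $ 1 = \<beta>" using \<alpha>(2) by (simp add: inner_axis')
        then have "x $ 1 \<in> F1" using image_eqI[of "x $ 1" snd "(\<alpha>, \<beta>)" A] \<alpha>(1) by (simp add: F1_def)
        then show ?thesis using x(1) by simp
      next
        case 2
        then have "x $ 2 = \<beta>" using \<alpha>(2) by (simp add: inner_axis')
        then have "x $ 2 \<in> snd ` A" using image_eqI[of "x $ 2" snd "(\<alpha>, \<beta>)" A] \<alpha>(1) by simp
        then show ?thesis using x(2) by simp
      qed
    qed
    have un: "a' = a \<and> b' = b" if h': "(a', b') \<in> A" "a' \<bullet> (x, z) = b'" for a' b'
    proof -
      obtain q where q: "a = (- q *\<^sub>R axis 1 1, 1)" using form[OF h] by (elim exE)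
      obtain q' where q': "a' = (- q' *\<^sub>R axis 1 1, 1)" using form[OF h'] by (elim exE)
      have e: "- q * x $ 1 + z = b" "- q' * x $ 1 + z = b'"
        using h(2) h'(2) unfolding q q' by (simp_all add: inner_axis')
      have "q = q'"
      proof (rule ccontr)
        assume ne: "q \<noteq> q'"
        have "(b - b') = (q' - q) * x $ 1" unfolding e[symmetric] by (simp add: algebra_simps)
        then have "x $ 1 = (b - b') / (q' - q)" using ne by simp
        also have "\<dots> = (\<lambda>(h, h'). (snd h - snd h') / (fst (fst h) $ 1 - fst (fst h') $ 1)) ((a, b), (a', b'))"
          by (simp add: q q' axis_def)
        finally have "x $ 1 \<in> F1" unfolding F1_def
          by (rule UnI2[OF image_eqI]) (use h(1) h'(1) in simp)
        then show False using x(1) by simp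
      qed
      then show ?thesis using q q' e by (intro conjI) simp_all
    qed
    show "only_plane A (x, z) a b"
      unfolding only_plane_def by (intro conjI h ballI case_prodI2 impI) (use un in blast)+
  qed
qed

lemma unit_normal_cong:
  assumes "unit_normal S p n" "open V" "p \<in> V" "S \<inter> V = S' \<inter> V"
  shows "unit_normal S' p n"
proof -
  obtain W g c where W: "open W" "p \<in> W" "smooth_on g W" "S \<inter> W = {y \<in> W. g y = (0::real)}" "c \<noteq> 0"
      "GDERIV g p :> c *\<^sub>R n" "p \<in> S" "norm n = 1"
    using assms(1) by (auto simp: unit_normal_def)
  have "Ck_on k h (W \<inter> V)" if "Ck_on k h W" for k and h :: "space3 \<Rightarrow> real"
    using that by (induction k arbitrary: h) (auto intro: continuous_on_subset)
  then have "smooth_on g (W \<inter> V)" using W(3) by (simp add: smooth_on_def)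
  moreover have "S' \<inter> (W \<inter> V) = {y \<in> W \<inter> V. g y = 0}" using W(4) assms(4) by blast
  ultimately show ?thesis unfolding unit_normal_def using W assms
    by (intro conjI exI[of _ "W \<inter> V"] exI[of _ g] exI[of _ c]) auto
qed

lemma frontier_Int_open_eq:
  assumes "open V" "S \<inter> V = S' \<inter> V"
  shows "frontier S \<inter> V = frontier S' \<inter> V"
proof -
  have "V \<inter> closure S = V \<inter> closure S'"
    using open_Int_closure_subset[OF assms(1), of S] open_Int_closure_subset[OF assms(1), of S'] assms(2)
    by (smt (verit, best) Int_commute Int_lower1 Int_subset_iff closure_mono inf.coboundedI2 inf.orderE subset_antisym)
  moreover have "interior S \<inter> V = interior S' \<inter> V"
    using assms by (metis interior_Int interior_open)
  ultimately show ?thesis unfolding frontier_def by blast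
qed

text \<open>A unit normal is orthogonal to all segments of the graph that start at
  \<open>(x, h)\<close>. As \<open>C\<close> has interior points, this makes \<open>n\<close>
  parallel to \<open>(- v, 1)\<close>. The point \<open>x\<close> may lie on the boundary of
  \<open>C\<close>, so particles that hit the edge of a face are covered.\<close>

lemma graph_reflect:
  assumes n: "unit_normal S (x, h) n" and C: "convex C" "x \<in> C" "interior C \<noteq> {}"
    and S: "\<And>y. y \<in> C \<Longrightarrow> (y, h + v \<bullet> (y - x)) \<in> S"
  shows "reflect n w = w - (2 / (1 + v \<bullet> v) * (w \<bullet> (- v, 1))) *\<^sub>R (- v, 1)"
proof -
  define u where "u = fst n + snd n *\<^sub>R v"
  have "u \<bullet> y = u \<bullet> x" if y: "y \<in> C" for y
  proof -
    have "n \<bullet> (y - x, v \<bullet> (y - x)) = 0"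
    proof (rule unit_normal_tangent[OF n, of 1])
      fix s :: real assume s: "0 < s" "s < 1"
      then have "(1 - s) *\<^sub>R x + s *\<^sub>R y \<in> C" using C(1,2) y by (simp add: convex_alt)
      then have "x + s *\<^sub>R (y - x) \<in> C" by (simp add: algebra_simps)
      from S[OF this] show "(x, h) + s *\<^sub>R (y - x, v \<bullet> (y - x)) \<in> S" by simp
    qed simp
    then show ?thesis by (cases n) (simp add: u_def inner_add_left inner_diff_right algebra_simps)
  qed
  then have "C \<subseteq> {y. u \<bullet> y = u \<bullet> x}" by blast
  then have "interior {y. u \<bullet> y = u \<bullet> x} \<noteq> {}" using C(3) interior_mono by blast
  then have "u = 0" using interior_hyperplane by blast
  then have fn: "fst n = - snd n *\<^sub>R v" by (simp add: u_def add_eq_0_iff)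
  then have n': "n = snd n *\<^sub>R (- v, 1)" by (cases n) simp
  have "norm n = 1" using n by (simp add: unit_normal_def)
  then have "n \<bullet> n = 1" by (simp add: dot_square_norm)
  then have "(snd n)\<^sup>2 * (1 + v \<bullet> v) = 1" by (subst (asm) (1 2) n') (simp add: power2_eq_square algebra_simps)
  moreover have "1 + v \<bullet> v > 0" using inner_ge_zero[of v] by linarith
  ultimately have k: "(snd n)\<^sup>2 = 1 / (1 + v \<bullet> v)" by (simp add: field_simps)
  have wn: "w \<bullet> n = snd n * (w \<bullet> (- v, 1))" by (subst n') (simp only: inner_scaleR_right)
  have "reflect n w = w - (2 * (snd n * (w \<bullet> (- v, 1)))) *\<^sub>R (snd n *\<^sub>R (- v, 1))"
    unfolding reflect_def wn n'[symmetric] ..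
  also have "\<dots> = w - (2 * (snd n)\<^sup>2 * (w \<bullet> (- v, 1))) *\<^sub>R (- v, 1)"
    by (simp only: scaleR_scaleR power2_eq_square mult_ac)
  finally have "reflect n w = w - (2 * (snd n)\<^sup>2 * (w \<bullet> (- v, 1))) *\<^sub>R (- v, 1)" .
  then show ?thesis by (simp add: k)
qed

section \<open>The body inside the open cylinder over \<Omega>\<close>

lemma is_prismD:
  assumes "is_prism P"
  shows "compact P" "closed P" "convex P" "P \<subseteq> closure (interior P)"
proof -
  obtain a b c d p q p' q' where P: "a < b" "c < d" "\<forall>x\<in>{a..b}. p + q * x < p' + q' * x" "P = prism a b c d p q p' q'"
    using assms unfolding is_prism_def by blast
  show "compact P" "closed P" "convex P" "P \<subseteq> closure (interior P)"
    unfolding P(4) by (rule compact_prism closed_prism convex_prism prism_regular[OF P(1-3)])+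
qed

text \<open>As \<Omega> is an arbitrary convex set, the floor need not be polyhedral. The prisms
  stand over \<Omega> itself, away from \<open>frontier \<Omega> \<times> UNIV\<close>, where
  smoothness of the surface is not asked for.\<close>

locale floor_and_prisms =
  fixes \<Omega> :: "(real^2) set" and f M :: real and \<P> :: "space3 set set"
  assumes convex_\<Omega>: "convex \<Omega>" and open_\<Omega>: "open \<Omega>" and bounded_\<Omega>: "bounded \<Omega>"
    and f_pos: "0 < f" and f_le: "f \<le> M"
    and finite_prisms: "finite \<P>" and prisms: "\<And>P. P \<in> \<P> \<Longrightarrow> is_prism P"
    and prisms_subset: "\<Union>\<P> \<subseteq> \<Omega> \<times> {0..M}"
begin

definition body :: "space3 set" where
  "body = closure \<Omega> \<times> {0..f} \<union> \<Union>\<P>"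

lemma closed_body: "closed body"
  unfolding body_def
  by (intro closed_Un closed_Times closed_Union finite_prisms ballI) (auto dest: prisms is_prismD(2))

lemma body_regular: "closure (interior body) = body"
proof -
  have "closure \<Omega> \<times> {0..f} = closure (\<Omega> \<times> {0<..<f})"
    using f_pos by (simp add: closure_Times)
  also have "\<dots> \<subseteq> closure (interior (closure \<Omega> \<times> {0..f}))"
    using open_\<Omega> closure_subset[of \<Omega>] by (intro closure_mono interior_maximal open_Times) auto
  finally have fl: "closure \<Omega> \<times> {0..f} \<subseteq> closure (interior (closure \<Omega> \<times> {0..f}))" .
  have "closure (interior (\<Union>(insert (closure \<Omega> \<times> {0..f}) \<P>))) = \<Union>(insert (closure \<Omega> \<times> {0..f}) \<P>)"
  proof (rule closure_interior_Union)
    show "finite (insert (closure \<Omega> \<times> {0..f}) \<P>)" using finite_prisms by simp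
    fix C assume "C \<in> insert (closure \<Omega> \<times> {0..f}) \<P>"
    then show "closed C \<and> C \<subseteq> closure (interior C)"
    proof
      assume "C = closure \<Omega> \<times> {0..f}"
      then show ?thesis using fl by (simp add: closed_Times)
    next
      assume "C \<in> \<P>"
      then have "is_prism C" by (rule prisms)
      then show ?thesis using is_prismD[of C] by blast
    qed
  qed
  then show ?thesis by (simp add: body_def)
qed

text \<open>Inside the open cylinder the floor cannot be told from a box over a large square, so
  there the body has the frontier of a finite union of prisms.\<close>

lemma body_frontier:
  obtains B' A where "compact B'" "closure (interior B') = B'" "finite A" "A \<subseteq> canonical_planes"
    "invariant_under A B'" "frontier body \<inter> (\<Omega> \<times> UNIV) = frontier B' \<inter> (\<Omega> \<times> UNIV)"
proof -
  have "bounded (closure \<Omega>)" using bounded_\<Omega> by (rule bounded_closure)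
  then obtain R where R: "R > 0" "\<And>x. x \<in> closure \<Omega> \<Longrightarrow> norm x \<le> R" unfolding bounded_pos by blast
  have R': "- R \<le> x $ i \<and> x $ i \<le> R" if "x \<in> \<Omega>" for x i
  proof -
    have "x \<in> closure \<Omega>" using that closure_subset by (rule rev_subsetD)
    then have "\<bar>x $ i\<bar> \<le> R" using component_le_norm_cart[of x i] R(2)[of x] by linarith
    then show ?thesis by linarith
  qed
  define F where "F = prism (- R) R (- R) R 0 0 f 0"
  define B' where "B' = \<Union>(insert F \<P>)"
  have F: "is_prism F" unfolding F_def by (rule is_prismI) (use R(1) f_pos in simp_all)
  then have pr: "is_prism P" if "P \<in> insert F \<P>" for P using prisms[of P] that by blast
  have fin: "finite (insert F \<P>)" using finite_prisms by simp
  obtain A where A: "finite A" "A \<subseteq> canonical_planes" "invariant_under A B'"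
    unfolding B'_def by (rule prism_union_planes[OF fin pr])
  have "compact B'" unfolding B'_def by (intro compact_Union fin is_prismD(1) pr)
  moreover have "closure (interior B') = B'" unfolding B'_def
    by (intro closure_interior_Union fin conjI is_prismD(2,4) pr)
  moreover have "frontier body \<inter> (\<Omega> \<times> UNIV) = frontier B' \<inter> (\<Omega> \<times> UNIV)"
  proof (rule frontier_Int_open_eq)
    show "open (\<Omega> \<times> (UNIV :: real set))" using open_\<Omega> by (simp add: open_Times)
    show "body \<inter> \<Omega> \<times> UNIV = B' \<inter> \<Omega> \<times> UNIV"
    proof (rule set_eqI)
      fix p :: space3
      show "p \<in> body \<inter> \<Omega> \<times> UNIV \<longleftrightarrow> p \<in> B' \<inter> \<Omega> \<times> UNIV"
      proof (cases "fst p \<in> \<Omega>")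
        case True
        then have "fst p \<in> closure \<Omega>" using closure_subset by (rule rev_subsetD)
        then have "p \<in> closure \<Omega> \<times> {0..f} \<longleftrightarrow> p \<in> F"
          using R'[OF True, of 1] R'[OF True, of 2] by (simp add: F_def prism_def mem_Times_iff)
        then show ?thesis unfolding body_def B'_def by simp
      qed (simp add: mem_Times_iff)
    qed
  qed
  ultimately show ?thesis by (rule that[OF _ _ A])
qed

lemma frontier_body_Diff: "frontier body - frontier \<Omega> \<times> UNIV = frontier body \<inter> (\<Omega> \<times> UNIV)"
proof -
  have "body \<subseteq> closure \<Omega> \<times> UNIV" unfolding body_def using prisms_subset closure_subset by blast
  then have "frontier body \<subseteq> closure \<Omega> \<times> UNIV" using closed_body frontier_subset_closed by blast
  then show ?thesis using open_\<Omega> by (auto simp: frontier_def interior_open)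
qed

lemma piecewise_smooth_body: "piecewise_smooth_surface (frontier body - frontier \<Omega> \<times> UNIV)"
proof -
  obtain B' A where B': "compact B'" "closure (interior B') = B'" "finite A" "A \<subseteq> canonical_planes"
    "invariant_under A B'" "frontier body \<inter> (\<Omega> \<times> UNIV) = frontier B' \<inter> (\<Omega> \<times> UNIV)"
    using body_frontier by blast
  obtain n :: nat and K \<phi> where K: "\<And>i. i < n \<Longrightarrow> surface_patch (K i) (\<phi> i)"
    "frontier B' = (\<Union>i<n. \<phi> i ` K i)"
    "\<And>i j u v. i < n \<Longrightarrow> j < n \<Longrightarrow> u \<in> interior (K i) \<Longrightarrow> v \<in> K j \<Longrightarrow> \<phi> i u = \<phi> j v \<Longrightarrow> i = j \<and> u = v"
    using frontier_patches[OF B'(3) reduced_canonical[OF B'(4)] B'(1,2,5)] by blast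
  show ?thesis unfolding piecewise_smooth_surface_def frontier_body_Diff
  proof
    fix p assume "p \<in> frontier body \<inter> \<Omega> \<times> UNIV"
    \<comment> \<open>The open cylinder serves as the neighbourhood of all points at once.\<close>
    then have pw: "open (\<Omega> \<times> UNIV) \<and> p \<in> \<Omega> \<times> UNIV \<and> (\<forall>i<n. surface_patch (K i) (\<phi> i)) \<and>
        (frontier body \<inter> \<Omega> \<times> UNIV) \<inter> \<Omega> \<times> UNIV = (\<Union>i<n. \<phi> i ` K i) \<inter> \<Omega> \<times> UNIV \<and>
        (\<forall>i<n. \<forall>j<n. \<forall>u\<in>interior (K i). \<forall>v\<in>K j.
            \<phi> i u = \<phi> j v \<and> \<phi> i u \<in> \<Omega> \<times> UNIV \<longrightarrow> i = j \<and> u = v)"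
      unfolding B'(6) K(2)[symmetric]
      by (intro conjI allI impI ballI open_Times open_\<Omega> open_UNIV K(1)) (use K(3) in blast)+
    show "\<exists>W (n::nat) K \<phi>. open W \<and> p \<in> W \<and> (\<forall>i<n. surface_patch (K i) (\<phi> i)) \<and>
        (frontier body \<inter> \<Omega> \<times> UNIV) \<inter> W = (\<Union>i<n. \<phi> i ` K i) \<inter> W \<and>
        (\<forall>i<n. \<forall>j<n. \<forall>u\<in>interior (K i). \<forall>v\<in>K j.
            \<phi> i u = \<phi> j v \<and> \<phi> i u \<in> W \<longrightarrow> i = j \<and> u = v)"
      by (rule exI[of _ "\<Omega> \<times> (UNIV :: real set)"], rule exI[of _ n], rule exI[of _ K], rule exI[of _ \<phi>]) (rule pw)
  qed
qed

lemma generic_unit_normal: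
  obtains F1 F2 :: "real set" where "finite F1" "finite F2"
    "\<And>x z. (x, z) \<in> frontier body \<Longrightarrow> x \<in> \<Omega> \<Longrightarrow> x $ 1 \<notin> F1 \<Longrightarrow> x $ 2 \<notin> F2 \<Longrightarrow> \<exists>n. unit_normal (frontier body) (x, z) n"
proof -
  obtain B' A where B': "compact B'" "closure (interior B') = B'" "finite A" "A \<subseteq> canonical_planes"
    "invariant_under A B'" "frontier body \<inter> (\<Omega> \<times> UNIV) = frontier B' \<inter> (\<Omega> \<times> UNIV)"
    using body_frontier by blast
  obtain F1 F2 where F: "finite F1" "finite F2"
    "\<And>x z a b. (a, b) \<in> A \<Longrightarrow> a \<bullet> (x, z) = b \<Longrightarrow> x $ 1 \<notin> F1 \<Longrightarrow> x $ 2 \<notin> F2 \<Longrightarrow> only_plane A (x, z) a b"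
    using generic_only_plane[OF B'(3,4)] by blast
  show ?thesis
  proof (rule that[OF F(1,2)])
    fix x z assume *: "(x, z) \<in> frontier body" "x \<in> \<Omega>" "x $ 1 \<notin> F1" "x $ 2 \<notin> F2"
    then have fr: "(x, z) \<in> frontier B'" using B'(6) by blast
    have red: "reduced A" using reduced_canonical B'(4) by blast
    obtain a b where ab: "(a, b) \<in> A" "a \<bullet> (x, z) = b"
      using frontier_meets_plane[OF B'(3,5) fr] by (elim exE conjE)
    have op: "only_plane A (x, z) a b" by (rule F(3)[OF ab *(3,4)])
    have "a \<noteq> 0" using ab(1) red unfolding reduced_def by fast
    then have "unit_normal (frontier B') (x, z) (a /\<^sub>R norm a)"
      by (rule unit_normal_only_plane[OF B'(3) compact_imp_closed[OF B'(1)] B'(2,5) fr op])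
    then have "unit_normal (frontier body) (x, z) (a /\<^sub>R norm a)"
      by (rule unit_normal_cong[of _ _ _ "\<Omega> \<times> (UNIV :: real set)"])
         (use *(2) in \<open>simp_all add: open_Times open_\<Omega> B'(6)\<close>)
    then show "\<exists>n. unit_normal (frontier body) (x, z) n" by blast
  qed
qed

end

section \<open>The two-dimensional profile\<close>

text \<open>The Chinese remainder theorem: the shift \<open>\<theta>\<close> brings the \<open>i\<close>-th cell of ramp \<open>q\<close> into a
  prescribed gap on each of the later ramps.\<close>

lemma crt_shift:
  fixes P :: "nat \<Rightarrow> nat"
  assumes P: "\<And>c. prime (P c)" "\<And>c. Q < P c" "inj P"
  shows "\<exists>\<theta><\<Prod>c<Q. P c. \<forall>k. 1 \<le> k \<longrightarrow> q + k < Q \<longrightarrow> int (P (q + k)) dvd int i - int k * int \<theta> - 3"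
proof -
  \<comment> \<open>In natural numbers, \<open>i + 3 * (P c - 1)\<close> represents
    \<open>i - 3\<close> modulo \<open>P c\<close>. The factor \<open>c - q\<close> is positive and
    less than \<open>P c\<close>, hence invertible modulo this prime.\<close>
  have "\<exists>u. [(c - q) * u = i + 3 * (P c - 1)] (mod P c)" if "q < c" "c < Q" for c
  proof -
    have "\<not> P c dvd (c - q)" using that P(2)[of c] by (auto dest!: dvd_imp_le)
    then have "coprime (c - q) (P c)" using P(1)[of c] by (metis coprime_commute prime_imp_coprime)
    then obtain x where "[(c - q) * x = 1] (mod P c)" using cong_solve_coprime_nat by fastforce
    then have "[(c - q) * x * (i + 3 * (P c - 1)) = 1 * (i + 3 * (P c - 1))] (mod P c)" by (rule cong_scalar_right)
    then show ?thesis by (metis mult.assoc mult_1)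
  qed
  then obtain u where u: "\<And>c. q < c \<Longrightarrow> c < Q \<Longrightarrow> [(c - q) * u c = i + 3 * (P c - 1)] (mod P c)" by metis
  have "\<forall>c\<in>{..<Q}. \<forall>d\<in>{..<Q}. c \<noteq> d \<longrightarrow> coprime (P c) (P d)"
    using P(1,3) by (auto simp: inj_eq intro: primes_coprime)
  then obtain x where x: "\<And>c. c < Q \<Longrightarrow> [x = u c] (mod P c)"
    using chinese_remainder_nat[of "{..<Q}" P u] by auto
  define \<theta> where "\<theta> = x mod (\<Prod>c<Q. P c)"
  show ?thesis
  proof (intro exI[of _ \<theta>] conjI allI impI)
    show "\<theta> < (\<Prod>c<Q. P c)" unfolding \<theta>_def using P(1) by (intro mod_less_divisor prod_pos) (simp add: prime_gt_0_nat)
    fix k assume k: "1 \<le> k" "q + k < Q"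
    define c where "c = q + k"
    have c: "q < c" "c < Q" "c - q = k" using k by (auto simp: c_def)
    have "P c dvd (\<Prod>c<Q. P c)" using c by (intro dvd_prodI) auto
    then have "[\<theta> = x] (mod P c)" unfolding \<theta>_def cong_def by (rule mod_mod_cancel)
    then have "[\<theta> = u c] (mod P c)" using x[OF c(2)] cong_trans by blast
    then have "[k * \<theta> = k * u c] (mod P c)" by (rule cong_scalar_left)
    then have "[k * \<theta> = i + 3 * (P c - 1)] (mod P c)" using u[OF c(1,2)] c(3) cong_trans by auto
    then have "[int (k * \<theta>) = int (i + 3 * (P c - 1))] (mod int (P c))" by (simp only: cong_int_iff)
    then have "int (P c) dvd int (k * \<theta>) - int (i + 3 * (P c - 1))" by (simp only: cong_iff_dvd_diff)
    moreover have "P c \<ge> 1" using prime_gt_0_nat[OF P(1)[of c]] by linarith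
    ultimately have "int (P c) dvd - (int (k * \<theta>) - int (i + 3 * (P c - 1))) - 3 * int (P c)"
      by (intro dvd_diff) (simp_all only: dvd_minus_iff dvd_triv_right)
    moreover have "- (int (k * \<theta>) - int (i + 3 * (P c - 1))) - 3 * int (P c) = int i - int k * int \<theta> - 3"
      using \<open>P c \<ge> 1\<close> by (simp add: of_nat_diff algebra_simps)
    ultimately have "int (P c) dvd int i - int k * int \<theta> - 3" by (simp only:)
    then show "int (P (q + k)) dvd int i - int k * int \<theta> - 3" by (simp only: c_def)
  qed
qed

text \<open>\<open>i - k * \<theta>\<close> is congruent to \<open>3\<close>, the middle of the
  empty residues, so a cell with residue at least \<open>7\<close> is at least four cells
  away.\<close>

lemma shift_misses:
  assumes "int p dvd int i - int k * int \<theta> - 3" "7 \<le> j mod p" "7 < p"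
  shows "4 \<le> \<bar>int j - int i + int k * int \<theta>\<bar>"
proof (rule ccontr)
  assume n: "\<not> ?thesis"
  define d where "d = int j - int i + int k * int \<theta>"
  have d: "0 \<le> 3 + d" "3 + d < 7" using n by (auto simp: d_def)
  obtain m where m: "int i - int k * int \<theta> - 3 = int p * m" using assms(1) by blast
  have "int j = (3 + d) + int p * m" using m by (simp add: d_def)
  then have "int j mod int p = (3 + d) mod int p" by simp
  also have "\<dots> = 3 + d" using d assms(3) by (intro mod_pos_pos_trivial) auto
  finally have "int (j mod p) < 7" using d by (simp add: zmod_int)
  then show False using assms(2) by simp
qed

text \<open>An empty cell is determined by its residue and its period, which leaves at most
  \<open>7 * (n div p)\<close> of them.\<close>

lemma card_residues:
  assumes "p dvd n" "0 < p"
  shows "n - 7 * (n div p) \<le> card {j. j < n \<and> 7 \<le> j mod p}"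
proof -
  have "card {j. j < n \<and> j mod p < 7} \<le> card ({..<7::nat} \<times> {..<n div p})"
  proof (rule card_inj_on_le)
    show "inj_on (\<lambda>j. (j mod p, j div p)) {j. j < n \<and> j mod p < 7}"
      by (rule inj_onI) (metis mult_div_mod_eq prod.inject)
    show "(\<lambda>j. (j mod p, j div p)) ` {j. j < n \<and> j mod p < 7} \<subseteq> {..<7} \<times> {..<n div p}"
      using assms by (auto simp: less_mult_imp_div_less)
  qed simp
  then have 1: "card {j. j < n \<and> j mod p < 7} \<le> 7 * (n div p)" by (simp add: card_cartesian_product)
  have "{..<n} = {j. j < n \<and> j mod p < 7} \<union> {j. j < n \<and> 7 \<le> j mod p}" by auto
  then have "n \<le> card {j. j < n \<and> j mod p < 7} + card {j. j < n \<and> 7 \<le> j mod p}"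
    by (metis card_Un_le card_lessThan)
  then show ?thesis using 1 by linarith
qed

text \<open>The slope of the path of a vertically falling particle after its reflection from a segment
  of slope \<open>- s\<close>.\<close>

definition tilt :: "real \<Rightarrow> real" where
  "tilt s = (1 - s\<^sup>2) / (2 * s)"

text \<open>\<open>s\<close> is the positive root of
  \<open>s\<^sup>2 + 2 * t * s = 1\<close>.\<close>

lemma tilt_surj:
  assumes "0 \<le> t" "t \<le> 1"
  defines "s \<equiv> sqrt (1 + t\<^sup>2) - t"
  shows "tilt s = t" "0 < s" "s \<le> 1" "1 - s \<le> t"
proof -
  have r: "(sqrt (1 + t\<^sup>2))\<^sup>2 = 1 + t\<^sup>2" by simp
  have "sqrt (1 + t\<^sup>2) > sqrt (t\<^sup>2)" by (intro real_sqrt_less_mono) simp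
  then show s0: "0 < s" using assms by (simp add: s_def)
  have "sqrt (1 + t\<^sup>2) \<le> 1 + t" using assms by (intro real_le_lsqrt) (auto simp: power2_sum)
  then show "s \<le> 1" by (simp add: s_def)
  have "sqrt (1 + t\<^sup>2) \<ge> 1" by simp
  then show "1 - s \<le> t" by (simp add: s_def)
  have "1 - s\<^sup>2 = 2 * s * t" using r by (simp add: s_def power2_diff power2_eq_square algebra_simps)
  then show "tilt s = t" using s0 by (simp add: tilt_def)
qed

text \<open>Height at abscissa \<open>y\<close> of the straight path that leaves the top edge of
  slat \<open>i\<close> at abscissa \<open>x\<close> after its reflection there.\<close>

definition ray :: "('i \<Rightarrow> real) \<Rightarrow> ('i \<Rightarrow> real) \<Rightarrow> ('i \<Rightarrow> real) \<Rightarrow> 'i \<Rightarrow> real \<Rightarrow> real \<Rightarrow> real" where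
  "ray a u s i x y = u i - s i * (x - a i) + tilt (s i) * (y - x)"

text \<open>Two-dimensional section of a device: slats over \<open>[a i, a i + l]\<close> with top edge
  \<open>u i - s i * (x - a i)\<close>, and a mirror over \<open>[g, \<beta>]\<close> with lower edge
  \<open>h + (1 - \<epsilon>) * (\<beta> - x)\<close>.\<close>

definition profile :: "real \<Rightarrow> real \<Rightarrow> real \<Rightarrow> real \<Rightarrow> 'i set \<Rightarrow> ('i \<Rightarrow> real) \<Rightarrow> ('i \<Rightarrow> real) \<Rightarrow> ('i \<Rightarrow> real) \<Rightarrow>
    real \<Rightarrow> real \<Rightarrow> real \<Rightarrow> real \<Rightarrow> bool" where
  "profile \<alpha> \<beta> M \<epsilon> I a u s l \<tau> g h \<longleftrightarrow>
     finite I \<and> 0 < l \<and> 0 < \<tau> \<and> \<alpha> < g \<and> g < \<beta> \<and> \<beta> - g \<le> \<epsilon> * M / 100 \<and>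
     (\<forall>i\<in>I. \<alpha> \<le> a i \<and> a i + l < g \<and> 0 < s i \<and> s i \<le> 1 \<and> 1 - s i \<le> \<epsilon> / 4 \<and> tilt (s i) \<le> \<epsilon> / 4 \<and>
        M / 4 < u i - s i * l - \<tau> \<and> u i < M) \<and>
     (\<forall>i\<in>I. \<forall>j\<in>I. i \<noteq> j \<longrightarrow> a i + l < a j \<or> a j + l < a i) \<and>
     M / 4 < h \<and> h + (1 - \<epsilon>) * (\<beta> - g) < M \<and>
     (\<forall>i\<in>I. \<forall>x\<in>{a i..a i + l}. ray a u s i x g < h + (1 - \<epsilon>) * (\<beta> - g) \<and> h < ray a u s i x \<beta>) \<and>
     (\<forall>i\<in>I. \<forall>x\<in>{a i..a i + l}. \<forall>j\<in>I. \<forall>y\<in>{a j..a j + l}. x < y \<longrightarrow>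
        ray a u s i x y < u j - s j * (y - a j) - \<tau> \<or> u j - s j * (y - a j) < ray a u s i x y) \<and>
     (1 - \<epsilon>) * (\<beta> - \<alpha>) \<le> real (card I) * l"

text \<open>The ramps have length \<open>D\<close> and the last \<open>2 * D\<close> of the chord
  belong to the mirror; a cell has width \<open>w = D / n\<close>, and the ramp drops by
  \<open>w\<close> per cell. The uncovered part of the chord consists of the mirror, the empty cells
  and the gap beside each slat in its cell, each a portion of at most
  \<open>\<epsilon> / 4\<close>.\<close>

lemma profile_exists:
  assumes e: "0 < \<epsilon>" "\<epsilon> \<le> 1/16" and M: "0 < M" and ab: "\<alpha> < \<beta>"
  obtains I :: "(nat \<times> nat) set" and a u s l \<tau> g h where "profile \<alpha> \<beta> M \<epsilon> I a u s l \<tau> g h"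
proof -
  define L where "L = \<beta> - \<alpha>"
  have L: "L > 0" using ab by (simp add: L_def)
  \<comment> \<open>The first bound makes the mirror short compared with the chord, the second
    compared with \<open>M\<close>.\<close>
  obtain Q :: nat where Q: "real Q \<ge> 8 / \<epsilon>" "real Q \<ge> 200 * L / (\<epsilon> * M)"
    using real_arch_simple[of "max (8 / \<epsilon>) (200 * L / (\<epsilon> * M))"] by auto
  have "8 / \<epsilon> > 0" using e by simp
  then have Q0: "real Q > 0" using Q by linarith
  define D where "D = L / (real Q + 2)"
  have D: "D > 0" using L Q0 by (simp add: D_def)
  have LD: "L = (real Q + 2) * D" using Q0 by (simp add: D_def)
  have DM: "2 * D \<le> \<epsilon> * M / 100"
  proof -
    have "200 * L \<le> real Q * (\<epsilon> * M)" using Q(2) e M by (simp add: field_simps)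
    also have "\<dots> \<le> (real Q + 2) * (\<epsilon> * M)" using e M by (intro mult_right_mono) auto
    finally have "200 * D \<le> \<epsilon> * M" using Q0 by (simp add: D_def field_simps)
    then show ?thesis by simp
  qed
  have "\<epsilon> * M \<le> 1/16 * M" using e M by (intro mult_right_mono) auto
  then have DM': "D \<le> M / 3200" using DM by simp
  \<comment> \<open>Primes of at least \<open>28 / \<epsilon>\<close> make seven residues a portion
    of at most \<open>\<epsilon> / 4\<close>.\<close>
  obtain Bd :: nat where Bd: "real Bd \<ge> 28 / \<epsilon>" using real_arch_simple by blast
  have "infinite {p::nat. prime p \<and> max Q (max 7 Bd) < p}"
    using bigger_prime unfolding infinite_nat_iff_unbounded by (metis (mono_tags, lifting) max_less_iff_conj mem_Collect_eq)
  then obtain P :: "nat \<Rightarrow> nat" where Pi: "inj P" "range P \<subseteq> {p. prime p \<and> max Q (max 7 Bd) < p}"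
    using infinite_countable_subset by blast
  have P: "prime (P c)" "Q < P c" "7 < P c" "Bd < P c" for c using Pi(2) by auto
  define PP where "PP = (\<Prod>c<Q. P c)"
  have Pi0: "PP > 0" using P(1) by (simp add: PP_def prime_gt_0_nat prod_pos)
  \<comment> \<open>The first bound keeps the tilts at most \<open>\<epsilon> / 4\<close>; the
    second keeps the rise of a flight over the whole chord at most \<open>D / 2\<close>.\<close>
  obtain N :: nat where N: "real N \<ge> 8 / \<epsilon>" "real N \<ge> 4 * (real Q + 2)"
    using real_arch_simple[of "max (8 / \<epsilon>) (4 * (real Q + 2))"] by auto
  have N2: "real N \<ge> 2" using N(2) Q0 by simp
  define n where "n = N * PP"
  have n0: "n > 0" using N2 Pi0 by (auto simp: n_def intro: Nat.gr0I)
  define w where "w = D / real n"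
  have w: "w > 0" using D n0 by (simp add: w_def)
  have nw: "real n * w = D" using n0 by (simp add: w_def)
  have "w * 1 \<le> w * real n" using w n0 by (intro mult_left_mono) auto
  then have wD: "w \<le> D" using nw by (simp add: mult.commute)
  have "\<exists>\<theta>. \<theta> < PP \<and> (\<forall>k. 1 \<le> k \<longrightarrow> q + k < Q \<longrightarrow> int (P (q + k)) dvd int i - int k * int \<theta> - 3)" for q i
    unfolding PP_def by (rule crt_shift[OF P(1,2) Pi(1)])
  then obtain \<Theta> where \<Theta>: "\<And>q i. \<Theta> q i < PP"
    "\<And>q i k. 1 \<le> k \<Longrightarrow> q + k < Q \<Longrightarrow> int (P (q + k)) dvd int i - int k * int (\<Theta> q i) - 3" by metis
  define T where "T = (\<lambda>(q, i). real (\<Theta> q i) / real n)"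
  \<comment> \<open>This gives \<open>t p * n = \<Theta> q i * (1 + t p)\<close> for
    \<open>p = (q, i)\<close>. Per cell, a flight of slope \<open>t p\<close> gains the height
    \<open>w * (1 + t p)\<close> over a ramp that drops by \<open>w\<close>; so its rise over the
    length of one ramp amounts to a shift by \<open>\<Theta> q i\<close> cells.\<close>
  define t where "t p = T p / (1 - T p)" for p
  have T: "0 \<le> T p" "T p \<le> 1 / real N" for p
  proof -
    obtain q i where p: "p = (q, i)" by fastforce
    show "0 \<le> T p" by (simp add: T_def p)
    have "real (\<Theta> q i) \<le> real PP" using \<Theta>(1)[of q i] by simp
    then have "T p \<le> real PP / real n" by (simp add: T_def p divide_right_mono)
    also have "\<dots> = 1 / real N" using Pi0 by (simp add: n_def)
    finally show "T p \<le> 1 / real N" .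
  qed
  have "1 / real N \<le> 1 / 2" using N2 by (intro divide_left_mono) auto
  then have T2: "T p \<le> 1 / 2" for p using T(2)[of p] by simp
  have t0: "0 \<le> t p" for p using T(1)[of p] T2[of p] by (simp add: t_def)
  have tN: "t p \<le> 2 / real N" for p
  proof -
    have "T p * (1 - 2 * T p) \<ge> 0" using T(1)[of p] T2[of p] by (intro mult_nonneg_nonneg) auto
    then have "t p \<le> 2 * T p" using T2[of p] by (simp add: t_def divide_simps algebra_simps)
    then show ?thesis using T(2)[of p] by simp
  qed
  have te: "t p \<le> \<epsilon> / 4" for p
  proof -
    have "2 / real N \<le> \<epsilon> / 4" using N(1) N2 e by (simp add: field_simps)
    then show ?thesis using tN[of p] by simp
  qed
  have tL: "t p * L \<le> D / 2" for p
  proof -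
    have "t p * L \<le> 2 / real N * L" using tN[of p] L by (intro mult_right_mono) auto
    also have "\<dots> \<le> D / 2"
    proof -
      have "4 * (real Q + 2) * L \<le> real N * L" using N(2) L by (intro mult_right_mono) auto
      then show ?thesis using N2 Q0 by (simp add: D_def field_simps)
    qed
    finally show ?thesis .
  qed
  have t1: "t p \<le> 1" for p using te[of p] e by simp
  have tn: "t (q, i) * real n = real (\<Theta> q i) * (1 + t (q, i))" for q i
  proof -
    have "T (q, i) < 1" using T2[of "(q, i)"] by simp
    then show ?thesis using n0 by (simp add: t_def T_def field_simps)
  qed
  define s where "s p = sqrt (1 + (t p)\<^sup>2) - t p" for p
  have s: "tilt (s p) = t p" "0 < s p" "s p \<le> 1" "1 - s p \<le> t p" for p
    using tilt_surj[OF t0 t1] unfolding s_def by blast+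
  define a where "a = (\<lambda>(q, i). \<alpha> + real q * D + real i * w)"
  define u where "u = (\<lambda>(q::nat, i). M / 2 - real i * w)"
  define l where "l = (1 - \<epsilon> / 4) * w"
  define g where "g = \<beta> - 2 * D"
  \<comment> \<open>Flights reach the mirror region at heights between \<open>M / 2 - D\<close> and
    \<open>M / 2 + D / 2\<close>. The mirror edge is at \<open>h\<close> over \<open>\<beta>\<close>
    and, because of \<open>\<epsilon> \<le> 1/16\<close>, at \<open>M / 2 + 3/4 * D\<close> or
    higher over \<open>g\<close>.\<close>
  define h where "h = M / 2 - 9/8 * D"
  define I where "I = (SIGMA q:{..<Q}. {i. i < n \<and> 7 \<le> i mod P q})"
  have l: "0 < l" "l < w" using w e by (simp_all add: l_def)
  have gQ: "g = \<alpha> + real Q * D" using LD by (simp add: g_def L_def algebra_simps)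
  \<comment> \<open>Positions run consecutively through the cells of all ramps, whereas the heights
    \<open>u\<close> restart on each ramp.\<close>
  have lin: "a (q, i) = \<alpha> + real (q * n + i) * w" for q i
    using nw by (simp add: a_def algebra_simps)
  have iw: "real i * w + w \<le> D" if "i < n" for i
  proof -
    have "(real i + 1) * w \<le> real n * w" using that w by (intro mult_right_mono) auto
    then show ?thesis using nw by (simp add: algebra_simps)
  qed
  have fin: "finite I" by (simp add: I_def)
  have slat: "\<alpha> \<le> a p \<and> a p + l < g \<and> M / 4 < u p - s p * l - w \<and> u p < M" if p: "p \<in> I" for p
  proof -
    obtain q i where qi: "p = (q, i)" "q < Q" "i < n" using p by (auto simp: I_def)
    have "q * n + i + 1 \<le> Q * n" using qi(2,3) by (metis Suc_eq_plus1 add.commute add_less_le_mono less_eq_Suc_le mult_Suc mult_le_mono1 Suc_leI add_lessD1 le_trans nat_add_left_cancel_less add_Suc)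
    then have "real (q * n + i) + 1 \<le> real (Q * n)" by linarith
    then have "(real (q * n + i) + 1) * w \<le> real (Q * n) * w" using w by (intro mult_right_mono) auto
    moreover have "real (Q * n) * w = real Q * D" using nw by (simp add: mult.assoc)
    ultimately have "real (q * n + i) * w + w \<le> real Q * D" by (simp only: distrib_right mult_1_left)
    then have "a p + l < g" using l(2) gQ lin[of q i] qi(1) by simp
    moreover have "\<alpha> \<le> a p" using lin[of q i] qi(1) w by simp
    moreover have "s p * l \<le> 1 * w" using s[of p] l by (intro mult_mono) auto
    then have "M / 4 < u p - s p * l - w" using iw[OF qi(3)] wD DM' M by (simp add: u_def qi(1))
    moreover have "real i * w \<ge> 0" using w by simp
    then have "u p < M" using M by (simp add: u_def qi(1))
    ultimately show ?thesis by blast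
  qed
  have sep: "a p + l < a p' \<or> a p' + l < a p" if p: "p \<in> I" "p' \<in> I" "p \<noteq> p'" for p p'
  proof -
    obtain q i where qi: "p = (q, i)" "q < Q" "i < n" using p by (auto simp: I_def)
    obtain q' i' where qi': "p' = (q', i')" "q' < Q" "i' < n" using p by (auto simp: I_def)
    have "q * n + i \<noteq> q' * n + i'"
    proof
      assume "q * n + i = q' * n + i'"
      then have "(q * n + i) div n = (q' * n + i') div n" "(q * n + i) mod n = (q' * n + i') mod n" by simp_all
      then show False using qi qi' p(3) by simp
    qed
    then consider "real (q * n + i) + 1 \<le> real (q' * n + i')" | "real (q' * n + i') + 1 \<le> real (q * n + i)" by linarith
    then show ?thesis
    proof cases
      case 1
      then have "(real (q * n + i) + 1) * w \<le> real (q' * n + i') * w" using w by (intro mult_right_mono) auto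
      then show ?thesis using l(2) lin[of q i] lin[of q' i'] qi(1) qi'(1) by (simp add: distrib_right)
    next
      case 2
      then have "(real (q' * n + i') + 1) * w \<le> real (q * n + i) * w" using w by (intro mult_right_mono) auto
      then show ?thesis using l(2) lin[of q i] lin[of q' i'] qi(1) qi'(1) by (simp add: distrib_right)
    qed
  qed
  have scaled: "0 \<le> c * z \<and> c * z \<le> l" if "0 \<le> c" "c \<le> 1" "0 \<le> z" "z \<le> l" for c z
    using mult_mono[of c 1 z l] that by auto
  have mirror: "ray a u s p x g < h + (1 - \<epsilon>) * (\<beta> - g) \<and> h < ray a u s p x \<beta>"
    if p: "p \<in> I" and x: "x \<in> {a p..a p + l}" for p x
  proof -
    obtain q i where qi: "p = (q, i)" "q < Q" "i < n" using p by (auto simp: I_def)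
    have "0 \<le> s p * (x - a p) \<and> s p * (x - a p) \<le> l" using s[of p] x by (intro scaled) auto
    then have sx: "0 \<le> s p * (x - a p)" "s p * (x - a p) \<le> w" using l by simp_all
    have up: "M / 2 - D \<le> u p - w" "u p \<le> M / 2" using iw[OF qi(3)] w by (auto simp: u_def qi(1))
    have xg: "x < g" "\<alpha> \<le> x" using slat[OF p] x by auto
    have "t p * (g - x) \<le> t p * L" using t0[of p] xg D by (intro mult_left_mono) (auto simp: L_def g_def)
    then have r1: "ray a u s p x g \<le> M / 2 + D / 2" using tL[of p] sx up by (simp add: ray_def s)
    moreover have "(1 - \<epsilon>) * (2 * D) \<ge> 15/16 * (2 * D)" using e D by (intro mult_right_mono) auto
    moreover have "\<beta> - g = 2 * D" by (simp add: g_def)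
    ultimately have "M / 2 + D / 2 < h + (1 - \<epsilon>) * (\<beta> - g)" using D unfolding h_def by (simp only: \<open>\<beta> - g = 2 * D\<close>)
    moreover have "t p * (\<beta> - x) \<ge> 0" using t0[of p] xg D by (intro mult_nonneg_nonneg) (auto simp: g_def)
    then have "h < ray a u s p x \<beta>" using sx up D by (simp add: ray_def s h_def)
    ultimately show ?thesis using r1 by linarith
  qed
  have free: "ray a u s p x y < u p' - s p' * (y - a p') - w \<or> u p' - s p' * (y - a p') < ray a u s p x y"
    if p: "p \<in> I" "p' \<in> I" and x: "x \<in> {a p..a p + l}" and y: "y \<in> {a p'..a p' + l}" and xy: "x < y" for p p' x y
  proof -
    obtain q i where qi: "p = (q, i)" "q < Q" "i < n" using p by (auto simp: I_def)
    obtain q' j where qj: "p' = (q', j)" "q' < Q" "j < n" "7 \<le> j mod P q'" using p by (auto simp: I_def)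
    define \<xi> where "\<xi> = x - a p"
    define \<eta> where "\<eta> = y - a p'"
    have \<xi>: "0 \<le> \<xi>" "\<xi> \<le> l" and \<eta>: "0 \<le> \<eta>" "\<eta> \<le> l" using x y by (auto simp: \<xi>_def \<eta>_def)
    have s\<xi>: "0 \<le> s p * \<xi> \<and> s p * \<xi> \<le> l" using s[of p] \<xi> by (intro scaled) auto
    have s\<eta>: "0 \<le> s p' * \<eta> \<and> s p' * \<eta> \<le> l" using s[of p'] \<eta> by (intro scaled) auto
    have t\<xi>: "0 \<le> t p * \<xi> \<and> t p * \<xi> \<le> l" using t0[of p] t1[of p] \<xi> by (intro scaled) auto
    have t\<eta>: "0 \<le> t p * \<eta> \<and> t p * \<eta> \<le> l" using t0[of p] t1[of p] \<eta> by (intro scaled) auto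
    have R: "ray a u s p x y = M / 2 - real i * w - s p * \<xi> + t p * (y - x)"
      by (simp add: ray_def s u_def qi(1) \<xi>_def)
    have yx: "y - x = (real (q' * n + j) - real (q * n + i)) * w + \<eta> - \<xi>"
      using lin[of q i] lin[of q' j] by (simp add: \<xi>_def \<eta>_def qi(1) qj(1) algebra_simps)
    have txy: "t p * (y - x) \<ge> 0" using t0[of p] xy by simp
    have "q \<le> q'"
    proof (rule ccontr)
      assume "\<not> q \<le> q'"
      then have "Suc q' * n \<le> q * n" by (intro mult_right_mono) auto
      then have "q' * n + j + 1 \<le> q * n + i" using qj(3) by simp
      then have "real (q' * n + j) + 1 \<le> real (q * n + i)" by linarith
      then have "(real (q' * n + j) - real (q * n + i)) * w \<le> (-1) * w" using w by (intro mult_right_mono) auto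
      then show False using yx xy \<xi> \<eta> l by linarith
    qed
    \<comment> \<open>The slat itself, which falls while the flight does not; a later and therefore
      lower slat of the same ramp; an earlier one, which cannot lie to the right; and a slat of a
      later ramp, where the arithmetic enters.\<close>
    then consider "q' = q" "j = i" | "q' = q" "i < j" | "q' = q" "j < i" | "q < q'" by fastforce
    then show ?thesis
    proof cases
      case 1
      then have pp: "p' = p" using qi qj by simp
      have "s p * (y - a p) - s p * \<xi> = s p * (y - x)" by (simp add: \<xi>_def algebra_simps)
      moreover have "s p * (y - x) > 0" using s[of p] xy by simp
      ultimately have "u p' - s p' * (y - a p') < ray a u s p x y"
        using R txy unfolding pp by (simp add: u_def qi(1))
      then show ?thesis ..
    next
      case 2
      have "(real i + 1) * w \<le> real j * w" using 2 w by (intro mult_right_mono) auto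
      then have "u p' - s p' * \<eta> < ray a u s p x y"
        using R txy s\<xi> s\<eta> l by (simp add: u_def qj(1) distrib_right)
      then show ?thesis by (simp add: \<eta>_def)
    next
      case 3
      have "(real (q' * n + j) - real (q * n + i)) * w \<le> (-1) * w" using 3 w by (intro mult_right_mono) auto
      then show ?thesis using yx xy \<xi> \<eta> l by linarith
    next
      case 4
      define k where "k = q' - q"
      have k: "1 \<le> k" "q' = q + k" using 4 by (auto simp: k_def)
      define \<Delta> where "\<Delta> = int j - int i + int k * int (\<Theta> q i)"
      have "4 \<le> \<bar>\<Delta>\<bar>" unfolding \<Delta>_def
        using shift_misses[OF \<Theta>(2)[of k q i]] k qj P(3) by simp
      then have \<Delta>: "4 \<le> \<Delta> \<or> \<Delta> \<le> -4" by linarith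
      have "t p * (y - x) = real k * w * (t p * real n) + t p * (real j - real i) * w + t p * \<eta> - t p * \<xi>"
        unfolding yx k(2) by (simp add: algebra_simps)
      also have "\<dots> = real k * w * (real (\<Theta> q i) * (1 + t p)) + t p * (real j - real i) * w + t p * \<eta> - t p * \<xi>"
        using tn[of q i] qi(1) by simp
      \<comment> \<open>Compared with the slat that is crossed, the flight deviates by
        \<open>\<Delta>\<close> units of \<open>w * (1 + t p)\<close>. The remaining terms,
        including the slope of that slat, amount to less than \<open>2 * w\<close> either way, and
        the slat has thickness \<open>w\<close>; so \<open>4 \<le> \<bar>\<Delta>\<bar>\<close> is
        enough.\<close>
      finally have ray: "ray a u s p x y = M / 2 - real j * w + w * (1 + t p) * real_of_int \<Delta> - s p * \<xi> + t p * \<eta> - t p * \<xi>"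
        unfolding R \<Delta>_def by (simp add: algebra_simps)
      have up: "u p' = M / 2 - real j * w" by (simp add: u_def qj(1))
      have tw: "t p * w \<ge> 0" using t0[of p] w by simp
      from \<Delta> show ?thesis
      proof
        assume "4 \<le> \<Delta>"
        then have "w * (1 + t p) * real_of_int \<Delta> \<ge> w * (1 + t p) * 4" using t0[of p] w by (intro mult_left_mono) auto
        then have "w * (1 + t p) * real_of_int \<Delta> \<ge> 4 * w" using tw by (simp add: algebra_simps)
        then have "u p' - s p' * \<eta> < ray a u s p x y"
          using ray s\<xi> s\<eta> t\<xi> t\<eta> l unfolding up by (elim conjE, linarith)
        then show ?thesis by (simp add: \<eta>_def)
      next
        assume "\<Delta> \<le> -4"
        then have "w * (1 + t p) * real_of_int \<Delta> \<le> w * (1 + t p) * (-4)" using t0[of p] w by (intro mult_left_mono) auto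
        then have "w * (1 + t p) * real_of_int \<Delta> \<le> - 4 * w" using tw by (simp add: algebra_simps)
        then have "ray a u s p x y < u p' - s p' * \<eta> - w"
          using ray s\<xi> s\<eta> t\<xi> t\<eta> l unfolding up by (elim conjE, linarith)
        then show ?thesis by (simp add: \<eta>_def)
      qed
    qed
  qed
  have count: "(1 - \<epsilon>) * (\<beta> - \<alpha>) \<le> real (card I) * l"
  proof -
    have c1: "(1 - \<epsilon> / 4) * real n \<le> real (card {i. i < n \<and> 7 \<le> i mod P q})" if "q < Q" for q
    proof -
      have "P q dvd PP" unfolding PP_def using that by (intro dvd_prodI) auto
      then have dv: "P q dvd n" by (simp add: n_def)
      have "real (n div P q) = real n / real (P q)" using dv by (simp add: real_of_nat_div)
      moreover have "7 / real (P q) \<le> \<epsilon> / 4"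
      proof -
        have "28 / \<epsilon> \<le> real (P q)" using Bd P(4)[of q] by linarith
        then show ?thesis using e P(3)[of q] by (simp add: field_simps)
      qed
      then have "7 / real (P q) * real n \<le> \<epsilon> / 4 * real n" by (intro mult_right_mono) auto
      moreover have "real n - 7 * real (n div P q) \<le> real (card {i. i < n \<and> 7 \<le> i mod P q})"
        using card_residues[OF dv] P(3)[of q] by linarith
      ultimately show ?thesis by (simp add: algebra_simps)
    qed
    have "real (card I) = (\<Sum>q<Q. real (card {i. i < n \<and> 7 \<le> i mod P q}))"
      unfolding I_def by (subst card_SigmaI) auto
    also have "\<dots> \<ge> (\<Sum>q<Q. (1 - \<epsilon> / 4) * real n)" using c1 by (intro sum_mono) auto
    finally have cI: "real (card I) \<ge> real Q * ((1 - \<epsilon> / 4) * real n)" by simp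
    then have "real (card I) * l \<ge> real Q * ((1 - \<epsilon> / 4) * real n) * l" using l by (intro mult_right_mono) auto
    also have "real Q * ((1 - \<epsilon> / 4) * real n) * l = real Q * D * (1 - \<epsilon> / 4)\<^sup>2"
      unfolding l_def nw[symmetric] by (simp only: power2_eq_square mult_ac)
    finally have 1: "real Q * D * (1 - \<epsilon> / 4)\<^sup>2 \<le> real (card I) * l" .
    have "2 \<le> (real Q + 2) * (\<epsilon> / 4)"
    proof -
      have "8 \<le> real Q * \<epsilon>" using Q(1) e by (simp add: field_simps)
      then show ?thesis using e by (simp add: algebra_simps)
    qed
    then have "(1 - \<epsilon> / 4) * (real Q + 2) \<le> real Q" by (simp add: algebra_simps)
    then have "(1 - \<epsilon> / 4) * L \<le> real Q * D" unfolding LD using D by (simp add: mult_right_mono flip: mult.assoc)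
    then have "(1 - \<epsilon> / 4) * L * (1 - \<epsilon> / 4)\<^sup>2 \<le> real Q * D * (1 - \<epsilon> / 4)\<^sup>2" by (intro mult_right_mono) auto
    moreover have "(1 - \<epsilon>) * L \<le> (1 - \<epsilon> / 4) * L * (1 - \<epsilon> / 4)\<^sup>2"
    proof -
      have "(1 - \<epsilon> / 4)\<^sup>2 \<ge> 1 - \<epsilon> / 2" by (simp add: power2_diff)
      then have "(1 - \<epsilon> / 4) * (1 - \<epsilon> / 4)\<^sup>2 \<ge> (1 - \<epsilon> / 4) * (1 - \<epsilon> / 2)" using e by (intro mult_left_mono) auto
      moreover have "(1 - \<epsilon> / 4) * (1 - \<epsilon> / 2) \<ge> 1 - \<epsilon>" using e by (simp add: algebra_simps)
      ultimately have "(1 - \<epsilon> / 4) * (1 - \<epsilon> / 4)\<^sup>2 \<ge> 1 - \<epsilon>" by linarith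
      then show ?thesis using L by (simp add: mult.assoc mult.left_commute[of _ L] mult.commute[of _ L])
    qed
    ultimately show ?thesis using 1 by (simp add: L_def)
  qed
  have "profile \<alpha> \<beta> M \<epsilon> I a u s l w g h" unfolding profile_def
  proof (intro conjI)
    show "\<alpha> < g" using gQ Q0 D by simp
    show "g < \<beta>" using D by (simp add: g_def)
    show "\<beta> - g \<le> \<epsilon> * M / 100" using DM by (simp add: g_def)
    show "M / 4 < h" using DM' M by (simp add: h_def)
    have "(1 - \<epsilon>) * (2 * D) \<le> 1 * (2 * D)" using e D by (intro mult_right_mono) auto
    then show "h + (1 - \<epsilon>) * (\<beta> - g) < M" using DM' M by (simp add: h_def g_def)
    show "\<forall>i\<in>I. \<alpha> \<le> a i \<and> a i + l < g \<and> 0 < s i \<and> s i \<le> 1 \<and> 1 - s i \<le> \<epsilon> / 4 \<and> tilt (s i) \<le> \<epsilon> / 4 \<and>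
        M / 4 < u i - s i * l - w \<and> u i < M"
    proof
      fix p assume "p \<in> I"
      then show "\<alpha> \<le> a p \<and> a p + l < g \<and> 0 < s p \<and> s p \<le> 1 \<and> 1 - s p \<le> \<epsilon> / 4 \<and> tilt (s p) \<le> \<epsilon> / 4 \<and>
        M / 4 < u p - s p * l - w \<and> u p < M"
        using slat[of p] s[of p] te[of p] by auto
    qed
    show "\<forall>i\<in>I. \<forall>j\<in>I. i \<noteq> j \<longrightarrow> a i + l < a j \<or> a j + l < a i" by (intro ballI impI sep)
    show "\<forall>i\<in>I. \<forall>x\<in>{a i..a i + l}. ray a u s i x g < h + (1 - \<epsilon>) * (\<beta> - g) \<and> h < ray a u s i x \<beta>"
      by (intro ballI mirror)
    show "\<forall>i\<in>I. \<forall>x\<in>{a i..a i + l}. \<forall>j\<in>I. \<forall>y\<in>{a j..a j + l}. x < y \<longrightarrow>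
        ray a u s i x y < u j - s j * (y - a j) - w \<or> u j - s j * (y - a j) < ray a u s i x y"
      by (intro ballI impI free)
    show "finite I" "0 < l" "0 < w" "(1 - \<epsilon>) * (\<beta> - \<alpha>) \<le> real (card I) * l" by (rule fin l(1) w count)+
  qed
  then show ?thesis by (rule that)
qed

section \<open>Covering by rectangles\<close>

text \<open>The distance of a compact set to a line that it misses is positive. This turns
  statements about one chord into statements about all nearby chords.\<close>

lemma compact_avoids_strip:
  fixes C :: "(real^2) set"
  assumes "compact C" "\<And>x. x \<in> C \<Longrightarrow> x $ 2 \<noteq> y"
  shows "\<exists>r>0. \<forall>x\<in>C. r < \<bar>x $ 2 - y\<bar>"
proof (cases "C = {}")
  case True
  then show ?thesis by (intro exI[of _ 1]) simp
next
  case False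
  have "continuous_on C (\<lambda>x. \<bar>x $ 2 - y\<bar>)" by (intro continuous_intros)
  then obtain x0 where x0: "x0 \<in> C" "\<And>x. x \<in> C \<Longrightarrow> \<bar>x0 $ 2 - y\<bar> \<le> \<bar>x $ 2 - y\<bar>"
    using continuous_attains_inf[OF assms(1) False] by blast
  have pos: "\<bar>x0 $ 2 - y\<bar> > 0" using assms(2)[OF x0(1)] by simp
  show ?thesis
  proof (intro exI conjI ballI)
    show h: "0 < \<bar>x0 $ 2 - y\<bar> / 2" using pos by simp
    fix x assume "x \<in> C"
    have "\<bar>x0 $ 2 - y\<bar> / 2 < \<bar>x0 $ 2 - y\<bar>" using pos by simp
    also have "\<dots> \<le> \<bar>x $ 2 - y\<bar>" by (rule x0(2)) fact
    finally show "\<bar>x0 $ 2 - y\<bar> / 2 < \<bar>x $ 2 - y\<bar>" .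
  qed
qed

definition rect :: "real \<Rightarrow> real \<Rightarrow> real \<Rightarrow> real \<Rightarrow> (real^2) set" where
  "rect a b c d = {x. a \<le> x $ 1 \<and> x $ 1 \<le> b \<and> c \<le> x $ 2 \<and> x $ 2 \<le> d}"

lemma rect_cbox: "rect a b c d = cbox (vector [a, c]) (vector [b, d])"
  by (auto simp: rect_def mem_box_cart forall_2 vector_2)

lemma compact_rect: "compact (rect a b c d)"
  unfolding rect_cbox by (rule compact_cbox)

text \<open>\<open>\<alpha>\<close> and \<open>\<beta>\<close> lie strictly inside the chord of
  \<Omega> at level \<open>y\<close> and enclose the section of \<open>K\<close>, with
  \<open>\<beta>\<close> closer than \<open>\<kappa>\<close> to the right end. Each claim then says
  that some compact set misses the line \<open>x $ 2 = y\<close>, so it persists in a strip.\<close>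

lemma rect_through_slice:
  fixes \<Omega> :: "(real^2) set"
  assumes \<Omega>: "convex \<Omega>" "open \<Omega>" "bounded \<Omega>" and K: "compact K" "K \<subseteq> \<Omega>" and \<kappa>: "0 < \<kappa>"
    and y: "x0 \<in> K" "x0 $ 2 = y"
  shows "\<exists>\<alpha> \<beta> r. \<alpha> < \<beta> \<and> 0 < r \<and> rect \<alpha> \<beta> (y - r) (y + r) \<subseteq> \<Omega> \<and>
    (\<forall>x\<in>closure \<Omega>. \<bar>x $ 2 - y\<bar> \<le> r \<longrightarrow> x $ 1 \<le> \<beta> + \<kappa>) \<and> (\<forall>x\<in>K. \<bar>x $ 2 - y\<bar> \<le> r \<longrightarrow> \<alpha> \<le> x $ 1 \<and> x $ 1 \<le> \<beta>)"
proof -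
  define e where "e u = (vector [u, y] :: real^2)" for u
  have e: "e u $ 1 = u" "e u $ 2 = y" for u by (simp_all add: e_def)
  have e_eta: "e (x $ 1) = x" if "x $ 2 = y" for x
    using that by (simp add: vec_eq_iff forall_2 e)
  have e_lin: "e ((1 - s) * u + s * v) = (1 - s) *\<^sub>R e u + s *\<^sub>R e v" for s u v
    by (simp add: vec_eq_iff forall_2 e algebra_simps)
  define X where "X = {u. e u \<in> \<Omega>}"
  have ce: "continuous_on UNIV e"
  proof -
    have "e = (\<lambda>u. u *\<^sub>R axis 1 1 + y *\<^sub>R axis 2 1)"
      by (rule ext) (simp add: vec_eq_iff forall_2 e axis_def)
    moreover have "continuous_on UNIV (\<lambda>u. u *\<^sub>R axis 1 1 + y *\<^sub>R axis 2 1 :: real^2)"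
      by (intro continuous_intros)
    ultimately show ?thesis by (simp only:)
  qed
  have oX: "open X" unfolding X_def
    using open_vimage[OF \<Omega>(2) ce] by (simp add: vimage_def)
  have cX: "(1 - s) * u + s * v \<in> X" if "u \<in> X" "v \<in> X" "0 \<le> s" "s \<le> 1" for u v s
    using that \<Omega>(1)[unfolded convex_alt, rule_format, of "e u" "e v" s] by (simp add: X_def e_lin)
  obtain R where R: "\<And>x. x \<in> \<Omega> \<Longrightarrow> norm x \<le> R" using \<Omega>(3) unfolding bounded_iff by blast
  have bX: "- R \<le> u \<and> u \<le> R" if "u \<in> X" for u
  proof -
    have "norm (e u) \<le> R" using R that by (simp add: X_def)
    moreover have "\<bar>u\<bar> \<le> norm (e u)" using component_le_norm_cart[of "e u" 1] by (simp only: e)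
    ultimately show ?thesis by linarith
  qed
  have bdd: "bdd_above X" "bdd_below X"
    by (rule bdd_aboveI[of X R], rule conjunct2[OF bX], assumption)
       (rule bdd_belowI[of X "- R"], rule conjunct1[OF bX], assumption)
  have "x0 \<in> \<Omega>" using y(1) K(2) by (rule rev_subsetD)
  then have x0X: "x0 $ 1 \<in> X" using e_eta[OF y(2)] by (simp add: X_def)
  define a where "a = Inf X"
  define b where "b = Sup X"
  have ab: "a < u \<and> u < b" if uX: "u \<in> X" for u
  proof -
    obtain d where d: "d > 0" "ball u d \<subseteq> X" by (rule openE[OF oX uX])
    have "u + d / 2 \<in> ball u d" "u - d / 2 \<in> ball u d" using d(1) by (auto simp: dist_norm)
    then have m: "u + d / 2 \<in> X" "u - d / 2 \<in> X" using d(2) by blast+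
    have "u + d / 2 \<le> b" unfolding b_def by (rule cSup_upper[OF m(1) bdd(1)])
    moreover have "a \<le> u - d / 2" unfolding a_def by (rule cInf_lower[OF m(2) bdd(2)])
    ultimately show ?thesis using d(1) by linarith
  qed
  have inX: "u \<in> X" if u: "a < u" "u < b" for u
  proof -
    have ne: "X \<noteq> {}" using x0X by blast
    obtain u1 where u1: "u1 \<in> X" "u1 < u" using u(1) cInf_less_iff[OF ne bdd(2)] unfolding a_def by auto
    obtain u2 where u2: "u2 \<in> X" "u < u2" using u(2) less_cSup_iff[OF ne bdd(1)] unfolding b_def by auto
    define s where "s = (u - u1) / (u2 - u1)"
    have "0 < u2 - u1" "0 \<le> u - u1" "u - u1 \<le> u2 - u1" using u1 u2 by simp_all
    then have s: "0 \<le> s" "s \<le> 1" unfolding s_def by simp_all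
    have "s * (u2 - u1) = u - u1" using u1 u2 by (simp add: s_def)
    then have "u = (1 - s) * u1 + s * u2" by (simp add: algebra_simps)
    then show ?thesis using cX[OF u1(1) u2(1) s] by simp
  qed
  define Ks where "Ks = K \<inter> {x. x $ 2 = y}"
  have cl: "closed {x :: real^2. x $ 2 = y}" by (intro closed_Collect_eq continuous_intros)
  have "x0 \<in> Ks" using y by (simp add: Ks_def)
  then have Ks: "compact Ks" "Ks \<noteq> {}" using compact_Int_closed[OF K(1) cl] by (auto simp: Ks_def)
  have KsX: "x $ 1 \<in> X" if "x \<in> Ks" for x
  proof -
    have "x $ 2 = y" "x \<in> \<Omega>" using that K(2) by (auto simp: Ks_def)
    then show ?thesis using e_eta[of x] by (simp add: X_def)
  qed
  have c1: "continuous_on Ks (\<lambda>x. x $ 1)" by (intro continuous_intros)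
  obtain p1 where p1: "p1 \<in> Ks" "\<And>x. x \<in> Ks \<Longrightarrow> p1 $ 1 \<le> x $ 1"
    using continuous_attains_inf[OF Ks c1] by blast
  obtain p2 where p2: "p2 \<in> Ks" "\<And>x. x \<in> Ks \<Longrightarrow> x $ 1 \<le> p2 $ 1"
    using continuous_attains_sup[OF Ks c1] by blast
  obtain \<alpha> where \<alpha>: "a < \<alpha>" "\<alpha> < p1 $ 1" using ab[OF KsX[OF p1(1)]] dense by blast
  have "max (p2 $ 1) (b - \<kappa>) < b" using ab[OF KsX[OF p2(1)]] \<kappa> by simp
  then obtain \<beta> where \<beta>: "max (p2 $ 1) (b - \<kappa>) < \<beta>" "\<beta> < b" using dense by blast
  have \<alpha>\<beta>: "\<alpha> < \<beta>" using \<alpha>(2) \<beta>(1) p1(2)[OF p2(1)] by simp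
  have "\<exists>r>0. \<forall>x\<in>rect \<alpha> \<beta> (y - 1) (y + 1) - \<Omega>. r < \<bar>x $ 2 - y\<bar>"
  proof (rule compact_avoids_strip)
    show "compact (rect \<alpha> \<beta> (y - 1) (y + 1) - \<Omega>)" using compact_rect \<Omega>(2) by (rule compact_diff)
    fix x assume x: "x \<in> rect \<alpha> \<beta> (y - 1) (y + 1) - \<Omega>"
    show "x $ 2 \<noteq> y"
    proof
      assume xy: "x $ 2 = y"
      have "x $ 1 \<in> X" using x \<alpha> \<beta> by (intro inX) (auto simp: rect_def)
      then show False using x e_eta[OF xy] by (simp add: X_def)
    qed
  qed
  then obtain r1 where r1: "r1 > 0" "\<And>x. x \<in> rect \<alpha> \<beta> (y - 1) (y + 1) - \<Omega> \<Longrightarrow> r1 < \<bar>x $ 2 - y\<bar>" by blast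
  have closed1: "closed {x :: real^2. v \<le> x $ 1}" "closed {x :: real^2. x $ 1 \<le> v}" for v
    by (intro closed_Collect_le continuous_intros)+
  have "\<exists>r>0. \<forall>x\<in>closure \<Omega> \<inter> {x. \<beta> + \<kappa> \<le> x $ 1}. r < \<bar>x $ 2 - y\<bar>"
  proof (rule compact_avoids_strip)
    show "compact (closure \<Omega> \<inter> {x. \<beta> + \<kappa> \<le> x $ 1})"
      using \<Omega>(3) closed1 by (intro compact_Int_closed) simp_all
    fix x assume x: "x \<in> closure \<Omega> \<inter> {x. \<beta> + \<kappa> \<le> x $ 1}"
    show "x $ 2 \<noteq> y"
    proof
      assume xy: "x $ 2 = y"
      define u0 where "u0 = x0 $ 1"
      \<comment> \<open>A point of \<open>closure \<Omega>\<close> on the line beyond the right end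
        \<open>b\<close>, joined to the point \<open>e u0\<close> of \<Omega>, would produce a point
        of \<Omega> beyond \<open>b\<close>.\<close>
      define v where "v = (b + x $ 1) / 2"
      have xb: "b < x $ 1" using x \<beta> by simp
      then have v: "b < v" "v < x $ 1" "u0 < b" using ab[OF x0X] by (auto simp: v_def u0_def)
      define s where "s = (v - u0) / (x $ 1 - u0)"
      have "0 < x $ 1 - u0" "0 < v - u0" "v - u0 < x $ 1 - u0" using v by simp_all
      then have s: "0 < s" "s < 1" unfolding s_def by simp_all
      have "s * (x $ 1 - u0) = v - u0" using v by (simp add: s_def)
      then have "v = (1 - s) * u0 + s * x $ 1" by (simp add: algebra_simps)
      then have "e v = (1 - s) *\<^sub>R e u0 + s *\<^sub>R e (x $ 1)" by (simp add: e_lin)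
      then have "e v \<in> open_segment (e u0) (e (x $ 1))"
      proof -
        assume ev: "e v = (1 - s) *\<^sub>R e u0 + s *\<^sub>R e (x $ 1)"
        have "e u0 \<noteq> e (x $ 1)" using e(1)[of u0] e(1)[of "x $ 1"] v by auto
        then show ?thesis unfolding in_segment using s ev by blast
      qed
      moreover have "e u0 \<in> interior \<Omega>" using x0X \<Omega>(2) by (simp add: X_def u0_def interior_open)
      moreover have "e (x $ 1) \<in> closure \<Omega>" using x e_eta[OF xy] by simp
      ultimately have "e v \<in> interior \<Omega>"
        using in_interior_closure_convex_segment[OF \<Omega>(1)] by blast
      then have "v \<in> X" using interior_subset by (auto simp: X_def)
      then show False using ab v(1) by fastforce
    qed
  qed
  then obtain r2 where r2: "r2 > 0" "\<And>x. x \<in> closure \<Omega> \<inter> {x. \<beta> + \<kappa> \<le> x $ 1} \<Longrightarrow> r2 < \<bar>x $ 2 - y\<bar>" by blast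
  have "\<exists>r>0. \<forall>x\<in>K \<inter> {x. \<beta> \<le> x $ 1}. r < \<bar>x $ 2 - y\<bar>"
  proof (rule compact_avoids_strip)
    show "compact (K \<inter> {x. \<beta> \<le> x $ 1})" using K(1) closed1 by (intro compact_Int_closed)
    fix x assume x: "x \<in> K \<inter> {x. \<beta> \<le> x $ 1}"
    show "x $ 2 \<noteq> y" using x \<beta> p2(2)[of x] by (auto simp: Ks_def)
  qed
  then obtain r3 where r3: "r3 > 0" "\<And>x. x \<in> K \<inter> {x. \<beta> \<le> x $ 1} \<Longrightarrow> r3 < \<bar>x $ 2 - y\<bar>" by blast
  have "\<exists>r>0. \<forall>x\<in>K \<inter> {x. x $ 1 \<le> \<alpha>}. r < \<bar>x $ 2 - y\<bar>"
  proof (rule compact_avoids_strip)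
    show "compact (K \<inter> {x. x $ 1 \<le> \<alpha>})" using K(1) closed1 by (intro compact_Int_closed)
    fix x assume x: "x \<in> K \<inter> {x. x $ 1 \<le> \<alpha>}"
    show "x $ 2 \<noteq> y" using x \<alpha> p1(2)[of x] by (auto simp: Ks_def)
  qed
  then obtain r4 where r4: "r4 > 0" "\<And>x. x \<in> K \<inter> {x. x $ 1 \<le> \<alpha>} \<Longrightarrow> r4 < \<bar>x $ 2 - y\<bar>" by blast
  define r where "r = Min {1, r1, r2, r3, r4}"
  have r: "0 < r" "r \<le> 1" "r \<le> r1" "r \<le> r2" "r \<le> r3" "r \<le> r4"
    using r1(1) r2(1) r3(1) r4(1) by (simp_all add: r_def)
  have "rect \<alpha> \<beta> (y - r) (y + r) \<subseteq> \<Omega>"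
  proof
    fix x assume x: "x \<in> rect \<alpha> \<beta> (y - r) (y + r)"
    show "x \<in> \<Omega>"
    proof (rule ccontr)
      assume "x \<notin> \<Omega>"
      then have "r1 < \<bar>x $ 2 - y\<bar>" using x r by (intro r1(2)) (auto simp: rect_def)
      then show False using x r by (auto simp: rect_def)
    qed
  qed
  moreover have "x $ 1 \<le> \<beta> + \<kappa>" if "x \<in> closure \<Omega>" "\<bar>x $ 2 - y\<bar> \<le> r" for x
    using r2(2)[of x] that r by (cases "\<beta> + \<kappa> \<le> x $ 1") auto
  moreover have "\<alpha> \<le> x $ 1 \<and> x $ 1 \<le> \<beta>" if "x \<in> K" "\<bar>x $ 2 - y\<bar> \<le> r" for x
    using r3(2)[of x] r4(2)[of x] that r by fastforce
  ultimately show ?thesis using \<alpha>\<beta> r(1) by blast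
qed

text \<open>The strips have half the Lebesgue number of the cover of the projection \<open>Y\<close>
  by the intervals around good levels. So each strip that meets \<open>Y\<close> fits into one
  interval and inherits its rectangle.\<close>

lemma rect_cover:
  fixes \<Omega> :: "(real^2) set"
  assumes \<Omega>: "convex \<Omega>" "open \<Omega>" "bounded \<Omega>" and K: "compact K" "K \<subseteq> \<Omega>" and \<kappa>: "0 < \<kappa>"
  obtains J :: "int set" and \<alpha> \<beta> c d where "finite J"
    "\<And>j. j \<in> J \<Longrightarrow> \<alpha> j < \<beta> j \<and> c j < d j \<and> rect (\<alpha> j) (\<beta> j) (c j) (d j) \<subseteq> \<Omega>"
    "\<And>j x. j \<in> J \<Longrightarrow> x \<in> closure \<Omega> \<Longrightarrow> c j \<le> x $ 2 \<Longrightarrow> x $ 2 \<le> d j \<Longrightarrow> x $ 1 \<le> \<beta> j + \<kappa>"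
    "\<And>j k. j \<in> J \<Longrightarrow> k \<in> J \<Longrightarrow> j \<noteq> k \<Longrightarrow> d j \<le> c k \<or> d k \<le> c j"
    "K \<subseteq> (\<Union>j\<in>J. rect (\<alpha> j) (\<beta> j) (c j) (d j))"
proof -
  define Y where "Y = (\<lambda>x. x $ 2) ` K"
  have cY: "compact Y" unfolding Y_def by (intro compact_continuous_image continuous_intros K(1))
  define good where "good y \<alpha> \<beta> r \<longleftrightarrow> \<alpha> < \<beta> \<and> 0 < r \<and> rect \<alpha> \<beta> (y - r) (y + r) \<subseteq> \<Omega> \<and>
    (\<forall>x\<in>closure \<Omega>. \<bar>x $ 2 - y\<bar> \<le> r \<longrightarrow> x $ 1 \<le> \<beta> + \<kappa>) \<and> (\<forall>x\<in>K. \<bar>x $ 2 - y\<bar> \<le> r \<longrightarrow> \<alpha> \<le> x $ 1 \<and> x $ 1 \<le> \<beta>)"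
    for y \<alpha> \<beta> r
  have "\<exists>\<alpha> \<beta> r. good y \<alpha> \<beta> r" if "y \<in> Y" for y
  proof -
    obtain x0 where "x0 \<in> K" "x0 $ 2 = y" using \<open>y \<in> Y\<close> unfolding Y_def by blast
    then show ?thesis unfolding good_def by (rule rect_through_slice[OF \<Omega> K \<kappa>])
  qed
  then obtain A B r where good: "\<And>y. y \<in> Y \<Longrightarrow> good y (A y) (B y) (r y)" by metis
  note AB = good[unfolded good_def]
  have cov: "Y \<subseteq> \<Union>((\<lambda>y. ball y (r y)) ` Y)"
  proof
    fix y assume y: "y \<in> Y"
    then have "y \<in> ball y (r y)" using AB[OF y] by simp
    then show "y \<in> \<Union>((\<lambda>y. ball y (r y)) ` Y)" using y by blast
  qed
  obtain e where e: "e > 0" "\<And>x. x \<in> Y \<Longrightarrow> \<exists>G\<in>(\<lambda>y. ball y (r y)) ` Y. ball x e \<subseteq> G"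
    by (rule Heine_Borel_lemma[OF cY cov]) auto
  define \<rho> where "\<rho> = e / 2"
  have \<rho>: "\<rho> > 0" using e by (simp add: \<rho>_def)
  define J where "J = {k::int. \<exists>y\<in>Y. of_int k * \<rho> \<le> y \<and> y \<le> (of_int k + 1) * \<rho>}"
  have "\<exists>y\<in>Y. \<forall>z. of_int k * \<rho> \<le> z \<longrightarrow> z \<le> (of_int k + 1) * \<rho> \<longrightarrow> \<bar>z - y\<bar> \<le> r y" if k: "k \<in> J" for k
  proof -
    obtain y' where y': "y' \<in> Y" "of_int k * \<rho> \<le> y'" "y' \<le> (of_int k + 1) * \<rho>" using k by (auto simp: J_def)
    obtain y where y: "y \<in> Y" "ball y' e \<subseteq> ball y (r y)" using e(2)[OF y'(1)] by auto
    have "\<bar>z - y\<bar> \<le> r y" if "of_int k * \<rho> \<le> z" "z \<le> (of_int k + 1) * \<rho>" for z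
    proof -
      have "\<bar>y' - z\<bar> \<le> \<rho>" using that y' by (auto simp: abs_le_iff algebra_simps)
      then have "z \<in> ball y' e" using e(1) by (simp add: dist_real_def \<rho>_def)
      then have "z \<in> ball y (r y)" using y(2) by blast
      then show ?thesis by (simp add: dist_real_def abs_minus_commute less_imp_le)
    qed
    then show ?thesis using y(1) by blast
  qed
  then obtain f where f: "\<And>k. k \<in> J \<Longrightarrow> f k \<in> Y" "\<And>k z. k \<in> J \<Longrightarrow> of_int k * \<rho> \<le> z \<Longrightarrow> z \<le> (of_int k + 1) * \<rho> \<Longrightarrow> \<bar>z - f k\<bar> \<le> r (f k)"
    by metis
  show ?thesis
  proof (rule that[of J "\<lambda>k. A (f k)" "\<lambda>k. B (f k)" "\<lambda>k. of_int k * \<rho>" "\<lambda>k. (of_int k + 1) * \<rho>"])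
    obtain R where R: "\<And>y. y \<in> Y \<Longrightarrow> \<bar>y\<bar> \<le> R" using compact_imp_bounded[OF cY] unfolding bounded_iff by auto
    have "J \<subseteq> {\<lfloor>- R / \<rho>\<rfloor> - 1 .. \<lceil>R / \<rho>\<rceil>}"
    proof
      fix k assume "k \<in> J"
      then obtain y where y: "y \<in> Y" "of_int k * \<rho> \<le> y" "y \<le> (of_int k + 1) * \<rho>" by (auto simp: J_def)
      have "of_int k * \<rho> \<le> R" "- R \<le> (of_int k + 1) * \<rho>" using R[OF y(1)] y by linarith+
      then have "of_int k \<le> R / \<rho>" "- R / \<rho> \<le> of_int (k + 1)" using \<rho> by (simp_all add: field_simps)
      then have "k \<le> \<lceil>R / \<rho>\<rceil>" "\<lfloor>- R / \<rho>\<rfloor> \<le> k + 1" by linarith+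
      then show "k \<in> {\<lfloor>- R / \<rho>\<rfloor> - 1 .. \<lceil>R / \<rho>\<rceil>}" by simp
    qed
    then show "finite J" by (rule finite_subset) simp
    fix j assume j: "j \<in> J"
    have "rect (A (f j)) (B (f j)) (of_int j * \<rho>) ((of_int j + 1) * \<rho>) \<subseteq> rect (A (f j)) (B (f j)) (f j - r (f j)) (f j + r (f j))"
    proof
      fix x assume x: "x \<in> rect (A (f j)) (B (f j)) (of_int j * \<rho>) ((of_int j + 1) * \<rho>)"
      then have "\<bar>x $ 2 - f j\<bar> \<le> r (f j)" by (intro f(2) j) (auto simp: rect_def)
      then show "x \<in> rect (A (f j)) (B (f j)) (f j - r (f j)) (f j + r (f j))" using x by (auto simp: rect_def abs_le_iff)
    qed
    then show "A (f j) < B (f j) \<and> of_int j * \<rho> < (of_int j + 1) * \<rho> \<and>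
        rect (A (f j)) (B (f j)) (of_int j * \<rho>) ((of_int j + 1) * \<rho>) \<subseteq> \<Omega>"
      using AB[OF f(1)[OF j]] \<rho> by (auto simp: algebra_simps)
    show "x $ 1 \<le> B (f j) + \<kappa>" if "x \<in> closure \<Omega>" "of_int j * \<rho> \<le> x $ 2" "x $ 2 \<le> (of_int j + 1) * \<rho>" for x
      using AB[OF f(1)[OF j]] f(2)[OF j that(2,3)] that(1) by blast
  next
    fix j k assume "j \<in> J" "k \<in> J" "j \<noteq> k"
    then consider "j + 1 \<le> k" | "k + 1 \<le> j" by linarith
    then have "real_of_int j + 1 \<le> of_int k \<or> real_of_int k + 1 \<le> of_int j" by cases linarith+
    then show "(of_int j + 1) * \<rho> \<le> of_int k * \<rho> \<or> (of_int k + 1) * \<rho> \<le> of_int j * \<rho>"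
      using \<rho> by auto
  next
    show "K \<subseteq> (\<Union>j\<in>J. rect (A (f j)) (B (f j)) (of_int j * \<rho>) ((of_int j + 1) * \<rho>))"
    proof
      fix x assume x: "x \<in> K"
      define k where "k = \<lfloor>x $ 2 / \<rho>\<rfloor>"
      have "of_int k \<le> x $ 2 / \<rho>" "x $ 2 / \<rho> \<le> of_int k + 1" unfolding k_def by linarith+
      then have k: "of_int k * \<rho> \<le> x $ 2" "x $ 2 \<le> (of_int k + 1) * \<rho>" using \<rho> by (simp_all add: field_simps)
      then have kJ: "k \<in> J" using x by (auto simp: J_def Y_def)
      have "A (f k) \<le> x $ 1 \<and> x $ 1 \<le> B (f k)"
        using AB[OF f(1)[OF kJ]] f(2)[OF kJ k] x by blast
      then show "x \<in> (\<Union>j\<in>J. rect (A (f j)) (B (f j)) (of_int j * \<rho>) ((of_int j + 1) * \<rho>))"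
        using k kJ by (auto simp: rect_def)
    qed
  qed
qed

section \<open>Arrays of devices\<close>

lemma no_body_over:
  assumes "closed B" "\<And>z. (x, z) \<notin> B"
  shows "after_reflections B x k p w \<Longrightarrow> k = 0" "scatters_to B x (0, -1)"
proof -
  show "k = 0" if A: "after_reflections B x k p w"
  proof (rule ccontr)
    assume "k \<noteq> 0"
    then obtain p' w' where "after_reflections B x (Suc 0) p' w'"
      using after_reflections_prefix[OF A, of 0] by auto
    then show False using assms(2) unfolding first_reflection[OF assms(1)] by blast
  qed
  have "after_reflections B x 0 (x, 0) (0, -1)" by (rule incoming) (simp add: assms(2))
  then show "scatters_to B x (0, -1)" unfolding scatters_to_def
    by (intro exI[of _ 0] exI[of _ "(x, 0)"] conjI allI impI) (simp_all add: assms(2))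
qed

lemma first_reflection_at:
  assumes B: "closed B" and z0: "(x, z0) \<in> B" "\<And>z. z0 < z \<Longrightarrow> (x, z) \<notin> B"
    and w1: "\<And>n. unit_normal (frontier B) (x, z0) n \<Longrightarrow> reflect n (0, -1) = w1"
  shows "after_reflections B x (Suc 0) p w \<Longrightarrow> p = (x, z0) \<and> w = w1"
    "unit_normal (frontier B) (x, z0) n \<Longrightarrow> after_reflections B x (Suc 0) (x, z0) w1"
proof -
  show "p = (x, z0) \<and> w = w1" if A: "after_reflections B x (Suc 0) p w"
  proof -
    obtain z n where z: "p = (x, z)" "(x, z) \<in> B" "\<forall>z'>z. (x, z') \<notin> B"
      "unit_normal (frontier B) (x, z) n" "w = reflect n (0, -1)"
      using A unfolding first_reflection[OF B] by blast
    have "\<not> z < z0" "\<not> z0 < z" using z(2,3) z0 by blast+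
    then have "z = z0" by simp
    then show ?thesis using z w1 by simp
  qed
  show "after_reflections B x (Suc 0) (x, z0) w1" if n: "unit_normal (frontier B) (x, z0) n"
    unfolding first_reflection[OF B] using z0 n w1[OF n]
    by (intro exI[of _ z0] exI[of _ n]) simp
qed

lemma one_reflection:
  assumes B: "closed B" and z0: "(x, z0) \<in> B" "\<And>z. z0 < z \<Longrightarrow> (x, z) \<notin> B"
    and w1: "\<And>n. unit_normal (frontier B) (x, z0) n \<Longrightarrow> reflect n (0, -1) = w1"
    and free: "\<And>t. 0 < t \<Longrightarrow> (x, z0) + t *\<^sub>R w1 \<notin> B"
  shows "after_reflections B x k p w \<Longrightarrow> k \<le> 1"
    "unit_normal (frontier B) (x, z0) n \<Longrightarrow> scatters_to B x w1"
proof -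
  show "k \<le> 1" if A: "after_reflections B x k p w"
  proof (rule ccontr)
    assume "\<not> k \<le> 1"
    then have "Suc 0 < k" by simp
    then obtain p' w' where "after_reflections B x (Suc (Suc 0)) p' w'"
      using after_reflections_prefix[OF A] by blast
    then obtain p0 w0 t n where 1: "after_reflections B x (Suc 0) p0 w0" "t > 0"
      "unit_normal (frontier B) (p0 + t *\<^sub>R w0) n"
      by (subst (asm) after_reflections_Suc) blast
    have "p0 = (x, z0) \<and> w0 = w1" by (rule first_reflection_at(1)[OF B z0 w1 1(1)])
    then have "(x, z0) + t *\<^sub>R w1 \<in> frontier B" using unit_normal_mem[OF 1(3)] by simp
    then have "(x, z0) + t *\<^sub>R w1 \<in> B" using frontier_subset_closed[OF B] by blast
    then show False using free[OF 1(2)] by blast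
  qed
  show "scatters_to B x w1" if "unit_normal (frontier B) (x, z0) n"
    unfolding scatters_to_def using first_reflection_at(2)[OF B z0 w1 that] free by blast
qed

text \<open>\<open>w1\<close> and \<open>w2\<close> are prescribed for whatever normals exist. In
  this form the bound on the number of reflections applies to every particle, and the existence of
  normals enters only in the claim on scattering.\<close>

lemma two_reflections:
  assumes B: "closed B" and z0: "(x, z0) \<in> B" "\<And>z. z0 < z \<Longrightarrow> (x, z) \<notin> B"
    and w1: "\<And>n. unit_normal (frontier B) (x, z0) n \<Longrightarrow> reflect n (0, -1) = w1"
    and t1: "0 < t1" "(x, z0) + t1 *\<^sub>R w1 \<in> B"
      "\<And>t. 0 < t \<Longrightarrow> t < t1 \<Longrightarrow> (x, z0) + t *\<^sub>R w1 \<notin> B"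
    and w2: "\<And>n. unit_normal (frontier B) ((x, z0) + t1 *\<^sub>R w1) n \<Longrightarrow> reflect n w1 = w2"
    and free: "\<And>t. 0 < t \<Longrightarrow> (x, z0) + t1 *\<^sub>R w1 + t *\<^sub>R w2 \<notin> B"
  shows "after_reflections B x k p w \<Longrightarrow> k \<le> 2"
    "unit_normal (frontier B) (x, z0) n \<Longrightarrow> unit_normal (frontier B) ((x, z0) + t1 *\<^sub>R w1) m \<Longrightarrow> scatters_to B x w2"
proof -
  have second: "p' = (x, z0) + t1 *\<^sub>R w1 \<and> w' = w2" if A: "after_reflections B x (Suc (Suc 0)) p' w'" for p' w'
  proof -
    obtain p0 w0 t n where 1: "after_reflections B x (Suc 0) p0 w0" "t > 0" "\<forall>s\<in>{0<..<t}. p0 + s *\<^sub>R w0 \<notin> B"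
      "unit_normal (frontier B) (p0 + t *\<^sub>R w0) n" "p' = p0 + t *\<^sub>R w0" "w' = reflect n w0"
      using A by (subst (asm) after_reflections_Suc) blast
    have e: "p0 = (x, z0)" "w0 = w1" using first_reflection_at(1)[OF B z0 w1 1(1)] by simp_all
    have "(x, z0) + t *\<^sub>R w1 \<in> frontier B" using unit_normal_mem[OF 1(4)] e by simp
    then have tB: "(x, z0) + t *\<^sub>R w1 \<in> B" using frontier_subset_closed[OF B] by blast
    have "\<not> t < t1" using t1(3)[OF 1(2)] tB by blast
    moreover have "\<not> t1 < t" using 1(3) t1(1,2) e by force
    ultimately have "t = t1" by simp
    then show ?thesis using 1 e w2 by simp
  qed
  show "k \<le> 2" if A: "after_reflections B x k p w"
  proof (rule ccontr)
    assume "\<not> k \<le> 2"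
    then have "Suc (Suc 0) < k" by simp
    then obtain p' w' where "after_reflections B x (Suc (Suc (Suc 0))) p' w'"
      using after_reflections_prefix[OF A] by blast
    then obtain p0 w0 t n where 1: "after_reflections B x (Suc (Suc 0)) p0 w0" "t > 0"
      "unit_normal (frontier B) (p0 + t *\<^sub>R w0) n"
      by (subst (asm) after_reflections_Suc) blast
    have "(x, z0) + t1 *\<^sub>R w1 + t *\<^sub>R w2 \<in> frontier B" using unit_normal_mem[OF 1(3)] second[OF 1(1)] by simp
    then have "(x, z0) + t1 *\<^sub>R w1 + t *\<^sub>R w2 \<in> B" using frontier_subset_closed[OF B] by blast
    then show False using free[OF 1(2)] by blast
  qed
  show "scatters_to B x w2" if n: "unit_normal (frontier B) (x, z0) n"
    and m: "unit_normal (frontier B) ((x, z0) + t1 *\<^sub>R w1) m"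
  proof -
    have "after_reflections B x (Suc 0) (x, z0) w1" by (rule first_reflection_at(2)[OF B z0 w1 n])
    then have "after_reflections B x (Suc (Suc 0)) ((x, z0) + t1 *\<^sub>R w1) (reflect m w1)"
      by (rule reflection) (use t1 m in auto)
    then show ?thesis unfolding scatters_to_def w2[OF m] using free by blast
  qed
qed

lemma frontier_vertical:
  fixes B :: "space3 set"
  assumes "(y, h) \<in> B" "\<And>e. e > 0 \<Longrightarrow> \<exists>\<delta>. \<bar>\<delta>\<bar> < e \<and> (y, h + \<delta>) \<notin> B"
  shows "(y, h) \<in> frontier B"
  unfolding frontier_straddle
proof (intro allI impI conjI)
  fix e :: real assume e: "0 < e"
  show "\<exists>x\<in>B. dist (y, h) x < e" using assms(1) e by (intro bexI[of _ "(y, h)"]) simp_all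
  obtain \<delta> where "\<bar>\<delta>\<bar> < e" "(y, h + \<delta>) \<notin> B" using assms(2)[OF e] by blast
  then show "\<exists>x. x \<notin> B \<and> dist (y, h) x < e"
    by (intro exI[of _ "(y, h + \<delta>)"]) (simp add: dist_Pair_Pair dist_real_def)
qed

lemma frontier_top:
  fixes B :: "space3 set"
  assumes "(y, h) \<in> B" "\<And>z. h < z \<Longrightarrow> (y, z) \<notin> B"
  shows "(y, h) \<in> frontier B"
proof (rule frontier_vertical[OF assms(1)])
  fix e :: real assume "e > 0"
  then show "\<exists>\<delta>. \<bar>\<delta>\<bar> < e \<and> (y, h + \<delta>) \<notin> B"
    by (intro exI[of _ "e / 2"]) (simp add: assms(2))
qed

lemma flat_reflect:
  assumes "unit_normal S (x, h) n" "convex C" "x \<in> C" "interior C \<noteq> {}" "\<And>y. y \<in> C \<Longrightarrow> (y, h) \<in> S"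
  shows "reflect n (0, -1) = (0, 1)"
  using graph_reflect[OF assms(1-4), of 0 "(0, -1)"] assms(5) by (simp add: prod_eq_iff)

text \<open>The particle returns along the vertical line on which it came, and \<open>B\<close> has
  no point there above \<open>z0\<close>.\<close>

lemma flat_top:
  assumes B: "closed B" and z0: "(x, z0) \<in> B" "\<And>z. z0 < z \<Longrightarrow> (x, z) \<notin> B"
    and C: "convex C" "x \<in> C" "interior C \<noteq> {}" "\<And>y. y \<in> C \<Longrightarrow> (y, z0) \<in> frontier B"
  shows "after_reflections B x k p w \<Longrightarrow> k \<le> 1"
    "unit_normal (frontier B) (x, z0) n \<Longrightarrow> scatters_to B x (0, 1)"
proof -
  have w1: "reflect n (0, -1) = (0, 1)" if "unit_normal (frontier B) (x, z0) n" for n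
    by (rule flat_reflect[OF that C])
  have free: "(x, z0) + t *\<^sub>R (0, 1) \<notin> B" if "0 < t" for t
    using z0(2)[of "z0 + t"] that by simp
  show "after_reflections B x k p w \<Longrightarrow> k \<le> 1" by (rule one_reflection(1)[OF B z0 w1 free])
  show "unit_normal (frontier B) (x, z0) n \<Longrightarrow> scatters_to B x (0, 1)" by (rule one_reflection(2)[OF B z0 w1 free])
qed

section \<open>Devices side by side and the pieces of their body\<close>

lemma interior_rect_nonempty: "a < b \<Longrightarrow> c < d \<Longrightarrow> interior (rect a b c d) \<noteq> {}"
proof -
  assume "a < b" "c < d"
  then have "vector [(a + b) / 2, (c + d) / 2] \<in> interior (rect a b c d)"
    unfolding rect_cbox interior_cbox by (simp add: mem_box_cart forall_2 vector_2)
  then show ?thesis by blast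
qed

lemma convex_rect: "convex (rect a b c d)"
  unfolding rect_cbox by (rule convex_box)

text \<open>Each \<open>j\<close> carries one profile, extended along the second coordinate from
  \<open>c j\<close> to \<open>d j\<close>. The assumption \<open>exit\<close> limits how far
  \<open>closure \<Omega>\<close> continues to the right of a device, by the same
  \<open>\<epsilon> * M / 100\<close> that limits the mirror length in
  \<open>profile\<close>.\<close>

locale device_array =
  fixes \<Omega> :: "(real^2) set" and M \<epsilon> :: real and J :: "int set"
    and \<alpha> \<beta> c d \<theta> l \<tau> g h :: "int \<Rightarrow> real" and I :: "int \<Rightarrow> (nat \<times> nat) set"
    and a u s :: "int \<Rightarrow> nat \<times> nat \<Rightarrow> real"
  assumes convex: "convex \<Omega>" and op: "open \<Omega>" and bdd: "bounded \<Omega>"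
    and \<epsilon>: "0 < \<epsilon>" "\<epsilon> \<le> 1/16" and M: "0 < M" and finJ: "finite J"
    and base: "\<And>j. j \<in> J \<Longrightarrow> rect (\<alpha> j) (\<beta> j) (c j) (d j) \<subseteq> \<Omega>"
    and \<theta>: "\<And>j. j \<in> J \<Longrightarrow> 0 < \<theta> j \<and> 2 * \<theta> j < d j - c j"
    and prof: "\<And>j. j \<in> J \<Longrightarrow> profile (\<alpha> j) (\<beta> j) M \<epsilon> (I j) (a j) (u j) (s j) (l j) (\<tau> j) (g j) (h j)"
    and exit: "\<And>j x. j \<in> J \<Longrightarrow> x \<in> closure \<Omega> \<Longrightarrow> c j \<le> x $ 2 \<Longrightarrow> x $ 2 \<le> d j \<Longrightarrow> x $ 1 \<le> \<beta> j + \<epsilon> * M / 100"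
    and strips: "\<And>j k. j \<in> J \<Longrightarrow> k \<in> J \<Longrightarrow> j \<noteq> k \<Longrightarrow> d j \<le> c k \<or> d k \<le> c j"
begin

definition wall1 where "wall1 j = prism (\<alpha> j) (\<beta> j) (c j) (c j + \<theta> j) 0 0 M 0"
definition wall2 where "wall2 j = prism (\<alpha> j) (\<beta> j) (d j - \<theta> j) (d j) 0 0 M 0"
definition slat where
  "slat j i = prism (a j i) (a j i + l j) (c j) (d j) (u j i + s j i * a j i - \<tau> j) (- s j i) (u j i + s j i * a j i) (- s j i)"
definition mirror where
  "mirror j = prism (g j) (\<beta> j) (c j) (d j) (h j + (1 - \<epsilon>) * \<beta> j) (- (1 - \<epsilon>)) M 0"

definition pieces where
  "pieces = (\<Union>j\<in>J. {wall1 j, wall2 j, mirror j} \<union> slat j ` I j)"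

definition upper where "upper j i y = u j i - s j i * (y - a j i)"
definition low where "low j y = h j + (1 - \<epsilon>) * (\<beta> j - y)"

lemma mem_wall1: "(x, z) \<in> wall1 j \<longleftrightarrow> \<alpha> j \<le> x $ 1 \<and> x $ 1 \<le> \<beta> j \<and> c j \<le> x $ 2 \<and> x $ 2 \<le> c j + \<theta> j \<and> 0 \<le> z \<and> z \<le> M"
  by (simp add: wall1_def prism_mem)

lemma mem_wall2: "(x, z) \<in> wall2 j \<longleftrightarrow> \<alpha> j \<le> x $ 1 \<and> x $ 1 \<le> \<beta> j \<and> d j - \<theta> j \<le> x $ 2 \<and> x $ 2 \<le> d j \<and> 0 \<le> z \<and> z \<le> M"
  by (simp add: wall2_def prism_mem)

lemma mem_slat: "(x, z) \<in> slat j i \<longleftrightarrow> a j i \<le> x $ 1 \<and> x $ 1 \<le> a j i + l j \<and> c j \<le> x $ 2 \<and> x $ 2 \<le> d j \<and>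
    upper j i (x $ 1) - \<tau> j \<le> z \<and> z \<le> upper j i (x $ 1)"
  by (auto simp: slat_def prism_mem upper_def algebra_simps)

lemma mem_mirror: "(x, z) \<in> mirror j \<longleftrightarrow> g j \<le> x $ 1 \<and> x $ 1 \<le> \<beta> j \<and> c j \<le> x $ 2 \<and> x $ 2 \<le> d j \<and> low j (x $ 1) \<le> z \<and> z \<le> M"
  by (auto simp: mirror_def prism_mem low_def algebra_simps)

lemma prof_basic:
  assumes "j \<in> J"
  shows "finite (I j)" "0 < l j" "0 < \<tau> j" "\<alpha> j < g j" "g j < \<beta> j" "\<beta> j - g j \<le> \<epsilon> * M / 100"
    "M / 4 < h j" "low j (g j) < M" "(1 - \<epsilon>) * (\<beta> j - \<alpha> j) \<le> real (card (I j)) * l j"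
proof -
  note P = prof[OF assms, unfolded profile_def]
  show "finite (I j)" using P by (elim conjE)
  show "0 < l j" using P by (elim conjE)
  show "0 < \<tau> j" using P by (elim conjE)
  show "\<alpha> j < g j" using P by (elim conjE)
  show "g j < \<beta> j" using P by (elim conjE)
  show "\<beta> j - g j \<le> \<epsilon> * M / 100" using P by (elim conjE)
  show "M / 4 < h j" using P by (elim conjE)
  show "low j (g j) < M" unfolding low_def using P by (elim conjE)
  show "(1 - \<epsilon>) * (\<beta> j - \<alpha> j) \<le> real (card (I j)) * l j" using P by (elim conjE)
qed

lemma prof_slat:
  assumes "j \<in> J" "i \<in> I j"
  shows "\<alpha> j \<le> a j i" "a j i + l j < g j" "0 < s j i" "s j i \<le> 1" "1 - s j i \<le> \<epsilon> / 4" "tilt (s j i) \<le> \<epsilon> / 4"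
    "M / 4 < u j i - s j i * l j - \<tau> j" "u j i < M"
proof -
  have "\<forall>i\<in>I j. \<alpha> j \<le> a j i \<and> a j i + l j < g j \<and> 0 < s j i \<and> s j i \<le> 1 \<and> 1 - s j i \<le> \<epsilon> / 4 \<and> tilt (s j i) \<le> \<epsilon> / 4 \<and>
        M / 4 < u j i - s j i * l j - \<tau> j \<and> u j i < M"
    using prof[OF assms(1)] unfolding profile_def by (elim conjE)
  then have "\<alpha> j \<le> a j i \<and> a j i + l j < g j \<and> 0 < s j i \<and> s j i \<le> 1 \<and> 1 - s j i \<le> \<epsilon> / 4 \<and> tilt (s j i) \<le> \<epsilon> / 4 \<and>
        M / 4 < u j i - s j i * l j - \<tau> j \<and> u j i < M" using assms(2) by (rule bspec)
  then show "\<alpha> j \<le> a j i" "a j i + l j < g j" "0 < s j i" "s j i \<le> 1" "1 - s j i \<le> \<epsilon> / 4" "tilt (s j i) \<le> \<epsilon> / 4"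
    "M / 4 < u j i - s j i * l j - \<tau> j" "u j i < M" by simp_all
qed

lemma prof_sep:
  assumes "j \<in> J" "i \<in> I j" "i' \<in> I j" "i \<noteq> i'"
  shows "a j i + l j < a j i' \<or> a j i' + l j < a j i"
proof -
  have "\<forall>i\<in>I j. \<forall>i'\<in>I j. i \<noteq> i' \<longrightarrow> a j i + l j < a j i' \<or> a j i' + l j < a j i"
    using prof[OF assms(1)] unfolding profile_def by (elim conjE)
  then show ?thesis using assms(2-4) by blast
qed

abbreviation "flight j i \<equiv> ray (a j) (u j) (s j) i"

lemma prof_ray:
  assumes "j \<in> J" "i \<in> I j" "a j i \<le> x" "x \<le> a j i + l j"
  shows "flight j i x (g j) < low j (g j)" "h j < flight j i x (\<beta> j)"
proof -
  have "\<forall>i\<in>I j. \<forall>x\<in>{a j i..a j i + l j}. flight j i x (g j) < h j + (1 - \<epsilon>) * (\<beta> j - g j) \<and> h j < flight j i x (\<beta> j)"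
    using prof[OF assms(1)] unfolding profile_def by (elim conjE)
  then have "flight j i x (g j) < h j + (1 - \<epsilon>) * (\<beta> j - g j) \<and> h j < flight j i x (\<beta> j)" using assms(2-4) by simp
  then show "flight j i x (g j) < low j (g j)" "h j < flight j i x (\<beta> j)" by (simp_all add: low_def)
qed

lemma prof_free:
  assumes "j \<in> J" "i \<in> I j" "a j i \<le> x" "x \<le> a j i + l j" "i' \<in> I j" "a j i' \<le> y" "y \<le> a j i' + l j" "x < y"
  shows "flight j i x y < upper j i' y - \<tau> j \<or> upper j i' y < flight j i x y"
proof -
  have "\<forall>i\<in>I j. \<forall>x\<in>{a j i..a j i + l j}. \<forall>i'\<in>I j. \<forall>y\<in>{a j i'..a j i' + l j}. x < y \<longrightarrow>
        flight j i x y < u j i' - s j i' * (y - a j i') - \<tau> j \<or> u j i' - s j i' * (y - a j i') < flight j i x y"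
    using prof[OF assms(1)] unfolding profile_def by (elim conjE)
  then show ?thesis using assms(2-) unfolding upper_def by simp
qed

lemma upper_bounds:
  assumes "j \<in> J" "i \<in> I j" "a j i \<le> y" "y \<le> a j i + l j"
  shows "M / 4 + \<tau> j < upper j i y" "upper j i y < M"
proof -
  have s: "0 \<le> s j i" using prof_slat(3)[OF assms(1,2)] by simp
  have "s j i * (y - a j i) \<le> s j i * l j" using s assms(4) by (intro mult_left_mono) auto
  then show "M / 4 + \<tau> j < upper j i y" using prof_slat(7)[OF assms(1,2)] by (simp add: upper_def)
  have "0 \<le> s j i * (y - a j i)" using s assms(3) by simp
  then show "upper j i y < M" using prof_slat(8)[OF assms(1,2)] by (simp add: upper_def)
qed

lemma low_bounds:
  assumes "j \<in> J" "g j \<le> y" "y \<le> \<beta> j"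
  shows "M / 4 < low j y" "low j y < M"
proof -
  have "(1 - \<epsilon>) * (\<beta> j - y) \<le> (1 - \<epsilon>) * (\<beta> j - g j)" using \<epsilon> assms(2) by (intro mult_left_mono) auto
  then show "low j y < M" using prof_basic(8)[OF assms(1)] by (simp add: low_def)
  have "0 \<le> (1 - \<epsilon>) * (\<beta> j - y)" using \<epsilon> assms(3) by simp
  then show "M / 4 < low j y" using prof_basic(7)[OF assms(1)] by (simp add: low_def)
qed

lemma piece_cases:
  assumes "P \<in> pieces"
  obtains j where "j \<in> J" "P = wall1 j" | j where "j \<in> J" "P = wall2 j" | j where "j \<in> J" "P = mirror j"
    | j i where "j \<in> J" "i \<in> I j" "P = slat j i"
  using assms unfolding pieces_def by blast

lemma piece_subset_base:
  assumes "j \<in> J" "(x, z) \<in> wall1 j \<or> (x, z) \<in> wall2 j \<or> (x, z) \<in> mirror j \<or> (\<exists>i\<in>I j. (x, z) \<in> slat j i)"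
  shows "x \<in> rect (\<alpha> j) (\<beta> j) (c j) (d j)" "0 \<le> z" "z \<le> M"
proof -
  note b = prof_basic[OF assms(1)] \<theta>[OF assms(1)]
  have "\<alpha> j \<le> x $ 1 \<and> x $ 1 \<le> \<beta> j \<and> c j \<le> x $ 2 \<and> x $ 2 \<le> d j \<and> 0 \<le> z \<and> z \<le> M"
    using assms(2)
  proof (elim disjE bexE)
    assume "(x, z) \<in> wall1 j" then show ?thesis using b unfolding mem_wall1 by linarith
  next
    assume "(x, z) \<in> wall2 j" then show ?thesis using b unfolding mem_wall2 by linarith
  next
    assume m: "(x, z) \<in> mirror j"
    then have "M / 4 < low j (x $ 1)" by (intro low_bounds(1)[OF assms(1)]) (simp_all add: mem_mirror)
    then show ?thesis using m b M unfolding mem_mirror by linarith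
  next
    fix i assume i: "i \<in> I j" "(x, z) \<in> slat j i"
    have "M / 4 + \<tau> j < upper j i (x $ 1)" "upper j i (x $ 1) < M"
      using i(2) by (auto intro!: upper_bounds[OF assms(1) i(1)] simp: mem_slat)
    then show ?thesis using i(2) b M prof_slat(1,2)[OF assms(1) i(1)] unfolding mem_slat by linarith
  qed
  then show "x \<in> rect (\<alpha> j) (\<beta> j) (c j) (d j)" "0 \<le> z" "z \<le> M" by (simp_all add: rect_def)
qed

text \<open>Slats and mirrors stay above \<open>M / 4\<close>. A floor of thickness
  \<open>M / 8\<close> therefore leaves a drop of more than \<open>M / 8\<close> below a mirror, and
  particles fall by at most \<open>12 * M / 100\<close> before they leave the cylinder.\<close>

sublocale floor_and_prisms \<Omega> "M / 8" M pieces
proof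
  show "finite pieces" unfolding pieces_def using finJ prof_basic(1) by simp
  show "\<Union>pieces \<subseteq> \<Omega> \<times> {0..M}"
  proof
    fix p assume "p \<in> \<Union>pieces"
    then obtain x z P where P: "p = (x, z)" "P \<in> pieces" "(x, z) \<in> P" by (metis UnionE surj_pair)
    obtain j where j: "j \<in> J" "(x, z) \<in> wall1 j \<or> (x, z) \<in> wall2 j \<or> (x, z) \<in> mirror j \<or> (\<exists>i\<in>I j. (x, z) \<in> slat j i)"
      using P(2,3) unfolding pieces_def by blast
    show "p \<in> \<Omega> \<times> {0..M}" using piece_subset_base[OF j] base[OF j(1)] P(1) by auto
  qed
  fix P assume "P \<in> pieces"
  then show "is_prism P"
  proof (cases rule: piece_cases)
    case (1 j)
    show ?thesis unfolding 1 wall1_def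
      by (rule is_prismI) (use prof_basic(4,5)[OF 1(1)] \<theta>[OF 1(1)] M in simp_all)
  next
    case (2 j)
    show ?thesis unfolding 2 wall2_def
      by (rule is_prismI) (use prof_basic(4,5)[OF 2(1)] \<theta>[OF 2(1)] M in simp_all)
  next
    case (3 j)
    show ?thesis unfolding 3 mirror_def
    proof (rule is_prismI)
      fix x assume "g j \<le> x" "x \<le> \<beta> j"
      then have "low j x < M" by (rule low_bounds(2)[OF 3(1)])
      then show "h j + (1 - \<epsilon>) * \<beta> j + - (1 - \<epsilon>) * x < M + 0 * x" by (simp add: low_def algebra_simps)
    qed (use prof_basic(4,5)[OF 3(1)] \<theta>[OF 3(1)] in simp_all)
  next
    case (4 j i)
    show ?thesis unfolding 4 slat_def
      by (rule is_prismI) (use prof_basic(2,3)[OF 4(1)] \<theta>[OF 4(1)] in simp_all)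
  qed
qed (use convex op bdd M in simp_all)

lemma mem_body: "(x, z) \<in> body \<longleftrightarrow> (x \<in> closure \<Omega> \<and> 0 \<le> z \<and> z \<le> M / 8) \<or>
  (\<exists>j\<in>J. (x, z) \<in> wall1 j \<or> (x, z) \<in> wall2 j \<or> (x, z) \<in> mirror j \<or> (\<exists>i\<in>I j. (x, z) \<in> slat j i))"
  unfolding body_def unfolding pieces_def by auto

lemma body_le_M: "(x, z) \<in> body \<Longrightarrow> z \<le> M"
  unfolding mem_body using piece_subset_base(3) M by force

lemma body_in_closure: "(x, z) \<in> body \<Longrightarrow> x \<in> closure \<Omega>"
  unfolding mem_body using piece_subset_base(1) base closure_subset by blast

definition inner where "inner j x \<longleftrightarrow> c j + \<theta> j < x $ 2 \<and> x $ 2 < d j - \<theta> j" for x :: "real^2"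

text \<open>Flights between the two walls of a device keep \<open>x $ 2\<close>, and a plane of this
  kind meets only the floor, the mirror and the slats of that device. This reduces the motion to the
  two-dimensional profile.\<close>

lemma mem_body_inner:
  assumes "j \<in> J" "inner j x"
  shows "(x, z) \<in> body \<longleftrightarrow> (x \<in> closure \<Omega> \<and> 0 \<le> z \<and> z \<le> M / 8) \<or> (x, z) \<in> mirror j \<or> (\<exists>i\<in>I j. (x, z) \<in> slat j i)"
proof -
  have "k = j" if k: "k \<in> J" "(x, z) \<in> wall1 k \<or> (x, z) \<in> wall2 k \<or> (x, z) \<in> mirror k \<or> (\<exists>i\<in>I k. (x, z) \<in> slat k i)" for k
  proof (rule ccontr)
    assume "k \<noteq> j"
    then have "d k \<le> c j \<or> d j \<le> c k" using strips[OF k(1) assms(1)] by simp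
    moreover have "c k \<le> x $ 2" "x $ 2 \<le> d k" using piece_subset_base(1)[OF k] by (auto simp: rect_def)
    ultimately show False using assms(2) \<theta>[OF assms(1)] unfolding inner_def by linarith
  qed
  moreover have "(x, z) \<notin> wall1 j" "(x, z) \<notin> wall2 j" using assms(2) by (auto simp: mem_wall1 mem_wall2 inner_def)
  ultimately show ?thesis unfolding mem_body using assms(1) by blast
qed

lemma flat_top_M:
  assumes R: "a' < b'" "c' < d'" "x \<in> rect a' b' c' d'" "\<And>y. y \<in> rect a' b' c' d' \<Longrightarrow> (y, M) \<in> body"
  shows "after_reflections body x k p w \<Longrightarrow> k \<le> 1"
    "unit_normal (frontier body) (x, M) n \<Longrightarrow> scatters_to body x (0, 1)" "(x, M) \<in> frontier body"
proof -
  have z: "(y, z) \<notin> body" if "M < z" for y z using body_le_M that by force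
  have fr: "(y, M) \<in> frontier body" if "y \<in> rect a' b' c' d'" for y
    by (rule frontier_top[OF R(4)[OF that] z])
  note C = convex_rect R(3) interior_rect_nonempty[OF R(1,2)] fr
  show "after_reflections body x k p w \<Longrightarrow> k \<le> 1" by (rule flat_top(1)[OF closed_body R(4)[OF R(3)] z C])
  show "unit_normal (frontier body) (x, M) n \<Longrightarrow> scatters_to body x (0, 1)" by (rule flat_top(2)[OF closed_body R(4)[OF R(3)] z C])
  show "(x, M) \<in> frontier body" by (rule fr[OF R(3)])
qed

text \<open>\<open>x\<close> may lie on \<open>frontier \<Omega>\<close>, so the flat neighbourhood
  is taken within \<open>closure \<Omega>\<close>, where it is still convex and has interior points.
  It avoids the pieces because their projection is compact.\<close>

lemma flat_top_floor:
  assumes x: "x \<in> closure \<Omega>" "x \<notin> fst ` \<Union>pieces"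
  shows "after_reflections body x k p w \<Longrightarrow> k \<le> 1"
    "unit_normal (frontier body) (x, M / 8) n \<Longrightarrow> scatters_to body x (0, 1)" "(x, M / 8) \<in> frontier body"
proof -
  have "compact (\<Union>pieces)" by (intro compact_Union finite_prisms is_prismD(1) prisms)
  then have "compact (fst ` \<Union>pieces)" by (intro compact_continuous_image continuous_intros)
  then have "open (- (fst ` \<Union>pieces))" by (simp add: compact_imp_closed open_Compl)
  then obtain r where r: "r > 0" "cball x r \<subseteq> - (fst ` \<Union>pieces)"
    using x(2) open_contains_cball by blast
  define C where "C = closure \<Omega> \<inter> cball x r"
  have mem: "(y, z) \<in> body \<longleftrightarrow> 0 \<le> z \<and> z \<le> M / 8" if "y \<in> C" for y z
  proof -
    have "y \<in> cball x r" using that by (simp add: C_def)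
    then have "y \<notin> fst ` \<Union>pieces" using r(2) by blast
    then have "(y, z) \<notin> \<Union>pieces" by (metis fst_conv image_eqI)
    then show ?thesis using that unfolding body_def C_def by auto
  qed
  have xC: "x \<in> C" using x(1) r(1) by (simp add: C_def)
  have cC: "convex C" unfolding C_def using convex by (intro convex_Int convex_closure convex_cball)
  have "open (\<Omega> \<inter> ball x r)" using op by blast
  moreover have "\<Omega> \<inter> ball x r \<subseteq> C" using closure_subset by (auto simp: C_def)
  moreover have "\<Omega> \<inter> ball x r \<noteq> {}"
  proof -
    obtain y where "y \<in> \<Omega>" "dist y x < r" using x(1) r(1) unfolding closure_approachable by blast
    then have "y \<in> \<Omega> \<inter> ball x r" by (simp add: dist_commute)
    then show ?thesis by blast
  qed
  ultimately have iC: "interior C \<noteq> {}" using interior_maximal by blast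
  have in1: "(y, M / 8) \<in> body" and out: "\<And>z. M / 8 < z \<Longrightarrow> (y, z) \<notin> body" if "y \<in> C" for y
    using mem[OF that] M by simp_all
  have fr: "(y, M / 8) \<in> frontier body" if "y \<in> C" for y
    by (rule frontier_top[OF in1[OF that] out[OF that]])
  note C = cC xC iC fr
  show "after_reflections body x k p w \<Longrightarrow> k \<le> 1" by (rule flat_top(1)[OF closed_body in1[OF xC] out[OF xC] C])
  show "unit_normal (frontier body) (x, M / 8) n \<Longrightarrow> scatters_to body x (0, 1)" by (rule flat_top(2)[OF closed_body in1[OF xC] out[OF xC] C])
  show "(x, M / 8) \<in> frontier body" by (rule fr[OF xC])
qed

definition slat_base where "slat_base j i = {x :: real^2. inner j x \<and> a j i \<le> x $ 1 \<and> x $ 1 \<le> a j i + l j}"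

text \<open>Walls and mirrors have flat tops at height \<open>M\<close>, and the parts of slats
  inside a wall are hidden by its top. So three kinds of surface are seen from above.\<close>

lemma base_cases:
  assumes "x \<in> closure \<Omega>"
  obtains (floor) "x \<notin> fst ` \<Union>pieces"
  | (high) a' b' c' d' where "a' < b'" "c' < d'" "x \<in> rect a' b' c' d'" "\<And>y. y \<in> rect a' b' c' d' \<Longrightarrow> (y, M) \<in> body"
  | (slat) j i where "j \<in> J" "i \<in> I j" "x \<in> slat_base j i"
proof (cases "x \<in> fst ` \<Union>pieces")
  case False
  then show ?thesis by (rule floor)
next
  case True
  then obtain P z where P: "P \<in> pieces" "(x, z) \<in> P" by force
  have W1: thesis if j: "j \<in> J" "\<alpha> j \<le> x $ 1" "x $ 1 \<le> \<beta> j" "c j \<le> x $ 2" "x $ 2 \<le> c j + \<theta> j" for j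
  proof (rule high[of "\<alpha> j" "\<beta> j" "c j" "c j + \<theta> j"])
    show "\<alpha> j < \<beta> j" "c j < c j + \<theta> j" using prof_basic(4,5)[OF j(1)] \<theta>[OF j(1)] by simp_all
    show "x \<in> rect (\<alpha> j) (\<beta> j) (c j) (c j + \<theta> j)" using j by (simp add: rect_def)
    fix y assume "y \<in> rect (\<alpha> j) (\<beta> j) (c j) (c j + \<theta> j)"
    then have "(y, M) \<in> wall1 j" using M by (simp add: mem_wall1 rect_def)
    then show "(y, M) \<in> body" using j(1) unfolding mem_body by blast
  qed
  have W2: thesis if j: "j \<in> J" "\<alpha> j \<le> x $ 1" "x $ 1 \<le> \<beta> j" "d j - \<theta> j \<le> x $ 2" "x $ 2 \<le> d j" for j
  proof (rule high[of "\<alpha> j" "\<beta> j" "d j - \<theta> j" "d j"])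
    show "\<alpha> j < \<beta> j" "d j - \<theta> j < d j" using prof_basic(4,5)[OF j(1)] \<theta>[OF j(1)] by simp_all
    show "x \<in> rect (\<alpha> j) (\<beta> j) (d j - \<theta> j) (d j)" using j by (simp add: rect_def)
    fix y assume "y \<in> rect (\<alpha> j) (\<beta> j) (d j - \<theta> j) (d j)"
    then have "(y, M) \<in> wall2 j" using M by (simp add: mem_wall2 rect_def)
    then show "(y, M) \<in> body" using j(1) unfolding mem_body by blast
  qed
  from P(1) show ?thesis
  proof (cases rule: piece_cases)
    case (1 j)
    then show ?thesis using P(2) W1[OF 1(1)] by (simp add: mem_wall1)
  next
    case (2 j)
    then show ?thesis using P(2) W2[OF 2(1)] by (simp add: mem_wall2)
  next
    case (3 j)
    show ?thesis
    proof (rule high[of "g j" "\<beta> j" "c j" "d j"])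
      show "g j < \<beta> j" "c j < d j" using prof_basic(4,5)[OF 3(1)] \<theta>[OF 3(1)] by simp_all
      show "x \<in> rect (g j) (\<beta> j) (c j) (d j)" using 3 P(2) by (simp add: rect_def mem_mirror)
      fix y assume y: "y \<in> rect (g j) (\<beta> j) (c j) (d j)"
      then have "low j (y $ 1) < M" by (intro low_bounds(2)[OF 3(1)]) (simp_all add: rect_def)
      then have "(y, M) \<in> mirror j" using y by (simp add: mem_mirror rect_def)
      then show "(y, M) \<in> body" using 3(1) unfolding mem_body by blast
    qed
  next
    case (4 j i)
    have x: "a j i \<le> x $ 1" "x $ 1 \<le> a j i + l j" "c j \<le> x $ 2" "x $ 2 \<le> d j"
      using P(2) 4(3) by (simp_all add: mem_slat)
    then have x': "\<alpha> j \<le> x $ 1" "x $ 1 \<le> \<beta> j" using prof_slat(1,2)[OF 4(1,2)] prof_basic(5)[OF 4(1)] by linarith+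
    consider "x $ 2 \<le> c j + \<theta> j" | "d j - \<theta> j \<le> x $ 2" | "inner j x" unfolding inner_def by linarith
    then show ?thesis
    proof cases
      case 1 then show ?thesis by (rule W1[OF 4(1) x' x(3)])
    next
      case 2 then show ?thesis using W2[OF 4(1) x' _ x(4)] by blast
    next
      case 3 then show ?thesis using slat[OF 4(1,2)] x by (simp add: slat_base_def)
    qed
  qed
qed

end

section \<open>Particles falling on the slats\<close>

context device_array
begin

text \<open>Abscissa of the point where the path starting on a slat at \<open>x\<close> meets the mirror.\<close>

definition hit where
  "hit j i x = g j + (low j (g j) - flight j i x (g j)) / (tilt (s j i) + (1 - \<epsilon>))"

text \<open>Horizontal and vertical velocity after the second reflection.\<close>

definition out_x where
  "out_x j i = 2 * s j i / (1 + (s j i)\<^sup>2) * ((1 - (1 - \<epsilon>)\<^sup>2) - 2 * (1 - \<epsilon>) * tilt (s j i)) / (1 + (1 - \<epsilon>)\<^sup>2)"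
definition out_z where
  "out_z j i = - (2 * s j i / (1 + (s j i)\<^sup>2) * (2 * (1 - \<epsilon>) + tilt (s j i) * (1 - (1 - \<epsilon>)\<^sup>2)) / (1 + (1 - \<epsilon>)\<^sup>2))"

lemma tilt_bounds:
  assumes "j \<in> J" "i \<in> I j"
  shows "0 \<le> tilt (s j i)" "tilt (s j i) \<le> \<epsilon> / 4"
proof -
  have "0 < s j i" "s j i \<le> 1" by (rule prof_slat[OF assms])+
  moreover have "(s j i)\<^sup>2 \<le> 1" using calculation by (simp add: power_le_one)
  ultimately show "0 \<le> tilt (s j i)" by (simp add: tilt_def)
  show "tilt (s j i) \<le> \<epsilon> / 4" by (rule prof_slat(6)[OF assms])
qed

lemma flight_affine: "flight j i x y = flight j i x y' + tilt (s j i) * (y - y')"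
  by (simp add: ray_def algebra_simps)

text \<open>A difference of affine functions of \<open>y\<close> that vanishes at
  \<open>hit j i x\<close>. The factor is positive, so the flight is below the mirror edge before
  this point and above it afterwards.\<close>

lemma flight_minus_low:
  assumes "j \<in> J" "i \<in> I j"
  shows "flight j i x y - low j y = (y - hit j i x) * (tilt (s j i) + (1 - \<epsilon>))"
proof -
  define k where "k = tilt (s j i) + (1 - \<epsilon>)"
  have k: "k > 0" using tilt_bounds[OF assms] \<epsilon> by (simp add: k_def)
  have "(hit j i x - g j) * k = low j (g j) - flight j i x (g j)"
    using k by (simp add: hit_def k_def)
  moreover have "flight j i x y - low j y = (flight j i x (g j) - low j (g j)) + (y - g j) * k"
    unfolding flight_affine[of j i x y "g j"] by (simp add: low_def k_def algebra_simps)
  ultimately show ?thesis unfolding k_def[symmetric] by (simp add: algebra_simps)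
qed

lemma hit_range:
  assumes "j \<in> J" "i \<in> I j" "a j i \<le> x" "x \<le> a j i + l j"
  shows "g j < hit j i x" "hit j i x < \<beta> j" "x < hit j i x"
proof -
  have k: "tilt (s j i) + (1 - \<epsilon>) > 0" using tilt_bounds[OF assms(1,2)] \<epsilon> by simp
  have "(g j - hit j i x) * (tilt (s j i) + (1 - \<epsilon>)) < 0"
    using prof_ray(1)[OF assms] flight_minus_low[OF assms(1,2), of x "g j"] by simp
  then show g: "g j < hit j i x" using k by (simp add: mult_less_0_iff)
  have "(\<beta> j - hit j i x) * (tilt (s j i) + (1 - \<epsilon>)) > 0"
    using prof_ray(2)[OF assms] flight_minus_low[OF assms(1,2), of x "\<beta> j"] by (simp add: low_def)
  then show "hit j i x < \<beta> j" using k by (simp add: zero_less_mult_iff)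
  show "x < hit j i x" using g assms(4) prof_slat(2)[OF assms(1,2)] by simp
qed

text \<open>Moving the start to the right lowers the whole flight. Injectivity is what keeps
  preimages of finite sets of exceptional abscissas finite.\<close>

lemma inj_hit:
  assumes "j \<in> J" "i \<in> I j"
  shows "inj (hit j i)"
proof (rule injI)
  fix x y assume e: "hit j i x = hit j i y"
  have k: "tilt (s j i) + (1 - \<epsilon>) > 0" using tilt_bounds[OF assms] \<epsilon> by simp
  have "flight j i x (g j) = flight j i y (g j)" using e k by (simp add: hit_def)
  then have "(s j i + tilt (s j i)) * (x - y) = 0" by (simp add: ray_def algebra_simps)
  moreover have "s j i + tilt (s j i) > 0" using prof_slat(3)[OF assms] tilt_bounds[OF assms] by simp
  ultimately show "x = y" by simp
qed

lemma speed_eq: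
  assumes "0 < s'"
  shows "(1 - s'\<^sup>2) / (1 + s'\<^sup>2) = 2 * s' / (1 + s'\<^sup>2) * tilt s'"
proof -
  have "1 + s'\<^sup>2 > 0" by (simp add: add_pos_nonneg)
  then show ?thesis using assms by (simp add: tilt_def)
qed

text \<open>The left-hand side is the formula of \<open>graph_reflect\<close> for the slope
  \<open>- s'\<close>, and likewise in \<open>reflect_mirror\<close>. The new velocity has slope
  \<open>tilt s'\<close>.\<close>

lemma reflect_slat:
  assumes "0 < s'"
  shows "((0, -1) :: space3) - (2 / (1 + (- s' *\<^sub>R (axis 1 1 :: real^2)) \<bullet> (- s' *\<^sub>R (axis 1 1 :: real^2))) * (((0, -1) :: space3) \<bullet> (- (- s' *\<^sub>R (axis 1 1 :: real^2)), 1))) *\<^sub>R (- (- s' *\<^sub>R (axis 1 1 :: real^2)), 1)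
     = ((2 * s' / (1 + s'\<^sup>2)) *\<^sub>R (axis 1 1 :: real^2), 2 * s' / (1 + s'\<^sup>2) * tilt s') " (is "?L = ?R")
proof -
  have p: "1 + s'\<^sup>2 > 0" by (simp add: add_pos_nonneg)
  have aa: "(axis 1 1 :: real^2) \<bullet> (axis 1 1 :: real^2) = 1" by (simp add: inner_axis_axis)
  have q: "1 + (- s' *\<^sub>R axis 1 1) \<bullet> (- s' *\<^sub>R axis 1 1 :: real^2) = 1 + s'\<^sup>2" by (simp add: aa power2_eq_square)
  have wi: "((0, -1) :: space3) \<bullet> (- (- s' *\<^sub>R axis 1 1), 1) = -1" by (simp add: inner_prod_def)
  have "?L = ((2 * s' / (1 + s'\<^sup>2)) *\<^sub>R axis 1 1, -1 + 2 / (1 + s'\<^sup>2))"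
    unfolding wi q by (simp add: mult.commute)
  moreover have "-1 + 2 / (1 + s'\<^sup>2) = (1 - s'\<^sup>2) / (1 + s'\<^sup>2)" using p by (simp add: field_simps)
  ultimately show ?thesis using speed_eq[OF assms] by simp
qed

lemma reflect_mirror:
  fixes E t m :: real
  defines "w \<equiv> (E *\<^sub>R (axis 1 1 :: real^2), E * t) :: space3"
  shows "w - (2 / (1 + (- m *\<^sub>R (axis 1 1 :: real^2)) \<bullet> (- m *\<^sub>R (axis 1 1 :: real^2))) * (w \<bullet> (- (- m *\<^sub>R (axis 1 1 :: real^2)), 1))) *\<^sub>R (- (- m *\<^sub>R (axis 1 1 :: real^2)), 1)
     = ((E * ((1 - m\<^sup>2) - 2 * m * t) / (1 + m\<^sup>2)) *\<^sub>R (axis 1 1 :: real^2), - (E * (2 * m + t * (1 - m\<^sup>2)) / (1 + m\<^sup>2)))" (is "?L = ?R")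
proof -
  have p: "1 + m\<^sup>2 > 0" by (simp add: add_pos_nonneg)
  have aa: "(axis 1 1 :: real^2) \<bullet> (axis 1 1 :: real^2) = 1" by (simp add: inner_axis_axis)
  have wi: "w \<bullet> (- (- m *\<^sub>R (axis 1 1 :: real^2)), 1) = E * (m + t)"
    by (simp add: w_def aa algebra_simps)
  have q: "1 + (- m *\<^sub>R (axis 1 1 :: real^2)) \<bullet> (- m *\<^sub>R (axis 1 1 :: real^2)) = 1 + m\<^sup>2" by (simp add: aa power2_eq_square)
  have "?L = ((E - 2 / (1 + m\<^sup>2) * (E * (m + t)) * m) *\<^sub>R (axis 1 1 :: real^2), E * t - 2 / (1 + m\<^sup>2) * (E * (m + t)))"
    unfolding wi q by (simp add: w_def scaleR_left_diff_distrib)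
  moreover have "E - 2 / (1 + m\<^sup>2) * (E * (m + t)) * m = E * ((1 - m\<^sup>2) - 2 * m * t) / (1 + m\<^sup>2)"
    using p by (simp add: field_simps power2_eq_square)
  moreover have "E * t - 2 / (1 + m\<^sup>2) * (E * (m + t)) = - (E * (2 * m + t * (1 - m\<^sup>2)) / (1 + m\<^sup>2))"
    using p by (simp add: field_simps power2_eq_square)
  ultimately show ?thesis by simp
qed

text \<open>What the claims are for: the particle drifts to the right, away from the slats; it falls
  more steeply than the mirror edge; it falls by at most \<open>6 / \<epsilon>\<close> times its
  drift, so it leaves the cylinder in time; and the integrand of the resistance is at most
  \<open>\<epsilon>\<close>.\<close>

lemma out_bounds:
  assumes "j \<in> J" "i \<in> I j"
  shows "0 < out_x j i" "out_z j i < - (1 - \<epsilon>) * out_x j i" "- out_z j i * \<epsilon> \<le> 6 * out_x j i" "1 + out_z j i \<le> 2 * \<epsilon>"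
    "out_z j i < 0"
proof -
  define m where "m = 1 - \<epsilon>"
  define t where "t = tilt (s j i)"
  define E where "E = 2 * s j i / (1 + (s j i)\<^sup>2)"
  have s: "0 < s j i" "s j i \<le> 1" "1 - s j i \<le> \<epsilon> / 4" by (rule prof_slat[OF assms])+
  have sp: "1 + (s j i)\<^sup>2 > 0" by (simp add: add_pos_nonneg)
  have E0: "0 < E" using s sp by (simp add: E_def)
  have t: "0 \<le> t" "t \<le> \<epsilon> / 4" using tilt_bounds[OF assms] by (simp_all add: t_def)
  have m: "15/16 \<le> m" "m < 1" using \<epsilon> by (simp_all add: m_def)
  have lp: "1 + m\<^sup>2 > 0" by (simp add: add_pos_nonneg)
  have l2: "1 - m\<^sup>2 = \<epsilon> * (2 - \<epsilon>)" by (simp add: m_def power2_eq_square algebra_simps)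
  have l2b: "31/16 * \<epsilon> \<le> 1 - m\<^sup>2" unfolding l2 using \<epsilon> mult_left_mono[of "31/16" "2 - \<epsilon>" \<epsilon>] by (simp add: mult.commute)
  have l2c: "1 - m\<^sup>2 \<le> 1" by simp
  have lt: "0 \<le> m * t" "m * t \<le> \<epsilon> / 4" using mult_mono[of m 1 t "\<epsilon> / 4"] m t \<epsilon> by auto
  have tl: "0 \<le> t * (1 - m\<^sup>2)" "t * (1 - m\<^sup>2) \<le> \<epsilon> / 4" using mult_mono[of t "\<epsilon> / 4" "1 - m\<^sup>2" 1] l2b l2c t \<epsilon> by auto
  define F where "F = E / (1 + m\<^sup>2)"
  have F0: "0 < F" using E0 lp by (simp add: F_def)
  have ox: "out_x j i = F * ((1 - m\<^sup>2) - 2 * (m * t))"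
    by (simp add: out_x_def F_def E_def m_def t_def)
  have oz: "out_z j i = - (F * (2 * m + t * (1 - m\<^sup>2)))"
    by (simp add: out_z_def F_def E_def m_def t_def)
  \<comment> \<open>\<open>1 - m\<^sup>2\<close> is nearly \<open>2 * \<epsilon>\<close>, while the
    tilt of the flight takes away at most \<open>\<epsilon> / 2\<close>; so the drift stays
    positive.\<close>
  have num: "23/16 * \<epsilon> \<le> (1 - m\<^sup>2) - 2 * (m * t)" using l2b lt by linarith
  then have "0 < (1 - m\<^sup>2) - 2 * (m * t)" using \<epsilon> by linarith
  then show ox0: "0 < out_x j i" unfolding ox using F0 by simp
  have "0 < 2 * m + t * (1 - m\<^sup>2)" using m tl by linarith
  then show "out_z j i < 0" unfolding oz using F0 by simp
  \<comment> \<open>The reflection reverses the velocity component along the normal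
    \<open>(m, 1)\<close> of the mirror, which before was a multiple of
    \<open>m + t\<close>.\<close>
  have "out_z j i + m * out_x j i = - (F * ((1 + m\<^sup>2) * (m + t)))"
    unfolding ox oz by (simp add: power2_eq_square algebra_simps)
  moreover have "0 < F * ((1 + m\<^sup>2) * (m + t))" using F0 lp m t by (intro mult_pos_pos) auto
  ultimately show "out_z j i < - (1 - \<epsilon>) * out_x j i" unfolding m_def[symmetric] by simp
  have "(2 * m + t * (1 - m\<^sup>2)) * \<epsilon> \<le> 3 * \<epsilon>" using m tl \<epsilon> by (intro mult_right_mono) auto
  also have "3 * \<epsilon> \<le> 6 * (23/16 * \<epsilon>)" using \<epsilon> by simp
  also have "\<dots> \<le> 6 * ((1 - m\<^sup>2) - 2 * (m * t))" using num by (rule mult_left_mono) simp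
  finally have "(2 * m + t * (1 - m\<^sup>2)) * \<epsilon> \<le> 6 * ((1 - m\<^sup>2) - 2 * (m * t))" .
  then have "F * ((2 * m + t * (1 - m\<^sup>2)) * \<epsilon>) \<le> F * (6 * ((1 - m\<^sup>2) - 2 * (m * t)))"
    using F0 by (intro mult_left_mono) auto
  then show "- out_z j i * \<epsilon> \<le> 6 * out_x j i" unfolding ox oz by (simp add: algebra_simps)
  \<comment> \<open>\<open>E\<close> and \<open>2 * m / (1 + m\<^sup>2)\<close> have the same form,
    and the difference from \<open>1\<close> is quadratic in \<open>1 - s j i\<close> and in
    \<open>1 - m\<close>.\<close>
  have E1: "1 - \<epsilon> / 4 \<le> E"
  proof -
    have "1 - E = (1 - s j i)\<^sup>2 / (1 + (s j i)\<^sup>2)" using sp by (simp add: E_def field_simps power2_eq_square)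
    also have "\<dots> \<le> (1 - s j i)\<^sup>2 / 1" using sp by (intro divide_left_mono) auto
    also have "\<dots> \<le> (1 - s j i) * 1" using s by (simp add: power2_eq_square mult_left_le)
    finally show ?thesis using s by simp
  qed
  have L1: "1 - \<epsilon> \<le> 2 * m / (1 + m\<^sup>2)"
  proof -
    have "1 - 2 * m / (1 + m\<^sup>2) = (1 - m)\<^sup>2 / (1 + m\<^sup>2)" using lp by (simp add: field_simps power2_eq_square)
    also have "\<dots> \<le> (1 - m)\<^sup>2 / 1" using lp by (intro divide_left_mono) auto
    also have "\<dots> \<le> (1 - m) * 1" using m by (simp add: power2_eq_square mult_left_le)
    finally show ?thesis by (simp add: m_def)
  qed
  have "(1 - \<epsilon> / 4) * (1 - \<epsilon>) \<le> E * (2 * m / (1 + m\<^sup>2))" using E1 L1 E0 \<epsilon> by (intro mult_mono) auto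
  moreover have "(1 - \<epsilon> / 4) * (1 - \<epsilon>) = 1 - 5/4 * \<epsilon> + \<epsilon> * \<epsilon> / 4" by (simp add: field_simps)
  moreover have "0 \<le> \<epsilon> * \<epsilon>" by simp
  ultimately have "1 - 2 * \<epsilon> \<le> E * (2 * m / (1 + m\<^sup>2))" using \<epsilon> by linarith
  also have "\<dots> = F * (2 * m)" by (simp add: F_def)
  also have "\<dots> \<le> F * (2 * m + t * (1 - m\<^sup>2))" using F0 tl by (intro mult_left_mono) auto
  finally show "1 + out_z j i \<le> 2 * \<epsilon>" unfolding oz by simp
qed

lemma inner_rect:
  assumes "inner j x"
  obtains c' d' where "c j + \<theta> j < c'" "c' < x $ 2" "x $ 2 < d'" "d' < d j - \<theta> j"
  using assms dense unfolding inner_def by meson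

lemma slat_upper:
  assumes "j \<in> J" "i \<in> I j" "y \<in> slat_base j i"
  shows "(y, upper j i (y $ 1)) \<in> body" "\<And>z. upper j i (y $ 1) < z \<Longrightarrow> (y, z) \<notin> body"
proof -
  have y: "inner j y" "a j i \<le> y $ 1" "y $ 1 \<le> a j i + l j" using assms(3) by (simp_all add: slat_base_def)
  have t: "0 < \<tau> j" "0 < \<theta> j" using prof_basic(3)[OF assms(1)] \<theta>[OF assms(1)] by simp_all
  have y2: "c j \<le> y $ 2" "y $ 2 \<le> d j" using y(1) t unfolding inner_def by linarith+
  have "(y, upper j i (y $ 1)) \<in> slat j i" using y y2 t by (simp add: mem_slat)
  then show "(y, upper j i (y $ 1)) \<in> body" unfolding mem_body using assms(1,2) by blast
  fix z assume z: "upper j i (y $ 1) < z"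
  have u: "M / 4 + \<tau> j < upper j i (y $ 1)" by (rule upper_bounds(1)[OF assms(1,2) y(2,3)])
  show "(y, z) \<notin> body" unfolding mem_body_inner[OF assms(1) y(1)]
  proof (intro notI, elim disjE conjE bexE)
    assume "z \<le> M / 8" then show False using u z t M by linarith
  next
    assume "(y, z) \<in> mirror j" then show False using y(3) prof_slat(2)[OF assms(1,2)] by (simp add: mem_mirror)
  next
    fix i' assume i': "i' \<in> I j" "(y, z) \<in> slat j i'"
    show False
    proof (cases "i' = i")
      case True then show False using i' z by (simp add: mem_slat)
    next
      case False
      then show False using prof_sep[OF assms(1,2) i'(1)] i'(2) y by (auto simp: mem_slat)
    qed
  qed
qed

lemma slat_in_Omega:
  assumes "j \<in> J" "i \<in> I j" "x \<in> slat_base j i"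
  shows "x \<in> \<Omega>"
proof -
  have "\<alpha> j \<le> a j i" "a j i + l j < g j" "g j < \<beta> j" "0 < \<theta> j"
    using prof_slat[OF assms(1,2)] prof_basic[OF assms(1)] \<theta>[OF assms(1)] by simp_all
  then have "x \<in> rect (\<alpha> j) (\<beta> j) (c j) (d j)" using assms(3) by (simp add: slat_base_def inner_def rect_def)
  then show ?thesis using base[OF assms(1)] by blast
qed

context
  fixes j i x
  assumes j: "j \<in> J" and i: "i \<in> I j" and x: "x \<in> slat_base j i"
begin

text \<open>The horizontal speed between the two reflections; \<open>w1\<close> is the velocity
  there, and \<open>w2\<close> the one after the second reflection.\<close>

definition E where "E = 2 * s j i / (1 + (s j i)\<^sup>2)"
definition w1 :: space3 where "w1 = (E *\<^sub>R axis 1 1, E * tilt (s j i))"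
definition w2 :: space3 where "w2 = (out_x j i *\<^sub>R axis 1 1, out_z j i)"
definition xm where "xm = hit j i (x $ 1)"

lemma x_facts: "inner j x" "a j i \<le> x $ 1" "x $ 1 \<le> a j i + l j" "c j \<le> x $ 2" "x $ 2 \<le> d j"
  using x \<theta>[OF j] by (auto simp: slat_base_def inner_def)

lemma E_pos: "E > 0"
  using prof_slat(3)[OF j i] by (simp add: E_def add_pos_nonneg)

lemma xm_range: "g j < xm" "xm < \<beta> j" "x $ 1 < xm"
  using hit_range[OF j i x_facts(2,3)] by (simp_all add: xm_def)

lemma first_normal:
  assumes "unit_normal (frontier body) (x, upper j i (x $ 1)) n"
  shows "reflect n (0, -1) = w1"
proof -
  obtain c' d' where cd: "c j + \<theta> j < c'" "c' < x $ 2" "x $ 2 < d'" "d' < d j - \<theta> j"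
    by (rule inner_rect[OF x_facts(1)])
  \<comment> \<open>In the second coordinate \<open>C\<close> stays strictly between the walls; in
    the first it is the full slat, so \<open>x\<close> may be at an end of the slat.\<close>
  define C where "C = rect (a j i) (a j i + l j) c' d'"
  have C: "convex C" "x \<in> C" "interior C \<noteq> {}"
    using convex_rect interior_rect_nonempty[of "a j i" "a j i + l j" c' d'] prof_basic(2)[OF j] x_facts cd
    by (simp_all add: C_def rect_def)
  have fr: "(y, upper j i (x $ 1) + (- s j i *\<^sub>R axis 1 1) \<bullet> (y - x)) \<in> frontier body" if "y \<in> C" for y
  proof -
    have yb: "y \<in> slat_base j i" using that cd by (simp add: C_def rect_def slat_base_def inner_def)
    have "upper j i (x $ 1) + (- s j i *\<^sub>R axis 1 1) \<bullet> (y - x) = upper j i (y $ 1)"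
      by (simp add: upper_def inner_axis' algebra_simps)
    then show ?thesis using frontier_top[OF slat_upper[OF j i yb]] by simp
  qed
  show ?thesis unfolding w1_def E_def
    by (rule trans[OF graph_reflect[OF assms C fr] reflect_slat[OF prof_slat(3)[OF j i]]])
qed

definition z1 where "z1 = upper j i (x $ 1)"
definition t1 where "t1 = (xm - x $ 1) / E"

lemma t1_pos: "0 < t1"
  using xm_range E_pos by (simp add: t1_def)

lemma on_flight:
  shows "(x, z1) + t *\<^sub>R w1 = (x + (t * E) *\<^sub>R axis 1 1, flight j i (x $ 1) (x $ 1 + t * E))"
  by (simp add: w1_def z1_def upper_def ray_def)

lemma shifted: "inner j (x + r *\<^sub>R axis 1 1)" "(x + r *\<^sub>R axis 1 1) $ 1 = x $ 1 + r" "(x + r *\<^sub>R axis 1 1) $ 2 = x $ 2"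
  using x_facts(1) by (simp_all add: inner_def axis_def)

lemma flight_high: "x $ 1 \<le> y \<Longrightarrow> M / 4 < flight j i (x $ 1) y"
proof -
  assume y: "x $ 1 \<le> y"
  have "0 \<le> tilt (s j i) * (y - x $ 1)" using tilt_bounds(1)[OF j i] y by simp
  moreover have "M / 4 + \<tau> j < upper j i (x $ 1)" by (rule upper_bounds(1)[OF j i x_facts(2,3)])
  ultimately show ?thesis using prof_basic(3)[OF j] unfolding ray_def upper_def by linarith
qed

text \<open>The flight starts above \<open>M / 4\<close> and does not fall, so it stays clear of the
  floor; it is below the mirror edge until \<open>xm\<close>; and \<open>prof_free\<close> excludes
  a meeting with any slat.\<close>

lemma first_free:
  assumes "0 < t" "t < t1"
  shows "(x, z1) + t *\<^sub>R w1 \<notin> body"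
proof -
  define y where "y = x $ 1 + t * E"
  have y: "x $ 1 < y" "y < xm" using assms E_pos by (simp_all add: y_def t1_def field_simps)
  have hi: "M / 4 < flight j i (x $ 1) y" using flight_high y by simp
  show ?thesis unfolding on_flight mem_body_inner[OF j shifted(1)]
  proof (intro notI, elim disjE conjE bexE)
    assume "flight j i (x $ 1) (x $ 1 + t * E) \<le> M / 8"
    then show False using hi M unfolding y_def by linarith
  next
    assume "(x + (t * E) *\<^sub>R axis 1 1, flight j i (x $ 1) (x $ 1 + t * E)) \<in> mirror j"
    then have "low j y \<le> flight j i (x $ 1) y" unfolding mem_mirror shifted y_def by simp
    then have "0 \<le> (y - xm) * (tilt (s j i) + (1 - \<epsilon>))"
      using flight_minus_low[OF j i, of "x $ 1" y] by (simp add: xm_def)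
    moreover have "0 < tilt (s j i) + (1 - \<epsilon>)" using tilt_bounds(1)[OF j i] \<epsilon> by simp
    ultimately show False using y by (simp add: zero_le_mult_iff)
  next
    fix i' assume i': "i' \<in> I j" "(x + (t * E) *\<^sub>R axis 1 1, flight j i (x $ 1) (x $ 1 + t * E)) \<in> slat j i'"
    then have "a j i' \<le> y" "y \<le> a j i' + l j" "upper j i' y - \<tau> j \<le> flight j i (x $ 1) y" "flight j i (x $ 1) y \<le> upper j i' y"
      unfolding mem_slat shifted y_def by simp_all
    then show False using prof_free[OF j i x_facts(2,3) i'(1) _ _ y(1)] by force
  qed
qed

definition q where "q = x + (xm - x $ 1) *\<^sub>R axis 1 1"

lemma q_facts: "inner j q" "q $ 1 = xm" "q $ 2 = x $ 2"
  using shifted[of "xm - x $ 1"] by (simp_all add: q_def)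

lemma hit_point: "(x, z1) + t1 *\<^sub>R w1 = (q, low j xm)"
proof -
  have t: "t1 * E = xm - x $ 1" using E_pos by (simp add: t1_def)
  have "flight j i (x $ 1) xm = low j xm"
    using flight_minus_low[OF j i, of "x $ 1" xm] by (simp add: xm_def)
  then show ?thesis unfolding on_flight t q_def by simp
qed

lemma mirror_frontier:
  assumes "inner j y" "g j \<le> y $ 1" "y $ 1 \<le> \<beta> j"
  shows "(y, low j (y $ 1)) \<in> mirror j" "(y, low j (y $ 1)) \<in> frontier body"
proof -
  have lb: "M / 4 < low j (y $ 1)" "low j (y $ 1) < M" by (rule low_bounds[OF j assms(2,3)])+
  have "c j \<le> y $ 2" "y $ 2 \<le> d j" using assms(1) \<theta>[OF j] unfolding inner_def by linarith+
  then show m: "(y, low j (y $ 1)) \<in> mirror j" using assms lb by (simp add: mem_mirror)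
  show "(y, low j (y $ 1)) \<in> frontier body"
  proof (rule frontier_vertical)
    show "(y, low j (y $ 1)) \<in> body" unfolding mem_body using m j by blast
    fix e :: real assume e: "0 < e"
    \<comment> \<open>The bound \<open>M / 8\<close> keeps the point just below the mirror above the
      floor.\<close>
    define r where "r = min e (M / 8) / 2"
    have r: "0 < r" "r < e" "r < M / 8" using e M by (auto simp: r_def min_def)
    have "(y, low j (y $ 1) + - r) \<notin> body" unfolding mem_body_inner[OF j assms(1)]
    proof (intro notI, elim disjE conjE bexE)
      assume "low j (y $ 1) + - r \<le> M / 8" then show False using lb r by linarith
    next
      assume "(y, low j (y $ 1) + - r) \<in> mirror j" then show False using r by (simp add: mem_mirror)
    next
      fix i' assume i': "i' \<in> I j" "(y, low j (y $ 1) + - r) \<in> slat j i'"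
      then show False using prof_slat(2)[OF j i'(1)] assms(2) by (simp add: mem_slat)
    qed
    then show "\<exists>\<delta>. \<bar>\<delta>\<bar> < e \<and> (y, low j (y $ 1) + \<delta>) \<notin> body" using r by (intro exI[of _ "- r"]) simp
  qed
qed

lemma second_normal:
  assumes "unit_normal (frontier body) (q, low j xm) n"
  shows "reflect n w1 = w2"
proof -
  obtain c' d' where cd: "c j + \<theta> j < c'" "c' < x $ 2" "x $ 2 < d'" "d' < d j - \<theta> j"
    by (rule inner_rect[OF x_facts(1)])
  define C where "C = rect (g j) (\<beta> j) c' d'"
  have C: "convex C" "q \<in> C" "interior C \<noteq> {}"
    using convex_rect interior_rect_nonempty[of "g j" "\<beta> j" c' d'] prof_basic(5)[OF j] xm_range cd q_facts
    by (simp_all add: C_def rect_def)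
  have fr: "(y, low j xm + (- (1 - \<epsilon>) *\<^sub>R axis 1 1) \<bullet> (y - q)) \<in> frontier body" if "y \<in> C" for y
  proof -
    have yb: "inner j y" "g j \<le> y $ 1" "y $ 1 \<le> \<beta> j" using that cd by (simp_all add: C_def rect_def inner_def)
    have "(- (1 - \<epsilon>) *\<^sub>R axis 1 1) \<bullet> (y - q) = - (1 - \<epsilon>) * (y $ 1 - xm)"
      by (simp only: inner_scaleR_left inner_axis' q_facts(2) vector_minus_component) simp
    then have "low j xm + (- (1 - \<epsilon>) *\<^sub>R axis 1 1) \<bullet> (y - q) = low j (y $ 1)"
      by (simp add: low_def algebra_simps)
    then show ?thesis using mirror_frontier(2)[OF yb] by simp
  qed
  show ?thesis unfolding w1_def w2_def out_x_def out_z_def E_def[symmetric]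
    by (rule trans[OF graph_reflect[OF assms C fr] reflect_mirror])
qed

text \<open>As long as the particle is over \<open>closure \<Omega>\<close>, its drift
  \<open>r\<close> is at most the mirror length plus the margin of \<open>exit\<close>, together
  \<open>2 * \<epsilon> * M / 100\<close>. By \<open>out_bounds\<close> it has then fallen by at
  most \<open>12 * M / 100\<close>, less than the \<open>M / 8\<close> between mirror and
  floor.\<close>

lemma second_free:
  assumes "0 < t"
  shows "(q, low j xm) + t *\<^sub>R w2 \<notin> body"
proof -
  define A where "A = out_x j i"
  define Z where "Z = out_z j i"
  have AZ: "0 < A" "Z < - (1 - \<epsilon>) * A" "- Z * \<epsilon> \<le> 6 * A" "Z < 0"
    using out_bounds[OF j i] by (simp_all add: A_def Z_def)
  define r where "r = t * A"
  have r: "0 < r" using assms AZ by (simp add: r_def)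
  define y where "y = q + r *\<^sub>R axis 1 1"
  have y: "y $ 1 = xm + r" "y $ 2 = x $ 2" using q_facts by (simp_all add: y_def axis_def)
  have iy: "inner j y" using x_facts(1) y by (simp add: inner_def)
  have pt: "(q, low j xm) + t *\<^sub>R w2 = (y, low j xm + t * Z)" by (simp add: w2_def y_def r_def A_def Z_def)
  have lb: "M / 4 < low j xm" using low_bounds(1)[OF j] xm_range by simp
  show ?thesis unfolding pt mem_body_inner[OF j iy]
  proof (intro notI, elim disjE conjE bexE)
    assume cl: "y \<in> closure \<Omega>" and le: "low j xm + t * Z \<le> M / 8"
    have "y $ 1 \<le> \<beta> j + \<epsilon> * M / 100" using exit[OF j cl] x_facts(4,5) y(2) by simp
    then have rb: "r \<le> 2 * (\<epsilon> * M / 100)" using y(1) xm_range(1) prof_basic(6)[OF j] by linarith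
    have "t * (- Z * \<epsilon>) \<le> t * (6 * A)" using AZ(3) assms by (intro mult_left_mono) auto
    also have "\<dots> = 6 * r" by (simp add: r_def)
    also have "\<dots> \<le> \<epsilon> * (12 * M / 100)" using rb by simp
    finally have "\<epsilon> * (- (t * Z)) \<le> \<epsilon> * (12 * M / 100)" by (simp add: mult_ac)
    then have "- (t * Z) \<le> 12 * M / 100" using \<epsilon>(1) by (rule mult_left_le_imp_le)
    then show False using le lb M by linarith
  next
    assume "(y, low j xm + t * Z) \<in> mirror j"
    then have "low j (xm + r) \<le> low j xm + t * Z" by (simp add: mem_mirror y)
    then have "- ((1 - \<epsilon>) * r) \<le> t * Z" by (simp add: low_def algebra_simps)
    moreover have "t * Z < t * (- (1 - \<epsilon>) * A)" using AZ(2) assms by (rule mult_strict_left_mono)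
    moreover have "t * (- (1 - \<epsilon>) * A) = - ((1 - \<epsilon>) * r)" by (simp add: r_def algebra_simps)
    ultimately show False by linarith
  next
    fix i' assume i': "i' \<in> I j" "(y, low j xm + t * Z) \<in> slat j i'"
    then show False using prof_slat(2)[OF j i'(1)] xm_range(1) r y by (simp add: mem_slat)
  qed
qed

lemma slat_reflections:
  shows "after_reflections body x k p w \<Longrightarrow> k \<le> 2"
    "unit_normal (frontier body) (x, upper j i (x $ 1)) n \<Longrightarrow> unit_normal (frontier body) (q, low j xm) m \<Longrightarrow>
       scatters_to body x (out_x j i *\<^sub>R axis 1 1, out_z j i)"
    "(x, upper j i (x $ 1)) \<in> frontier body" "(q, low j xm) \<in> frontier body"
proof -
  have A: "(x, z1) \<in> body" and B: "\<And>z. z1 < z \<Longrightarrow> (x, z) \<notin> body"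
    using slat_upper[OF j i x] by (simp_all add: z1_def)
  have C: "\<And>n. unit_normal (frontier body) (x, z1) n \<Longrightarrow> reflect n (0, -1) = w1"
    unfolding z1_def by (rule first_normal)
  have fr: "(q, low j xm) \<in> frontier body"
    using mirror_frontier(2)[OF q_facts(1)] xm_range by (simp add: q_facts)
  have "(q, low j xm) \<in> body" using fr frontier_subset_closed[OF closed_body] by blast
  then have D: "(x, z1) + t1 *\<^sub>R w1 \<in> body" by (simp only: hit_point)
  have F: "\<And>n. unit_normal (frontier body) ((x, z1) + t1 *\<^sub>R w1) n \<Longrightarrow> reflect n w1 = w2"
    unfolding hit_point by (rule second_normal)
  have G: "\<And>t. 0 < t \<Longrightarrow> (x, z1) + t1 *\<^sub>R w1 + t *\<^sub>R w2 \<notin> body" unfolding hit_point by (rule second_free)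
  show "after_reflections body x k p w \<Longrightarrow> k \<le> 2"
    by (rule two_reflections(1)[OF closed_body A B C t1_pos D first_free F G])
  show "scatters_to body x (out_x j i *\<^sub>R axis 1 1, out_z j i)"
    if "unit_normal (frontier body) (x, upper j i (x $ 1)) n" "unit_normal (frontier body) (q, low j xm) m"
    using two_reflections(2)[OF closed_body A B C t1_pos D first_free F G, of n m] that
    unfolding hit_point by (simp add: z1_def w2_def)
  show "(x, upper j i (x $ 1)) \<in> frontier body" by (rule frontier_top[OF slat_upper[OF j i x]])
  show "(q, low j xm) \<in> frontier body" by (rule fr)
qed

lemma q_in_Omega: "q \<in> \<Omega>"
proof -
  have "q \<in> rect (\<alpha> j) (\<beta> j) (c j) (d j)"
    using q_facts xm_range x_facts prof_basic(4)[OF j] by (simp add: rect_def)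
  then show ?thesis using base[OF j] by blast
qed

end

end

section \<open>Scattering by an array\<close>

context device_array
begin

lemma floor_convex: "convex (closure \<Omega> \<times> {0..M / 8})"
  by (intro convex_Times convex_closure convex convex_closed_interval)

text \<open>Walls reach down to height \<open>0\<close> and so stand in the floor. Slats and mirrors
  extend over the whole range from \<open>c j\<close> to \<open>d j\<close>, so they run into the
  first wall.\<close>

lemma connected_body: "connected body"
proof (cases "\<Omega> = {}")
  case True
  \<comment> \<open>An empty \<Omega> contains no rectangle, so there are no devices and the body is
    empty.\<close>
  have "J = {}"
  proof (rule ccontr)
    assume "J \<noteq> {}"
    then obtain j where j: "j \<in> J" by blast
    have "vector [\<beta> j, d j] \<in> rect (\<alpha> j) (\<beta> j) (c j) (d j)"
      using prof_basic(4,5)[OF j] \<theta>[OF j] by (simp add: rect_def)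
    then show False using base[OF j] True by blast
  qed
  then have "body = {}" unfolding body_def unfolding pieces_def using True by simp
  then show ?thesis by simp
next
  case False
  define F where "F = closure \<Omega> \<times> {0..M / 8}"
  have cF: "connected F" unfolding F_def using floor_convex by (rule convex_connected)
  have neF: "F \<noteq> {}" using False M by (simp add: F_def)
  have conn: "connected P" if "P \<in> pieces" for P using is_prismD(3)[OF prisms[OF that]] by (rule convex_connected)
  have w1: "connected (F \<union> wall1 j)" if j: "j \<in> J" for j
  proof (rule connected_Un[OF cF])
    show "connected (wall1 j)" using j by (intro conn) (auto simp: pieces_def)
    have r: "vector [\<beta> j, c j] \<in> rect (\<alpha> j) (\<beta> j) (c j) (d j)"
      using prof_basic(4,5)[OF j] \<theta>[OF j] by (simp add: rect_def)
    then have "vector [\<beta> j, c j] \<in> closure \<Omega>" using base[OF j] closure_subset by blast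
    then have "(vector [\<beta> j, c j], 0) \<in> F" using M by (simp add: F_def)
    moreover have "(vector [\<beta> j, c j], 0) \<in> wall1 j"
      using prof_basic(4,5)[OF j] \<theta>[OF j] M by (simp add: mem_wall1)
    ultimately show "F \<inter> wall1 j \<noteq> {}" by blast
  qed
  have meet: "\<exists>j\<in>J. (F \<union> wall1 j) \<inter> P \<noteq> {} \<or> P = wall2 j" if P: "P \<in> pieces" for P
    using P
  proof (cases rule: piece_cases)
    case (1 j)
    have "(vector [\<beta> j, c j], 0) \<in> wall1 j"
      using prof_basic(4,5)[OF 1(1)] \<theta>[OF 1(1)] M by (simp add: mem_wall1)
    then show ?thesis using 1 by blast
  next
    case (2 j) then show ?thesis by blast
  next
    case (3 j)
    have "low j (\<beta> j) < M" by (rule low_bounds(2)[OF 3(1)]) (use prof_basic(5)[OF 3(1)] in simp_all)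
    then have "(vector [\<beta> j, c j], M) \<in> mirror j" "(vector [\<beta> j, c j], M) \<in> wall1 j"
      using prof_basic(4,5)[OF 3(1)] \<theta>[OF 3(1)] M by (simp_all add: mem_wall1 mem_mirror)
    then show ?thesis using 3 by blast
  next
    case (4 j i)
    note b = prof_basic[OF 4(1)] prof_slat[OF 4(1,2)] \<theta>[OF 4(1)]
    have ub: "M / 4 + \<tau> j < upper j i (a j i)" "upper j i (a j i) < M"
      by (rule upper_bounds[OF 4(1,2)]; use b in simp)+
    have "(vector [a j i, c j], upper j i (a j i)) \<in> slat j i" using b by (simp add: mem_slat)
    moreover have "(vector [a j i, c j], upper j i (a j i)) \<in> wall1 j" using b ub M by (simp add: mem_wall1)
    ultimately show ?thesis using 4 by blast
  qed
  have w2: "(F \<union> wall1 j) \<inter> wall2 j \<noteq> {}" if j: "j \<in> J" for j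
  proof -
    have r: "vector [\<beta> j, d j] \<in> rect (\<alpha> j) (\<beta> j) (c j) (d j)"
      using prof_basic(4,5)[OF j] \<theta>[OF j] by (simp add: rect_def)
    then have "vector [\<beta> j, d j] \<in> closure \<Omega>" using base[OF j] closure_subset by blast
    then have "(vector [\<beta> j, d j], 0) \<in> F" using M by (simp add: F_def)
    moreover have "(vector [\<beta> j, d j], 0) \<in> wall2 j"
      using prof_basic(4,5)[OF j] \<theta>[OF j] M by (simp add: mem_wall2)
    ultimately show ?thesis by blast
  qed
  have "\<exists>C. connected C \<and> F \<subseteq> C \<and> P \<subseteq> C \<and> C \<subseteq> body" if P: "P \<in> pieces" for P
  proof -
    obtain j where j: "j \<in> J" "(F \<union> wall1 j) \<inter> P \<noteq> {}" using meet[OF P] w2 by blast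
    have "wall1 j \<in> pieces" using j(1) by (auto simp: pieces_def)
    then have "F \<union> wall1 j \<union> P \<subseteq> body" using P unfolding body_def F_def by blast
    then show ?thesis using connected_Un[OF w1[OF j(1)] conn[OF P] j(2)]
      by (intro exI[of _ "F \<union> wall1 j \<union> P"]) blast
  qed
  then obtain CC where CC: "\<And>P. P \<in> pieces \<Longrightarrow> connected (CC P) \<and> F \<subseteq> CC P \<and> P \<subseteq> CC P \<and> CC P \<subseteq> body" by metis
  have "body = \<Union>(insert F (CC ` pieces))"
    using CC unfolding body_def F_def[symmetric] by blast
  moreover have "connected (\<Union>(insert F (CC ` pieces)))"
  proof (rule connected_Union)
    show "connected s" if "s \<in> insert F (CC ` pieces)" for s using that CC cF by blast
    have "F \<subseteq> \<Inter>(insert F (CC ` pieces))" using CC by blast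
    then show "\<Inter>(insert F (CC ` pieces)) \<noteq> {}" using neF by blast
  qed
  ultimately show ?thesis by simp
qed

lemma double_impact_body: "double_impact body"
  unfolding double_impact_def
proof (intro allI impI)
  fix x k p w assume A: "after_reflections body x k p w"
  show "k \<le> 2"
  proof (cases "x \<in> closure \<Omega>")
    case False
    then have "\<And>z. (x, z) \<notin> body" using body_in_closure by blast
    then show ?thesis using no_body_over(1)[OF closed_body _ A] by simp
  next
    case True
    then show ?thesis
    proof (cases rule: base_cases)
      case floor
      then show ?thesis using flat_top_floor(1)[OF True _ A] by simp
    next
      case (high a' b' c' d')
      then show ?thesis using flat_top_M(1)[OF high A] by simp
    next
      case (slat j i)
      then show ?thesis by (rule slat_reflections(1)[OF _ _ _ A])
    qed
  qed
qed

lemma slat_base_disjoint: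
  assumes "j \<in> J" "i \<in> I j" "x \<in> slat_base j i" "k \<in> J" "i' \<in> I k" "x \<in> slat_base k i'"
  shows "k = j \<and> i' = i"
proof -
  have "k = j"
  proof (rule ccontr)
    assume "k \<noteq> j"
    then have "d k \<le> c j \<or> d j \<le> c k" using strips[OF assms(4,1)] by simp
    then show False using assms(3,6) \<theta>[OF assms(1)] \<theta>[OF assms(4)] unfolding slat_base_def inner_def by auto
  qed
  moreover have "i' = i"
  proof (rule ccontr)
    assume ne: "i' \<noteq> i"
    have "i' \<in> I j" using assms(5) \<open>k = j\<close> by simp
    then have "a j i + l j < a j i' \<or> a j i' + l j < a j i" using prof_sep[OF assms(1,2)] ne by blast
    then show False using assms(3,6) unfolding \<open>k = j\<close> slat_base_def by auto
  qed
  ultimately show ?thesis by simp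
qed

definition good where "good = (\<Union>j\<in>J. \<Union>i\<in>I j. slat_base j i)"

definition out where "out j i = (out_x j i *\<^sub>R axis 1 1, out_z j i)" for j i

text \<open>Both reflection points have to avoid finitely many values of each coordinate. The second
  coordinate is the same at both points, and the condition on the second abscissa is pulled back by
  the injective \<open>hit j i\<close>. So only \<open>frontier \<Omega>\<close> and finitely many
  lines are excluded.\<close>

lemma generic_scattering:
  obtains N where "negligible N"
    "\<And>x. x \<notin> N \<Longrightarrow> x \<notin> \<Omega> \<Longrightarrow> scatters_to body x (0, -1)"
    "\<And>x. x \<notin> N \<Longrightarrow> x \<in> \<Omega> \<Longrightarrow> x \<notin> good \<Longrightarrow> scatters_to body x (0, 1)"
    "\<And>x j i. x \<notin> N \<Longrightarrow> j \<in> J \<Longrightarrow> i \<in> I j \<Longrightarrow> x \<in> slat_base j i \<Longrightarrow> scatters_to body x (out j i)"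
proof -
  obtain F1 F2 :: "real set" where F: "finite F1" "finite F2"
    "\<And>x z. (x, z) \<in> frontier body \<Longrightarrow> x \<in> \<Omega> \<Longrightarrow> x $ 1 \<notin> F1 \<Longrightarrow> x $ 2 \<notin> F2 \<Longrightarrow> \<exists>n. unit_normal (frontier body) (x, z) n"
    using generic_unit_normal by metis
  define F1' where "F1' = F1 \<union> (\<Union>j\<in>J. \<Union>i\<in>I j. hit j i -` F1)"
  have F1': "finite F1'" unfolding F1'_def
    using finJ prof_basic(1) F(1) inj_hit by (intro finite_UnI finite_UN_I finite_vimageI) auto
  define N where "N = frontier \<Omega> \<union> (\<Union>r\<in>F1'. {x :: real^2. x $ 1 = r}) \<union> (\<Union>r\<in>F2. {x :: real^2. x $ 2 = r})"
  show ?thesis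
  proof
    have "negligible {x :: real^2. x $ k = r}" for k r
      using negligible_hyperplane[of "axis k 1 :: real^2" r] by (simp add: inner_axis' axis_eq_0_iff)
    then show "negligible N" unfolding N_def
      using negligible_convex_frontier[OF convex] F1' F(2) by (intro negligible_Un negligible_Union) auto
    fix x assume xN: "x \<notin> N"
    have x1: "x $ 1 \<notin> F1'" and x2: "x $ 2 \<notin> F2" using xN by (auto simp: N_def)
    have xF1: "x $ 1 \<notin> F1" using x1 by (simp add: F1'_def)
    show "scatters_to body x (0, -1)" if "x \<notin> \<Omega>"
    proof (rule no_body_over(2)[OF closed_body])
      have "x \<notin> closure \<Omega>" using that xN op by (auto simp: N_def frontier_def interior_open)
      then show "(x, z) \<notin> body" for z using body_in_closure by blast
    qed
    show "scatters_to body x (0, 1)" if x: "x \<in> \<Omega>" "x \<notin> good"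
    proof -
      have xc: "x \<in> closure \<Omega>" using x(1) closure_subset by blast
      then show ?thesis
      proof (cases rule: base_cases)
        case floor
        have "(x, M / 8) \<in> frontier body" by (rule flat_top_floor(3)[OF xc floor])
        then obtain n where "unit_normal (frontier body) (x, M / 8) n" using F(3) x(1) xF1 x2 by blast
        then show ?thesis by (rule flat_top_floor(2)[OF xc floor])
      next
        case (high a' b' c' d')
        have "(x, M) \<in> frontier body" by (rule flat_top_M(3)[OF high])
        then obtain n where n: "unit_normal (frontier body) (x, M) n" using F(3) x(1) xF1 x2 by blast
        show ?thesis by (rule flat_top_M(2)[OF high(1-3) _ n]) (rule high(4))
      next
        case (slat j i)
        then have "x \<in> good" unfolding good_def by blast
        then show ?thesis using x(2) by simp
      qed
    qed
    show "scatters_to body x (out j i)" if ji: "j \<in> J" "i \<in> I j" "x \<in> slat_base j i" for j i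
    proof -
      have xO: "x \<in> \<Omega>" by (rule slat_in_Omega[OF ji])
      obtain n where n: "unit_normal (frontier body) (x, upper j i (x $ 1)) n"
        using F(3)[OF slat_reflections(3)[OF ji] xO xF1 x2] by blast
      have q: "q j i x $ 1 = hit j i (x $ 1)" "q j i x $ 2 = x $ 2"
        using q_facts[OF ji] by (simp_all add: xm_def[OF ji])
      have "hit j i (x $ 1) \<notin> F1"
      proof
        assume "hit j i (x $ 1) \<in> F1"
        then have "x $ 1 \<in> F1'" unfolding F1'_def using ji by blast
        then show False using x1 by simp
      qed
      then obtain m where m: "unit_normal (frontier body) (q j i x, low j (xm j i x)) m"
        using F(3)[OF slat_reflections(4)[OF ji] q_in_Omega[OF ji]] q x2 by auto
      show ?thesis unfolding out_def by (rule slat_reflections(2)[OF ji n m])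
    qed
  qed
qed

end

section \<open>Resistance of an array\<close>

context device_array
begin

lemma slat_base_sets: "slat_base j i \<in> sets lebesgue"
proof -
  have "slat_base j i = ({x. c j + \<theta> j < x $ 2} \<inter> {x. x $ 2 < d j - \<theta> j}) \<inter> ({x. a j i \<le> x $ 1} \<inter> {x. x $ 1 \<le> a j i + l j})"
    by (auto simp: slat_base_def inner_def)
  also have "\<dots> \<in> sets borel"
    by (intro sets.Int borel_open borel_closed open_Collect_less closed_Collect_le continuous_intros)
  finally show ?thesis by (simp add: sets_completionI_sets)
qed

lemma good_sets: "good \<in> sets lebesgue"
  unfolding good_def using finJ prof_basic(1)
  by (intro sets.finite_UN slat_base_sets) auto

lemma Omega_sets: "\<Omega> \<in> sets lebesgue"
  using op by (simp add: sets_completionI_sets)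

lemma Omega_lmeasurable: "\<Omega> \<in> lmeasurable"
  using op bdd by (simp add: lmeasurable_open)

lemma good_subset: "good \<subseteq> \<Omega>"
  unfolding good_def using slat_in_Omega by blast

text \<open>Off a null set the final velocity takes finitely many values, each on a measurable set;
  completeness of Lebesgue measure takes care of the null set.\<close>

lemma regular_body: "regular_scattering body"
proof (rule generic_scattering)
  fix N
  assume N: "negligible N"
    "\<And>x. x \<notin> N \<Longrightarrow> x \<notin> \<Omega> \<Longrightarrow> scatters_to body x (0, -1)"
    "\<And>x. x \<notin> N \<Longrightarrow> x \<in> \<Omega> \<Longrightarrow> x \<notin> good \<Longrightarrow> scatters_to body x (0, 1)"
    "\<And>x j i. x \<notin> N \<Longrightarrow> j \<in> J \<Longrightarrow> i \<in> I j \<Longrightarrow> x \<in> slat_base j i \<Longrightarrow> scatters_to body x (out j i)"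
  define D where "D = {x. scattering_defined body x}"
  have def: "x \<in> D" if "x \<notin> N" for x
  proof -
    consider "x \<notin> \<Omega>" | "x \<in> \<Omega>" "x \<notin> good" | j i where "j \<in> J" "i \<in> I j" "x \<in> slat_base j i"
      unfolding good_def by blast
    then have "\<exists>w. scatters_to body x w"
    proof cases
      case 1 then show ?thesis by (intro exI) (rule N(2)[OF that])
    next
      case 2 then show ?thesis by (intro exI) (rule N(3)[OF that])
    next
      case (3 j i) then show ?thesis by (intro exI) (rule N(4)[OF that])
    qed
    then show ?thesis by (simp add: D_def scattering_defined_def)
  qed
  have nullN: "N \<in> null_sets lebesgue" using N(1) by (simp add: negligible_iff_null_sets)
  have sub_sets: "S \<in> sets lebesgue" if "S \<subseteq> N" for S
    using negligible_subset[OF N(1) that] by (rule negligible_imp_sets)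
  have AE: "AE x in lebesgue. scattering_defined body x"
  proof (rule AE_I'[OF nullN], rule subsetI, rule ccontr)
    fix x assume "x \<in> {x \<in> space lebesgue. \<not> scattering_defined body x}" "x \<notin> N"
    then show False using def[of x] by (simp add: D_def)
  qed
  have "- D \<in> sets lebesgue" using def by (intro sub_sets) blast
  then have "space lebesgue - (- D) \<in> sets lebesgue" by (rule sets.compl_sets)
  moreover have "space lebesgue - (- D) = D" by auto
  ultimately have Ds: "D \<in> sets lebesgue" by simp
  have fv1: "final_velocity body x = (0, -1)" if "x \<notin> N" "x \<notin> \<Omega>" for x
    by (rule final_velocity_eq[OF closed_body N(2)[OF that]])
  have fv2: "final_velocity body x = (0, 1)" if "x \<notin> N" "x \<in> \<Omega>" "x \<notin> good" for x
    by (rule final_velocity_eq[OF closed_body N(3)[OF that]])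
  have fv3: "final_velocity body x = out j i" if "x \<notin> N" "j \<in> J" "i \<in> I j" "x \<in> slat_base j i" for x j i
    by (rule final_velocity_eq[OF closed_body N(4)[OF that]])
  have "final_velocity body \<in> borel_measurable (lebesgue_on D)"
    unfolding borel_measurable_lebesgue_on_preimage_borel[OF Ds]
  proof (intro allI impI)
    fix T :: "space3 set" assume "T \<in> sets borel"
    \<comment> \<open>The points whose generic final velocity lies in \<open>T\<close>.\<close>
    define S where "S = (if (0, -1) \<in> T then - \<Omega> else {}) \<union> (if (0, 1) \<in> T then \<Omega> - good else {}) \<union>
      (\<Union>j\<in>J. \<Union>i\<in>I j. if out j i \<in> T then slat_base j i else {})"
    have "- \<Omega> \<in> sets lebesgue" using op by (simp add: sets_completionI_sets borel_closed closed_Compl)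
    moreover have "\<Omega> - good \<in> sets lebesgue" using Omega_sets good_sets by (rule sets.Diff)
    moreover have "(\<Union>j\<in>J. \<Union>i\<in>I j. if out j i \<in> T then slat_base j i else {}) \<in> sets lebesgue"
      using finJ prof_basic(1) slat_base_sets by (intro sets.finite_UN) auto
    ultimately have Ss: "S \<in> sets lebesgue" unfolding S_def by (intro sets.Un) auto
    have ifm: "x \<in> (if P then A else {}) \<longleftrightarrow> P \<and> x \<in> A" for x P and A :: "(real^2) set" by simp
    have memS: "x \<in> S \<longleftrightarrow> ((0, -1) \<in> T \<and> x \<in> - \<Omega> \<or> (0, 1) \<in> T \<and> x \<in> \<Omega> - good) \<or>
        (\<exists>j\<in>J. \<exists>i\<in>I j. out j i \<in> T \<and> x \<in> slat_base j i)" for x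
      by (simp only: S_def Un_iff UN_iff ifm)
    have S: "final_velocity body x \<in> T \<longleftrightarrow> x \<in> S" if x: "x \<notin> N" for x
    proof (cases "x \<in> good")
      case False
      then have "\<not> (\<exists>j\<in>J. \<exists>i\<in>I j. out j i \<in> T \<and> x \<in> slat_base j i)" unfolding good_def by blast
      then have m: "x \<in> S \<longleftrightarrow> ((0, -1) \<in> T \<and> x \<in> - \<Omega> \<or> (0, 1) \<in> T \<and> x \<in> \<Omega> - good)" unfolding memS by blast
      show ?thesis
      proof (cases "x \<in> \<Omega>")
        case True
        then show ?thesis unfolding m using False fv2[OF x True False] by simp
      next
        case False
        then show ?thesis unfolding m using fv1[OF x False] by simp
      qed
    next
      case True
      then obtain j i where ji: "j \<in> J" "i \<in> I j" "x \<in> slat_base j i" unfolding good_def by blast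
      have xO: "x \<in> \<Omega>" by (rule slat_in_Omega[OF ji])
      have "x \<in> S \<longleftrightarrow> out j i \<in> T"
      proof
        assume "x \<in> S"
        then obtain k i' where k: "k \<in> J" "i' \<in> I k" "x \<in> slat_base k i'" "out k i' \<in> T"
          unfolding memS using xO True by blast
        then show "out j i \<in> T" using slat_base_disjoint[OF ji k(1-3)] by simp
      next
        assume "out j i \<in> T"
        then show "x \<in> S" unfolding memS using ji by blast
      qed
      then show ?thesis using fv3[OF x ji] by simp
    qed
    have eq: "{x \<in> D. final_velocity body x \<in> T} = (S - N) \<union> ({x \<in> D. final_velocity body x \<in> T} \<inter> N)"
    proof (rule set_eqI)
      fix x
      show "x \<in> {x \<in> D. final_velocity body x \<in> T} \<longleftrightarrow> x \<in> (S - N) \<union> ({x \<in> D. final_velocity body x \<in> T} \<inter> N)"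
      proof (cases "x \<in> N")
        case False
        then show ?thesis using S[OF False] def[OF False] by simp
      qed simp
    qed
    have m1: "S - N \<in> sets lebesgue" using Ss sub_sets[of N] by (intro sets.Diff) auto
    have m2: "{x \<in> D. final_velocity body x \<in> T} \<inter> N \<in> sets lebesgue" by (rule sub_sets) blast
    show "{x \<in> D. final_velocity body x \<in> T} \<in> sets lebesgue"
      by (subst eq) (intro sets.Un m1 m2)
  qed
  then show "regular_scattering body" unfolding regular_scattering_def D_def using AE by simp
qed

lemma body_in_dic_bodies: "body \<in> dic_bodies \<Omega> M"
proof -
  have 1: "closure \<Omega> \<times> {0} \<subseteq> body" unfolding body_def using M by auto
  have 2: "body \<subseteq> closure \<Omega> \<times> {0..M}"
  proof
    fix p assume p: "p \<in> body"
    obtain x z where xz: "p = (x, z)" by fastforce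
    have "0 \<le> z"
    proof -
      have "p \<in> closure \<Omega> \<times> {0..M / 8} \<or> p \<in> \<Union>pieces" using p unfolding body_def by blast
      then show ?thesis
      proof
        assume "p \<in> \<Union>pieces"
        then have "p \<in> \<Omega> \<times> {0..M}" using prisms_subset by (rule rev_subsetD)
        then show ?thesis using xz by simp
      qed (use xz in simp)
    qed
    moreover have "x \<in> closure \<Omega>" "z \<le> M" using body_in_closure body_le_M p xz by simp_all
    ultimately show "p \<in> closure \<Omega> \<times> {0..M}" using xz by simp
  qed
  show ?thesis
    unfolding dic_bodies_def bodies_def
    by (intro CollectI conjI 1 2 body_regular piecewise_smooth_body regular_body connected_body double_impact_body)
qed

text \<open>Almost everywhere the integrand is at most \<open>\<epsilon>\<close> over the slats, by
  \<open>out_bounds\<close>, and equal to \<open>1\<close> on the rest of \<Omega>.\<close>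

lemma resistance_body:
  "resistance \<Omega> body \<le> measure lebesgue (\<Omega> - good) + \<epsilon> * measure lebesgue \<Omega>"
proof (rule generic_scattering)
  fix N
  assume N: "negligible N"
    "\<And>x. x \<notin> N \<Longrightarrow> x \<notin> \<Omega> \<Longrightarrow> scatters_to body x (0, -1)"
    "\<And>x. x \<notin> N \<Longrightarrow> x \<in> \<Omega> \<Longrightarrow> x \<notin> good \<Longrightarrow> scatters_to body x (0, 1)"
    "\<And>x j i. x \<notin> N \<Longrightarrow> j \<in> J \<Longrightarrow> i \<in> I j \<Longrightarrow> x \<in> slat_base j i \<Longrightarrow> scatters_to body x (out j i)"
  define G where "G x = indicat_real (\<Omega> - good) x + \<epsilon> * indicat_real \<Omega> x" for x
  have lm: "\<Omega> - good \<in> lmeasurable"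
    using Omega_lmeasurable good_sets by (rule fmeasurable_Diff)
  have int: "integrable lebesgue G" "integral\<^sup>L lebesgue G = measure lebesgue (\<Omega> - good) + \<epsilon> * measure lebesgue \<Omega>"
  proof -
    have i1: "integrable lebesgue (indicat_real (\<Omega> - good))" "integrable lebesgue (indicat_real \<Omega>)"
      using lm Omega_lmeasurable by (simp_all add: lmeasurable_iff_integrable)
    then show "integrable lebesgue G" unfolding G_def by (intro Bochner_Integration.integrable_add integrable_mult_right)
    show "integral\<^sup>L lebesgue G = measure lebesgue (\<Omega> - good) + \<epsilon> * measure lebesgue \<Omega>"
      unfolding G_def using i1 by (simp add: Bochner_Integration.integral_add)
  qed
  have "AE x in lebesgue. indicator \<Omega> x *\<^sub>R ((1 + snd (final_velocity body x)) / 2) \<le> G x"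
  proof (rule AE_I'[of N])
    show "N \<in> null_sets lebesgue" using N(1) by (simp add: negligible_iff_null_sets)
    have "indicator \<Omega> x *\<^sub>R ((1 + snd (final_velocity body x)) / 2) \<le> G x" if x: "x \<notin> N" for x
    proof -
      consider "x \<notin> \<Omega>" | "x \<in> \<Omega>" "x \<notin> good" | j i where "j \<in> J" "i \<in> I j" "x \<in> slat_base j i"
        unfolding good_def by blast
      then show ?thesis
      proof cases
        case 1 then show ?thesis by (simp add: G_def)
      next
        case 2
        then show ?thesis using final_velocity_eq[OF closed_body N(3)[OF x 2]] \<epsilon> by (simp add: G_def)
      next
        case (3 j i)
        have g: "x \<in> good" "x \<in> \<Omega>" using 3 slat_in_Omega unfolding good_def by blast+
        show ?thesis using final_velocity_eq[OF closed_body N(4)[OF x 3]] g out_bounds(4)[OF 3(1,2)]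
          by (simp add: G_def out_def)
      qed
    qed
    then show "{x \<in> space lebesgue. \<not> indicator \<Omega> x *\<^sub>R ((1 + snd (final_velocity body x)) / 2) \<le> G x} \<subseteq> N" by blast
  qed
  moreover have "AE x in lebesgue. 0 \<le> G x" using \<epsilon> by (simp add: G_def)
  ultimately have "(\<integral>x. indicator \<Omega> x *\<^sub>R ((1 + snd (final_velocity body x)) / 2) \<partial>lebesgue) \<le> integral\<^sup>L lebesgue G"
    by (intro integral_mono_AE' int(1))
  then show "resistance \<Omega> body \<le> measure lebesgue (\<Omega> - good) + \<epsilon> * measure lebesgue \<Omega>"
    unfolding resistance_def set_lebesgue_integral_def int(2) .
qed

text \<open>The slat bases are disjoint rectangles, up to boundary, of width \<open>l j\<close> and
  of the length left between the walls; the last clause of \<open>profile\<close> bounds the number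
  of slats from below.\<close>

lemma measure_good:
  "measure lebesgue good \<ge> (\<Sum>j\<in>J. (1 - \<epsilon>) * (\<beta> j - \<alpha> j) * (d j - c j - 2 * \<theta> j))"
proof -
  have sb: "l j * (d j - c j - 2 * \<theta> j) \<le> measure lebesgue (slat_base j i)" if ji: "j \<in> J" "i \<in> I j" for j i
  proof -
    define p :: "real^2" where "p = vector [a j i, c j + \<theta> j]"
    define r :: "real^2" where "r = vector [a j i + l j, d j - \<theta> j]"
    have pr: "p $ 1 = a j i" "p $ 2 = c j + \<theta> j" "r $ 1 = a j i + l j" "r $ 2 = d j - \<theta> j" by (simp_all add: p_def r_def)
    have sub: "box p r \<subseteq> slat_base j i"
      by (auto simp: mem_box_cart forall_2 pr slat_base_def inner_def)
    have sub': "slat_base j i \<subseteq> \<Omega>" using slat_in_Omega[OF ji] by blast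
    have lm: "slat_base j i \<in> lmeasurable" by (rule fmeasurableI2[OF Omega_lmeasurable sub' slat_base_sets])
    have ne: "cbox p r \<noteq> {}"
    proof -
      have "p \<in> cbox p r" using prof_basic(2)[OF ji(1)] \<theta>[OF ji(1)] by (simp add: mem_box_cart forall_2 pr)
      then show ?thesis by blast
    qed
    have "measure lebesgue (box p r) = measure lborel (cbox p r)" by (simp add: measure_lborel_box_eq measure_lborel_cbox_eq)
    also have "\<dots> = l j * (d j - c j - 2 * \<theta> j)"
      unfolding content_cbox_cart[OF ne] by (simp add: UNIV_2 pr)
    finally show ?thesis using measure_mono_fmeasurable[OF sub _ lm] by simp
  qed
  have lmj: "slat_base j i \<in> lmeasurable" if ji: "j \<in> J" "i \<in> I j" for j i
    using slat_in_Omega[OF ji] by (intro fmeasurableI2[OF Omega_lmeasurable _ slat_base_sets]) blast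
  define X where "X = Sigma J I"
  have finX: "finite X" unfolding X_def using finJ prof_basic(1) by simp
  have "good = (\<Union>p\<in>X. slat_base (fst p) (snd p))"
  proof (intro equalityI subsetI)
    fix x assume "x \<in> good"
    then obtain j i where "j \<in> J" "i \<in> I j" "x \<in> slat_base j i" unfolding good_def by blast
    then show "x \<in> (\<Union>p\<in>X. slat_base (fst p) (snd p))" by (intro UN_I[of "(j, i)"]) (simp_all add: X_def)
  next
    fix x assume "x \<in> (\<Union>p\<in>X. slat_base (fst p) (snd p))"
    then obtain p where p: "p \<in> X" "x \<in> slat_base (fst p) (snd p)" by blast
    then have "fst p \<in> J" "snd p \<in> I (fst p)" by (auto simp: X_def)
    then show "x \<in> good" unfolding good_def using p(2) by blast
  qed
  moreover have "measure lebesgue (\<Union>p\<in>X. slat_base (fst p) (snd p)) = (\<Sum>p\<in>X. measure lebesgue (slat_base (fst p) (snd p)))"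
  proof (rule measure_finite_Union)
    show "finite X" by (rule finX)
    show "(\<lambda>p. slat_base (fst p) (snd p)) ` X \<subseteq> sets lebesgue" using slat_base_sets by blast
    show "disjoint_family_on (\<lambda>p. slat_base (fst p) (snd p)) X" unfolding disjoint_family_on_def
    proof (intro ballI impI)
      fix p p' assume p: "p \<in> X" "p' \<in> X" "p \<noteq> p'"
      show "slat_base (fst p) (snd p) \<inter> slat_base (fst p') (snd p') = {}"
      proof (rule ccontr)
        assume "\<not> ?thesis"
        then obtain x where "x \<in> slat_base (fst p) (snd p)" "x \<in> slat_base (fst p') (snd p')" by blast
        then have "fst p' = fst p \<and> snd p' = snd p"
          using p(1,2) by (intro slat_base_disjoint) (auto simp: X_def)
        then show False using p(3) by (simp add: prod_eq_iff)
      qed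
    qed
    show "emeasure lebesgue (slat_base (fst p) (snd p)) \<noteq> \<infinity>" if "p \<in> X" for p
      using fmeasurableD2[OF lmj] that by (auto simp: X_def)
  qed
  moreover have "(\<Sum>p\<in>X. measure lebesgue (slat_base (fst p) (snd p))) = (\<Sum>j\<in>J. \<Sum>i\<in>I j. measure lebesgue (slat_base j i))"
    unfolding X_def using finJ prof_basic(1) by (subst sum.Sigma) (auto simp: case_prod_unfold)
  moreover have "(\<Sum>j\<in>J. (1 - \<epsilon>) * (\<beta> j - \<alpha> j) * (d j - c j - 2 * \<theta> j)) \<le> (\<Sum>j\<in>J. \<Sum>i\<in>I j. measure lebesgue (slat_base j i))"
  proof (rule sum_mono)
    fix j assume j: "j \<in> J"
    have "(1 - \<epsilon>) * (\<beta> j - \<alpha> j) * (d j - c j - 2 * \<theta> j) \<le> real (card (I j)) * l j * (d j - c j - 2 * \<theta> j)"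
      using prof_basic(9)[OF j] \<theta>[OF j] by (intro mult_right_mono) auto
    also have "\<dots> = (\<Sum>i\<in>I j. l j * (d j - c j - 2 * \<theta> j))" by simp
    also have "\<dots> \<le> (\<Sum>i\<in>I j. measure lebesgue (slat_base j i))" using sb[OF j] by (intro sum_mono)
    finally show "(1 - \<epsilon>) * (\<beta> j - \<alpha> j) * (d j - c j - 2 * \<theta> j) \<le> (\<Sum>i\<in>I j. measure lebesgue (slat_base j i))" .
  qed
  ultimately show ?thesis by simp
qed

end

text \<open>The losses of area are \<open>\<epsilon>\<close> from replacing \<Omega> by a compact
  \<open>K\<close>, a factor \<open>1 - \<epsilon>\<close> from the profiles and a factor
  \<open>1 - \<epsilon> / 2\<close> from the walls. A further \<open>\<epsilon>\<close> per unit
  area is contributed by the particles that do hit slats.\<close>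

lemma small_resistance:
  fixes \<Omega> :: "(real^2) set" and M \<epsilon> :: real
  assumes \<Omega>: "convex \<Omega>" "open \<Omega>" "bounded \<Omega>" and M: "0 < M" and \<epsilon>: "0 < \<epsilon>" "\<epsilon> \<le> 1/16"
  obtains B where "B \<in> dic_bodies \<Omega> M" "resistance \<Omega> B \<le> 3 * \<epsilon> * measure lebesgue \<Omega> + \<epsilon>"
proof -
  have \<Omega>l: "\<Omega> \<in> lmeasurable" using \<Omega> by (simp add: lmeasurable_open)
  obtain K where K: "closed K" "K \<subseteq> \<Omega>" "\<Omega> - K \<in> lmeasurable" "emeasure lebesgue (\<Omega> - K) < ennreal \<epsilon>"
    using sets_lebesgue_inner_closed[OF fmeasurableD[OF \<Omega>l] \<epsilon>(1)] by metis
  have cK: "compact K" using K(1,2) \<Omega>(3) bounded_subset compact_eq_bounded_closed by blast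
  have Kl: "K \<in> lmeasurable" using cK by (rule lmeasurable_compact)
  have "measure lebesgue (\<Omega> - K) \<le> \<epsilon>"
    using K(4) \<epsilon> emeasure_eq_measure2[OF K(3)] by (simp add: ennreal_less_iff)
  then have mK: "measure lebesgue \<Omega> - \<epsilon> \<le> measure lebesgue K"
    using measurable_measure_Diff[OF \<Omega>l fmeasurableD[OF Kl] K(2)] by simp
  have \<kappa>: "0 < \<epsilon> * M / 100" using \<epsilon> M by simp
  show ?thesis
  proof (rule rect_cover[OF \<Omega> cK K(2) \<kappa>])
    fix J :: "int set" and \<alpha> \<beta> c d
    assume J: "finite J"
      "\<And>j. j \<in> J \<Longrightarrow> \<alpha> j < \<beta> j \<and> c j < d j \<and> rect (\<alpha> j) (\<beta> j) (c j) (d j) \<subseteq> \<Omega>"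
      "\<And>j x. j \<in> J \<Longrightarrow> x \<in> closure \<Omega> \<Longrightarrow> c j \<le> x $ 2 \<Longrightarrow> x $ 2 \<le> d j \<Longrightarrow> x $ 1 \<le> \<beta> j + \<epsilon> * M / 100"
      "\<And>j k. j \<in> J \<Longrightarrow> k \<in> J \<Longrightarrow> j \<noteq> k \<Longrightarrow> d j \<le> c k \<or> d k \<le> c j"
      "K \<subseteq> (\<Union>j\<in>J. rect (\<alpha> j) (\<beta> j) (c j) (d j))"
    \<comment> \<open>The eight parameters are packed into one tuple, so that a single choice makes
      all of them functions of \<open>j\<close>.\<close>
    have "\<exists>p. case p of (I :: (nat \<times> nat) set, a, u, s, l, \<tau>, g, h) \<Rightarrow> profile (\<alpha> j) (\<beta> j) M \<epsilon> I a u s l \<tau> g h" if j: "j \<in> J" for j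
    proof -
      obtain I :: "(nat \<times> nat) set" and a u s l \<tau> g h where "profile (\<alpha> j) (\<beta> j) M \<epsilon> I a u s l \<tau> g h"
        using profile_exists[OF \<epsilon> M, of "\<alpha> j" "\<beta> j"] J(2)[OF j] by blast
      then show ?thesis by (intro exI[of _ "(I, a, u, s, l, \<tau>, g, h)"]) simp
    qed
    then obtain p where p: "\<And>j. j \<in> J \<Longrightarrow> case p j of (I :: (nat \<times> nat) set, a, u, s, l, \<tau>, g, h) \<Rightarrow> profile (\<alpha> j) (\<beta> j) M \<epsilon> I a u s l \<tau> g h"
      by metis
    define I where "I j = fst (p j)" for j
    define a where "a j = fst (snd (p j))" for j
    define u where "u j = fst (snd (snd (p j)))" for j
    define s where "s j = fst (snd (snd (snd (p j))))" for j
    define l where "l j = fst (snd (snd (snd (snd (p j)))))" for j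
    define \<tau> where "\<tau> j = fst (snd (snd (snd (snd (snd (p j))))))" for j
    define g where "g j = fst (snd (snd (snd (snd (snd (snd (p j)))))))" for j
    define h where "h j = snd (snd (snd (snd (snd (snd (snd (p j)))))))" for j
    have prof: "profile (\<alpha> j) (\<beta> j) M \<epsilon> (I j) (a j) (u j) (s j) (l j) (\<tau> j) (g j) (h j)" if "j \<in> J" for j
      using p[OF that] by (simp add: case_prod_unfold I_def a_def u_def s_def l_def \<tau>_def g_def h_def)
    \<comment> \<open>The two walls together occupy the portion \<open>\<epsilon> / 2\<close> of a
      strip.\<close>
    define \<theta> where "\<theta> j = \<epsilon> * (d j - c j) / 4" for j
    have \<theta>: "0 < \<theta> j \<and> 2 * \<theta> j < d j - c j" if "j \<in> J" for j
    proof -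
      have dc: "0 < d j - c j" using J(2)[OF that] by simp
      have b: "\<epsilon> * (d j - c j) \<le> 1/16 * (d j - c j)" using \<epsilon> dc by (intro mult_right_mono) auto
      have a: "0 < \<epsilon> * (d j - c j)" using \<epsilon>(1) dc by (rule mult_pos_pos)
      have "0 < \<theta> j" using a by (simp add: \<theta>_def)
      moreover have "2 * (X / 4) < Y" if "X \<le> 1/16 * Y" "0 < Y" for X Y :: real using that by linarith
      from this[OF b dc] have "2 * \<theta> j < d j - c j" unfolding \<theta>_def .
      ultimately show ?thesis ..
    qed
    interpret device_array \<Omega> M \<epsilon> J \<alpha> \<beta> c d \<theta> l \<tau> g h I a u s
    proof
      show "finite J" by (rule J(1))
      show "rect (\<alpha> j) (\<beta> j) (c j) (d j) \<subseteq> \<Omega>" if "j \<in> J" for j using J(2)[OF that] by blast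
      show "0 < \<theta> j \<and> 2 * \<theta> j < d j - c j" if "j \<in> J" for j by (rule \<theta>[OF that])
      show "profile (\<alpha> j) (\<beta> j) M \<epsilon> (I j) (a j) (u j) (s j) (l j) (\<tau> j) (g j) (h j)" if "j \<in> J" for j by (rule prof[OF that])
      show "x $ 1 \<le> \<beta> j + \<epsilon> * M / 100" if "j \<in> J" "x \<in> closure \<Omega>" "c j \<le> x $ 2" "x $ 2 \<le> d j" for j x by (rule J(3)[OF that])
      show "d j \<le> c k \<or> d k \<le> c j" if "j \<in> J" "k \<in> J" "j \<noteq> k" for j k by (rule J(4)[OF that])
    qed (rule \<Omega> \<epsilon> M)+
    have area: "measure lebesgue (rect (\<alpha> j) (\<beta> j) (c j) (d j)) = (\<beta> j - \<alpha> j) * (d j - c j)" if j: "j \<in> J" for j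
    proof -
      have "vector [\<alpha> j, c j] \<in> rect (\<alpha> j) (\<beta> j) (c j) (d j)" using J(2)[OF j] by (simp add: rect_def)
      then have ne: "cbox (vector [\<alpha> j, c j]) (vector [\<beta> j, d j]) \<noteq> ({} :: (real^2) set)" unfolding rect_cbox by blast
      have "measure lebesgue (rect (\<alpha> j) (\<beta> j) (c j) (d j)) = measure lborel (cbox (vector [\<alpha> j, c j]) (vector [\<beta> j, d j]) :: (real^2) set)"
        unfolding rect_cbox by simp
      also have "\<dots> = (\<beta> j - \<alpha> j) * (d j - c j)" unfolding content_cbox_cart[OF ne] by (simp add: UNIV_2)
      finally show ?thesis .
    qed
    have "measure lebesgue K \<le> measure lebesgue (\<Union>j\<in>J. rect (\<alpha> j) (\<beta> j) (c j) (d j))"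
      using J(1) lmeasurable_compact[OF compact_rect] fmeasurableD[OF Kl]
      by (intro measure_mono_fmeasurable[OF J(5)] fmeasurable.finite_UN) auto
    also have "\<dots> \<le> (\<Sum>j\<in>J. measure lebesgue (rect (\<alpha> j) (\<beta> j) (c j) (d j)))"
      using J(1) lmeasurable_compact[OF compact_rect] by (intro measure_UNION_le) (auto dest: fmeasurableD)
    also have "\<dots> = (\<Sum>j\<in>J. (\<beta> j - \<alpha> j) * (d j - c j))" using area by (intro sum.cong) auto
    finally have mK': "measure lebesgue K \<le> (\<Sum>j\<in>J. (\<beta> j - \<alpha> j) * (d j - c j))" .
    have "(1 - 2 * \<epsilon>) * measure lebesgue K \<le> (1 - 2 * \<epsilon>) * (\<Sum>j\<in>J. (\<beta> j - \<alpha> j) * (d j - c j))"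
      using mK' \<epsilon> by (intro mult_left_mono) auto
    also have "\<dots> = (\<Sum>j\<in>J. (1 - 2 * \<epsilon>) * ((\<beta> j - \<alpha> j) * (d j - c j)))" by (rule sum_distrib_left)
    also have "\<dots> \<le> (\<Sum>j\<in>J. (1 - \<epsilon>) * (\<beta> j - \<alpha> j) * (d j - c j - 2 * \<theta> j))"
    proof (rule sum_mono)
      fix j assume j: "j \<in> J"
      have pos: "0 \<le> (\<beta> j - \<alpha> j) * (d j - c j)" using J(2)[OF j] by simp
      have e2: "0 \<le> \<epsilon> * \<epsilon>" by simp
      have "1 - 2 * \<epsilon> \<le> (1 - \<epsilon>) * (1 - \<epsilon> / 2)" using \<epsilon> e2 by (simp add: field_simps)
      then have "(1 - 2 * \<epsilon>) * ((\<beta> j - \<alpha> j) * (d j - c j)) \<le> (1 - \<epsilon>) * (1 - \<epsilon> / 2) * ((\<beta> j - \<alpha> j) * (d j - c j))"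
        using pos by (rule mult_right_mono)
      also have "\<dots> = (1 - \<epsilon>) * (\<beta> j - \<alpha> j) * (d j - c j - 2 * \<theta> j)" by (simp add: \<theta>_def field_simps)
      finally show "(1 - 2 * \<epsilon>) * ((\<beta> j - \<alpha> j) * (d j - c j)) \<le> (1 - \<epsilon>) * (\<beta> j - \<alpha> j) * (d j - c j - 2 * \<theta> j)" .
    qed
    also have "\<dots> \<le> measure lebesgue good" by (rule measure_good)
    finally have mg: "(1 - 2 * \<epsilon>) * measure lebesgue K \<le> measure lebesgue good" .
    have "(1 - 2 * \<epsilon>) * (measure lebesgue \<Omega> - \<epsilon>) \<le> (1 - 2 * \<epsilon>) * measure lebesgue K"
      using mK \<epsilon> by (intro mult_left_mono) auto
    moreover have "(1 - 2 * \<epsilon>) * (measure lebesgue \<Omega> - \<epsilon>) = measure lebesgue \<Omega> - 2 * \<epsilon> * measure lebesgue \<Omega> - \<epsilon> + 2 * (\<epsilon> * \<epsilon>)"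
      by (simp add: algebra_simps)
    moreover have "0 \<le> \<epsilon> * \<epsilon>" by simp
    moreover have "measure lebesgue (\<Omega> - good) = measure lebesgue \<Omega> - measure lebesgue good"
      using measurable_measure_Diff[OF \<Omega>l good_sets good_subset] by simp
    ultimately have "measure lebesgue (\<Omega> - good) \<le> 2 * \<epsilon> * measure lebesgue \<Omega> + \<epsilon>" using mg by linarith
    then have "resistance \<Omega> body \<le> 3 * \<epsilon> * measure lebesgue \<Omega> + \<epsilon>" using resistance_body by linarith
    then show thesis by (rule that[OF body_in_dic_bodies])
  qed
qed

text \<open>In \<open>ereal\<close> the infimum over an empty class is infinite, so the value
  \<open>0\<close> also says that both classes are nonempty.\<close>

theorem theorem3:
  fixes \<Omega> :: "(real^2) set" and M :: real
  assumes "convex \<Omega>" and "open \<Omega>" and "bounded \<Omega>" and "M > 0"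
  shows "(INF B\<in>bodies \<Omega> M. ereal (resistance \<Omega> B)) = 0
       \<and> (INF B\<in>dic_bodies \<Omega> M. ereal (resistance \<Omega> B)) = 0"
proof -
  have sub: "dic_bodies \<Omega> M \<subseteq> bodies \<Omega> M" by (auto simp: dic_bodies_def)
  have ge: "0 \<le> (INF B\<in>bodies \<Omega> M. ereal (resistance \<Omega> B))"
    by (intro INF_greatest) (simp add: resistance_nonneg)
  have le: "(INF B\<in>bodies \<Omega> M. ereal (resistance \<Omega> B)) \<le> (INF B\<in>dic_bodies \<Omega> M. ereal (resistance \<Omega> B))"
    using sub by (rule INF_superset_mono) simp
  have "(INF B\<in>dic_bodies \<Omega> M. ereal (resistance \<Omega> B)) \<le> 0"
  proof (rule ereal_le_epsilon2)
    fix e :: real assume e: "0 < e"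
    define m where "m = measure lebesgue \<Omega>"
    have m: "0 \<le> m" by (simp add: m_def)
    \<comment> \<open>Makes \<open>3 * \<epsilon> * m + \<epsilon>\<close> at most \<open>e\<close>,
      within the range \<open>\<epsilon> \<le> 1/16\<close> for which arrays are built.\<close>
    define \<epsilon> where "\<epsilon> = min (1/16) (e / (3 * m + 1))"
    have "0 < e / (3 * m + 1)" using e m by simp
    then have \<epsilon>: "0 < \<epsilon>" "\<epsilon> \<le> 1/16" "\<epsilon> \<le> e / (3 * m + 1)"
      unfolding \<epsilon>_def by (simp_all only: min_less_iff_conj min.cobounded1 min.cobounded2) simp_all
    obtain B where B: "B \<in> dic_bodies \<Omega> M" "resistance \<Omega> B \<le> 3 * \<epsilon> * m + \<epsilon>"
      unfolding m_def using small_resistance[OF assms \<epsilon>(1,2)] by blast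
    have "\<epsilon> * (3 * m + 1) \<le> e" using \<epsilon>(3) m by (simp add: le_divide_eq)
    then have "resistance \<Omega> B \<le> e" using B(2) by (simp add: algebra_simps)
    then show "(INF B\<in>dic_bodies \<Omega> M. ereal (resistance \<Omega> B)) \<le> 0 + ereal e"
      using B(1) by (intro INF_lower2[of B]) simp_all
  qed
  then show ?thesis using ge le by (metis antisym order_trans)
qed

end
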